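(* Let $p\in\{1,2,3,5,7\}$, let $k$ be an even integer, and let $f\in M^!_k(\Gamma_0^*(p))$ be a nonzero weakly holomorphic modular form of weight $k$ for $\Gamma_0^*(p)$ whose Fourier coefficients $a_f(n)$ are all real. Assume that $f$ has at least one zero in the upper half-plane $\mathbb{H}$ and that every zero of $f$ lying in the standard fundamental domain $\mathcal{F}_p$ lies on the lower boundary $\mathcal{A}_p$. Then every zero of the Serre derivative $\vartheta_k(f)$ lying in $\mathcal{F}_p$ also lies on $\mathcal{A}_p$.
   Context: $\mathbb{H}$ is the upper half-plane, $q=e^{2\pi i\tau}$, and $D=\frac{1}{2\pi i}\frac{d}{d\tau}$. For $p$ equal to $1$ or a prime, $\Gamma_0(p)=\{\begin{psmallmatrix}a&b\\c&d\end{psmallmatrix}\in SL_2(\mathbb{Z}) : c\equiv 0 \pmod p\}$ and the Fricke group is $\Gamma_0^*(p)=\Gamma_0(p)\cup\Gamma_0(p)\begin{psmallmatrix}0&-1/\sqrt{p}\\ \sqrt{p}&0\end{psmallmatrix}$. A weakly holomorphic modular form of weight $k\in\mathbb{Z}$ for $\Gamma_0^*(p)$ is a holomorphic $f:\mathbb{H}\to\mathbb{C}$ with $f(\frac{a\tau+b}{c\tau+d})=(c\tau+d)^kf(\tau)$ for all $\begin{psmallmatrix}a&b\\c&d\end{psmallmatrix}\in\Gamma_0^*(p)$ and with Fourier expansion $f(\tau)=\sum_{n\in\mathbb{Z}}a_f(n)q^n$ where $a_f(n)=0$ for all $n$ below some $n_0$; the space of these is $M^!_k(\Gamma_0^*(p))$.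 Let $E_2(\tau)=1-24\sum_{n\ge1}\big(\sum_{d\mid n}d\big)q^n$ and $E_{2,p}(\tau)=\frac{1}{p+1}(pE_2(p\tau)+E_2(\tau))$. The Serre derivative of weight $k$ is $\vartheta_k(f)=Df-\frac{p+1}{24}kE_{2,p}f$. For $p\in\{1,2,3\}$: $\mathcal{F}_p=\{\tau\in\mathbb{H}: |\tau|\ge 1/\sqrt p,\ -1/2\le \mathrm{Re}\,\tau\le 0\}\cup\{\tau\in\mathbb{H}: |\tau|>1/\sqrt p,\ 0<\mathrm{Re}\,\tau<1/2\}$ and $\mathcal{A}_p=\{\tau\in\mathcal{F}_p: |\tau|=1/\sqrt p,\ -1/2\le\mathrm{Re}\,\tau\le 0\}$. For $p\in\{5,7\}$: $\mathcal{F}_p=\{\tau\in\mathbb{H}: |\tau|\ge 1/\sqrt p,\ |\tau+1/2|\ge \frac{1}{2\sqrt p},\ -1/2\le\mathrm{Re}\,\tau\le0\}\cup\{\tau\in\mathbb{H}: |\tau|>1/\sqrt p,\ |\tau-1/2|>\frac{1}{2\sqrt p},\ 0<\mathrm{Re}\,\tau<1/2\}$ and $\mathcal{A}_p=\{\tau\in\mathcal{F}_p: |\tau|=1/\sqrt p,\ -1/2\le\mathrm{Re}\,\tau\le0\}\cup\{\tau\in\mathcal{F}_p: |\tau+1/2|=\frac{1}{2\sqrt p},\ -1/2\le\mathrm{Re}\,\tau\le 0\}$. *)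

theory Defs
  imports "HOL-Analysis.Analysis"
begin

text \<open>Functions on the upper half-plane are total functions on \<^typ>\<open>complex\<close>; only their values
  on \<open>upper_half_plane\<close> matter.\<close>

definition upper_half_plane :: "complex set" where
  "upper_half_plane = {\<tau>. Im \<tau> > 0}"

definition mat2 :: "real \<Rightarrow> real \<Rightarrow> real \<Rightarrow> real \<Rightarrow> real ^ 2 ^ 2" where
  "mat2 a b c d = vector [vector [a, b], vector [c, d]]"

definition Gamma0 :: "nat \<Rightarrow> (real ^ 2 ^ 2) set" where
  "Gamma0 p = {mat2 (of_int a) (of_int b) (of_int c) (of_int d) | a b c d :: int.
     a * d - b * c = 1 \<and> int p dvd c}"

definition Fricke_group :: "nat \<Rightarrow> (real ^ 2 ^ 2) set" where
  "Fricke_group p =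
     Gamma0 p \<union> (\<lambda>A. A ** mat2 0 (- 1 / sqrt (real p)) (sqrt (real p)) 0) ` Gamma0 p"

definition automorphy_factor :: "real ^ 2 ^ 2 \<Rightarrow> complex \<Rightarrow> complex" where
  "automorphy_factor A \<tau> = of_real (A $ 2 $ 1) * \<tau> + of_real (A $ 2 $ 2)"

definition moebius_action :: "real ^ 2 ^ 2 \<Rightarrow> complex \<Rightarrow> complex" where
  "moebius_action A \<tau> =
     (of_real (A $ 1 $ 1) * \<tau> + of_real (A $ 1 $ 2)) / automorphy_factor A \<tau>"

definition nome :: "complex \<Rightarrow> complex" where
  "nome \<tau> = exp (2 * of_real pi * \<i> * \<tau>)"

text \<open>\<open>has_fourier_expansion f a\<close> says that \<open>a n\<close> (\<open>n \<in> \<int>\<close>) are the Fourier coefficients of \<open>f\<close>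
  and that only finitely many of those with negative index are nonzero.  Such an \<open>a\<close> is uniquely
  determined by the values of \<open>f\<close> on the upper half-plane.\<close>

definition has_fourier_expansion :: "(complex \<Rightarrow> complex) \<Rightarrow> (int \<Rightarrow> complex) \<Rightarrow> bool" where
  "has_fourier_expansion f a \<longleftrightarrow>
     (\<exists>n0. \<forall>n<n0. a n = 0) \<and>
     (\<forall>\<tau>\<in>upper_half_plane. ((\<lambda>n. a n * nome \<tau> powi n) has_sum f \<tau>) UNIV)"

definition weakly_holomorphic_forms :: "int \<Rightarrow> nat \<Rightarrow> (complex \<Rightarrow> complex) set" where
  "weakly_holomorphic_forms k p = {f.
     f holomorphic_on upper_half_plane \<and>
     (\<forall>A\<in>Fricke_group p. \<forall>\<tau>\<in>upper_half_plane.
        f (moebius_action A \<tau>) = automorphy_factor A \<tau> powi k * f \<tau>) \<and>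
     (\<exists>a. has_fourier_expansion f a)}"

definition E2 :: "complex \<Rightarrow> complex" where
  "E2 \<tau> = 1 - 24 * (\<Sum>n. of_nat (\<Sum>d | d dvd Suc n. d) * nome \<tau> ^ Suc n)"

definition E2p :: "nat \<Rightarrow> complex \<Rightarrow> complex" where
  "E2p p \<tau> = 1 / of_nat (p + 1) * (of_nat p * E2 (of_nat p * \<tau>) + E2 \<tau>)"

definition D_op :: "(complex \<Rightarrow> complex) \<Rightarrow> complex \<Rightarrow> complex" where
  "D_op f \<tau> = 1 / (2 * of_real pi * \<i>) * deriv f \<tau>"

definition serre_derivative ::
    "nat \<Rightarrow> int \<Rightarrow> (complex \<Rightarrow> complex) \<Rightarrow> complex \<Rightarrow> complex" where
  "serre_derivative p k f \<tau> =
     D_op f \<tau> - of_nat (p + 1) / 24 * of_int k * E2p p \<tau> * f \<tau>"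

text \<open>The next two definitions are meant for \<open>p \<in> {1, 2, 3, 5, 7}\<close> only; the \<open>else\<close> branches
  are the cases \<open>p = 5\<close> and \<open>p = 7\<close>.\<close>

definition fundamental_domain :: "nat \<Rightarrow> complex set" where
  "fundamental_domain p =
     (if p \<in> {1, 2, 3} then
        {\<tau> \<in> upper_half_plane. norm \<tau> \<ge> 1 / sqrt (real p) \<and> - 1 / 2 \<le> Re \<tau> \<and> Re \<tau> \<le> 0} \<union>
        {\<tau> \<in> upper_half_plane. norm \<tau> > 1 / sqrt (real p) \<and> 0 < Re \<tau> \<and> Re \<tau> < 1 / 2}
      else
        {\<tau> \<in> upper_half_plane. norm \<tau> \<ge> 1 / sqrt (real p) \<and>
           norm (\<tau> + 1 / 2) \<ge> 1 / (2 * sqrt (real p)) \<and> - 1 / 2 \<le> Re \<tau> \<and> Re \<tau> \<le> 0} \<union>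
        {\<tau> \<in> upper_half_plane. norm \<tau> > 1 / sqrt (real p) \<and>
           norm (\<tau> - 1 / 2) > 1 / (2 * sqrt (real p)) \<and> 0 < Re \<tau> \<and> Re \<tau> < 1 / 2})"

definition lower_boundary :: "nat \<Rightarrow> complex set" where
  "lower_boundary p =
     (if p \<in> {1, 2, 3} then
        {\<tau> \<in> fundamental_domain p. norm \<tau> = 1 / sqrt (real p) \<and> - 1 / 2 \<le> Re \<tau> \<and> Re \<tau> \<le> 0}
      else
        {\<tau> \<in> fundamental_domain p. norm \<tau> = 1 / sqrt (real p) \<and> - 1 / 2 \<le> Re \<tau> \<and> Re \<tau> \<le> 0} \<union>
        {\<tau> \<in> fundamental_domain p. norm (\<tau> + 1 / 2) = 1 / (2 * sqrt (real p)) \<and>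
           - 1 / 2 \<le> Re \<tau> \<and> Re \<tau> \<le> 0})"

end

theory Submission
  imports Defs "HOL-Complex_Analysis.Complex_Analysis"
begin

text \<open>Let \<open>h = \<vartheta>\<^sub>k(f) / f\<close>. It has weight 2 without any correction term, because \<open>h\<close> is the
  logarithmic derivative of the weight 0 function \<open>f(\<tau>) / (\<eta>(\<tau>) \<eta>(p\<tau>))\<^sup>k\<close>, and since the
  Fourier coefficients are real it satisfies \<open>h(- cnj \<tau>) = cnj (h \<tau>)\<close>. Hence \<open>h\<close> is real on the vertical sides of the left half
  \<open>\<Omega>\<close> of the fundamental domain, and \<open>(\<tau> - c) h\<close> is real on each bounding arc with centre \<open>c\<close>. The
  only poles of \<open>h\<close> near \<open>\<Omega>\<close> lie on the arcs and have positive residue up to the factor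
  \<open>2 \<pi> \<i>\<close>, so that \<open>Im ((\<tau> - c) h)\<close> has nonpositive upper limit when an arc is approached from \<open>\<Omega>\<close>.

  First, let \<open>H\<close> be a primitive of \<open>h\<close>. Its real part is constant on each vertical side and by
  the preceding remark monotone along the arcs up to \<open>\<epsilon>\<close>, so the maximum principle bounds it by these two
  constants on \<open>\<Omega>\<close>; this forces \<open>h \<le> 0\<close> on both vertical sides. Secondly, choose a rational function \<open>X\<close> such
  that \<open>X / (\<tau> - c)\<close> is positive on the arcs and \<open>Im X > 0\<close> on the vertical sides: \<open>X = \<tau>\<close> if \<open>p \<le> 3\<close>, and
  a function with a pole at the elliptic point where the two arcs meet if \<open>p = 5, 7\<close>. Then \<open>Im (X h) \<le> 0\<close> on
  the boundary of \<open>\<Omega>\<close>, so \<open>Im (X h) < 0\<close> inside \<open>\<Omega>\<close> and \<open>h\<close> does not vanish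
  there. A zero on a vertical side would be a double zero as \<open>h \<le> 0\<close> on that side, which is incompatible with
  \<open>Im (X h) < 0\<close> on a half-disc.\<close>

section \<open>The transformation behaviour of the quasimodular form of weight 2\<close>

text \<open>The poles on the arcs shape the proof: neither \<open>H\<close> nor \<open>X h\<close>
  need extend to the closed half domain, so boundary statements are upper limits taken from inside,
  and \<open>Re H\<close> is compared along concentric arcs of slightly larger radius. The tangent
  of a side is vertical, so a real \<open>h\<close> there makes \<open>Re H\<close> constant, while
  along an arc the angular derivative of \<open>Re H\<close> is
  \<open>- Im ((\<tau> - c) h)\<close>. The left side carries the upper and the right side the lower
  bound of \<open>Re H\<close>; hence its horizontal derivative \<open>Re h\<close> is nonpositive
  on both. Crossing the strip far up gives the same sign to the value of \<open>h\<close> at the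
  cusp, which controls \<open>X h\<close> there although \<open>X\<close> grows.

  At levels 5 and 7 the linear choices \<open>\<tau>\<close> and \<open>\<tau> + 1/2\<close> each
  suit only one arc. In a coordinate \<open>v\<close> that straightens both arcs to rays from 0,
  \<open>v^n\<close> is real on both, so \<open>\<i> / (v^n)'\<close> is normal to both; its pole at
  the corner costs an expansion of \<open>h\<close> there. The zero of \<open>f\<close> excludes
  that \<open>f\<close> is a multiple of the k-th power of the eta product, for which
  \<open>h\<close> vanishes identically.\<close>

lemma has_sum_int_split:
  fixes f :: "int \<Rightarrow> 'a::{topological_comm_monoid_add,t3_space}"
  assumes "((\<lambda>n::nat. f (int n)) has_sum a) UNIV" "((\<lambda>n::nat. f (- 1 - int n)) has_sum b) UNIV"
  shows "(f has_sum (a + b)) UNIV"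
proof -
  have 1: "(f has_sum a) {0..}"
  proof -
    have "(f has_sum a) (range int)"
      by (subst has_sum_reindex) (use assms(1) in \<open>auto simp: o_def\<close>)
    moreover have "range int = {0..}"
      by (auto simp: image_iff intro: nonneg_int_cases)
    ultimately show ?thesis by simp
  qed
  have 2: "(f has_sum b) {..<0}"
  proof -
    have "inj (\<lambda>n. - 1 - int n)" by (auto simp: inj_on_def)
    hence "(f has_sum b) (range (\<lambda>n. - 1 - int n))"
      by (subst has_sum_reindex) (use assms(2) in \<open>auto simp: o_def\<close>)
    moreover have "range (\<lambda>n. - 1 - int n) = {..<0}"
    proof (intro equalityI subsetI)
      fix x :: int assume "x \<in> {..<0}"
      hence "x = - 1 - int (nat (- 1 - x))" by simp
      thus "x \<in> range (\<lambda>n. - 1 - int n)" by blast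
    qed auto
    ultimately show ?thesis by simp
  qed
  have "(f has_sum (a + b)) ({0..} \<union> {..<0})"
    by (rule has_sum_Un_disjoint[OF 1 2]) auto
  moreover have "{0..} \<union> {..<0} = (UNIV :: int set)" by auto
  ultimately show ?thesis by simp
qed

lemma has_sum_diff:
  fixes f g :: "'a \<Rightarrow> 'b::topological_ab_group_add"
  assumes "(f has_sum a) A" "(g has_sum b) A"
  shows "((\<lambda>x. f x - g x) has_sum (a - b)) A"
proof -
  have "((\<lambda>x. - g x) has_sum - b) A" using assms(2) by (simp add: has_sum_uminus)
  from has_sum_add[OF assms(1) this] show ?thesis by simp
qed

section \<open>Partial fractions of the cotangent and of the squared cosecant\<close>

text \<open>Logarithmic derivative of the reflection formula of the Gamma function. With
  \<open>rGamma\<close> both sides are entire, so the derivatives can be compared directly before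
  dividing by the sine.\<close>

lemma Digamma_reflection:
  fixes z :: complex
  assumes "z \<notin> \<int>"
  shows "Digamma (1 - z) - Digamma z = of_real pi * cot (of_real pi * z)"
proof -
  have z: "z \<notin> \<int>\<^sub>\<le>\<^sub>0" "1 - z \<notin> \<int>\<^sub>\<le>\<^sub>0"
    using assms nonpos_Ints_subset_Ints Ints_diff[of 1 "1 - z"] by auto
  have *: "rGamma z * rGamma (1 - z) = sin (of_real pi * z) / of_real pi" for z :: complex
    by (simp add: rGamma_reflection_complex)
  have "((\<lambda>z. rGamma z * rGamma (1 - z)) has_field_derivative
          (- Digamma z * rGamma z * rGamma (1 - z) + Digamma (1 - z) * rGamma z * rGamma (1 - z))) (at z)"
    using z by (auto intro!: derivative_eq_intros simp: algebra_simps)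
  hence "((\<lambda>z. sin (of_real pi * z) / of_real pi) has_field_derivative
          ((Digamma (1 - z) - Digamma z) * (sin (of_real pi * z) / of_real pi))) (at z)"
    unfolding * by (simp only: *[symmetric]) (simp add: algebra_simps)
  moreover have "((\<lambda>z::complex. sin (of_real pi * z) / of_real pi) has_field_derivative
          cos (of_real pi * z)) (at z)"
    by (auto intro!: derivative_eq_intros)
  ultimately have "(Digamma (1 - z) - Digamma z) * (sin (of_real pi * z) / of_real pi) = cos (of_real pi * z)"
    by (rule DERIV_unique)
  moreover have "sin (of_real pi * z) \<noteq> 0"
    using * z by (metis mult_eq_0_iff rGamma_eq_zero_iff divide_eq_0_iff)
  ultimately show ?thesis by (simp add: cot_def field_simps)
qed

lemma sin_pi_nonzero: "z \<notin> \<int> \<Longrightarrow> sin (of_real pi * z) \<noteq> (0 :: complex)"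
proof -
  assume "z \<notin> \<int>"
  hence z: "z \<notin> \<int>\<^sub>\<le>\<^sub>0" "1 - z \<notin> \<int>\<^sub>\<le>\<^sub>0"
    using nonpos_Ints_subset_Ints Ints_diff[of 1 "1 - z"] by auto
  thus ?thesis using rGamma_reflection_complex[of z]
    by (metis mult_eq_0_iff rGamma_eq_zero_iff divide_eq_0_iff)
qed

lemma Trigamma_reflection:
  fixes z :: complex
  assumes "z \<notin> \<int>"
  shows "Polygamma 1 z + Polygamma 1 (1 - z) = of_real pi ^ 2 / sin (of_real pi * z) ^ 2"
proof -
  have z: "z \<notin> \<int>\<^sub>\<le>\<^sub>0" "1 - z \<notin> \<int>\<^sub>\<le>\<^sub>0"
    using assms nonpos_Ints_subset_Ints Ints_diff[of 1 "1 - z"] by auto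
  have "((\<lambda>z. Digamma (1 - z) - Digamma z) has_field_derivative
          (- Polygamma 1 (1 - z) - Polygamma 1 z)) (at z)"
    using z by (auto intro!: derivative_eq_intros)
  hence "((\<lambda>z. of_real pi * cot (of_real pi * z)) has_field_derivative
          (- Polygamma 1 (1 - z) - Polygamma 1 z)) (at z)"
  proof (rule has_field_derivative_transform_within_open)
    show "open (- \<int> :: complex set)" by (simp add: closed_Ints open_Compl)
  qed (use assms Digamma_reflection in auto)
  moreover have "((\<lambda>z. of_real pi * cot (of_real pi * z)) has_field_derivative
      (- (of_real pi ^ 2 / sin (of_real pi * z) ^ 2))) (at z)"
    using DERIV_cmult[OF DERIV_chain2[OF DERIV_cot DERIV_cmult[OF DERIV_ident]], OF sin_pi_nonzero[OF assms]]
    by (simp add: power2_eq_square field_simps)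
  ultimately have "- Polygamma 1 (1 - z) - Polygamma 1 z = - (of_real pi ^ 2 / sin (of_real pi * z) ^ 2)"
    by (rule DERIV_unique)
  thus ?thesis by (simp add: algebra_simps)
qed

text \<open>Absolute summability is the point: the terms are later regrouped over all integers,
  which a merely convergent series would not permit.\<close>

lemma Polygamma_1_has_sum:
  fixes z :: complex
  assumes "z \<notin> \<int>\<^sub>\<le>\<^sub>0"
  shows "((\<lambda>n. 1 / (z + of_nat n) ^ 2) has_sum Polygamma 1 z) UNIV"
proof (rule norm_summable_imp_has_sum)
  have z0: "z \<noteq> 0" using assms by auto
  show "(\<lambda>n. 1 / (z + of_nat n) ^ 2) sums Polygamma 1 z"
    using Polygamma_LIMSEQ[of z 1] z0 by (simp add: inverse_eq_divide power2_eq_square)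
  have "summable (\<lambda>n. 1 / (real n) ^ 2)"
    using inverse_power_summable[of 2, where 'a=real] by (simp add: inverse_eq_divide)
  hence "summable (\<lambda>n. 4 * (1 / (real n) ^ 2))" by (rule summable_mult)
  \<comment> \<open>For \<open>n >= 2 * norm z\<close> one has \<open>norm (z + n) >= n / 2\<close>,
    whence the factor 4.\<close>
  moreover have "eventually (\<lambda>n. norm (norm (1 / (z + of_nat n) ^ 2)) \<le> 4 * (1 / (real n) ^ 2)) sequentially"
    using eventually_ge_at_top[of "nat \<lceil>2 * norm z\<rceil> + 1"]
  proof eventually_elim
    case (elim n)
    have n: "real n \<ge> 2 * norm z" "n > 0" using elim by linarith+
    have "real n / 2 \<le> norm (z + of_nat n)"
      using norm_triangle_ineq4[of "z + of_nat n" z] n by simp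
    hence "(real n / 2) ^ 2 \<le> norm (z + of_nat n) ^ 2" by (intro power_mono) auto
    moreover have "norm (z + of_nat n) > 0"
      using \<open>real n / 2 \<le> norm (z + of_nat n)\<close> n by linarith
    ultimately show ?case using n by (simp add: norm_divide norm_power field_simps)
  qed
  ultimately show "summable (\<lambda>n. norm (1 / (z + of_nat n) ^ 2))"
    by (rule summable_comparison_test_ev[rotated])
qed

text \<open>The integers \<open>n >= 0\<close> contribute \<open>Polygamma 1 z\<close>, the negative
  ones \<open>Polygamma 1 (1 - z)\<close>, and the reflection formula adds the two.\<close>

lemma csc_squared_partial_fractions:
  fixes z :: complex
  assumes "z \<notin> \<int>"
  shows "((\<lambda>n. 1 / (z + of_int n) ^ 2) has_sum (of_real pi ^ 2 / sin (of_real pi * z) ^ 2)) UNIV"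
proof -
  have z: "z \<notin> \<int>\<^sub>\<le>\<^sub>0" "1 - z \<notin> \<int>\<^sub>\<le>\<^sub>0"
    using assms nonpos_Ints_subset_Ints Ints_diff[of 1 "1 - z"] by auto
  have "((\<lambda>n. 1 / (z + of_int n) ^ 2) has_sum (Polygamma 1 z + Polygamma 1 (1 - z))) UNIV"
  proof (rule has_sum_int_split)
    show "((\<lambda>n. 1 / (z + of_int (int n))\<^sup>2) has_sum Polygamma 1 z) UNIV"
      using Polygamma_1_has_sum[OF z(1)] by simp
    have "(1 - z + of_nat n)^2 = (z + of_int (- 1 - int n))^2" for n
      by (simp add: power2_eq_square algebra_simps)
    thus "((\<lambda>n. 1 / (z + of_int (- 1 - int n))\<^sup>2) has_sum Polygamma 1 (1 - z)) UNIV"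
      using Polygamma_1_has_sum[OF z(2)] by simp
  qed
  thus ?thesis by (simp only: Trigamma_reflection[OF assms])
qed

text \<open>The series is not absolutely convergent, so only a limit along windows is available. The
  half-open window contains \<open>N\<close> nonnegative and \<open>N\<close> negative integers, so
  the two terms \<open>ln N\<close> in the limit formula of \<open>Digamma\<close> cancel.\<close>

lemma cot_partial_fractions:
  fixes z :: complex
  assumes "z \<notin> \<int>"
  shows "(\<lambda>N::nat. \<Sum>m\<in>{-int N..<int N}. 1 / (z + of_int m)) \<longlonglongrightarrow> of_real pi * cot (of_real pi * z)"
proof -
  have z: "z \<noteq> 0" "1 - z \<noteq> 0"
    using assms by auto
  have eq: "(\<Sum>m\<in>{-int N..<int N}. 1 / (z + of_int m)) =
        (\<Sum>n<N. inverse (z + of_nat n)) - (\<Sum>n<N. inverse (1 - z + of_nat n))" for N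
  proof -
    have "(\<Sum>m\<in>{-int N..<int N}. 1 / (z + of_int m)) =
          (\<Sum>m\<in>{0..<int N}. 1 / (z + of_int m)) + (\<Sum>m\<in>{-int N..<0}. 1 / (z + of_int m))"
      by (subst sum.union_disjoint [symmetric]) (auto intro!: sum.cong)
    also have "(\<Sum>m\<in>{0..<int N}. 1 / (z + of_int m)) = (\<Sum>n<N. inverse (z + of_nat n))"
      by (rule sum.reindex_bij_witness[of _ int nat]) (auto simp: inverse_eq_divide)
    also have "(\<Sum>m\<in>{-int N..<0}. 1 / (z + of_int m)) = (\<Sum>n<N. - inverse (1 - z + of_nat n))"
    proof (rule sum.reindex_bij_witness[of _ "\<lambda>n. - 1 - int n" "\<lambda>m. nat (- 1 - m)"])
      fix m assume m: "m \<in> {-int N..<0}"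
      have "1 - z + of_nat (nat (- 1 - m)) = - (z + of_int m)"
        using m by (simp add: of_nat_nat)
      thus "- inverse (1 - z + of_nat (nat (- 1 - m))) = 1 / (z + of_int m)"
        by (simp only: inverse_minus_eq minus_minus flip: inverse_eq_divide)
    qed auto
    finally show ?thesis by (simp add: sum_negf)
  qed
  show ?thesis
    using tendsto_diff[OF Digamma_LIMSEQ[OF z(2)] Digamma_LIMSEQ[OF z(1)]]
    unfolding eq Digamma_reflection[OF assms] by (simp add: algebra_simps)
qed

lemma filterlim_int_intervals:
  "filterlim (\<lambda>N::nat. {-int N..<int N}) (finite_subsets_at_top UNIV) sequentially"
  unfolding filterlim_finite_subsets_at_top
proof (intro allI impI)
  fix X :: "int set" assume "finite X \<and> X \<subseteq> UNIV"
  hence X: "finite X" by simp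
  define K where "K = nat (\<Sum>x\<in>X. \<bar>x\<bar>) + 1"
  have "X \<subseteq> {-int N..<int N}" if "N \<ge> K" for N
  proof
    fix x assume "x \<in> X"
    hence "\<bar>x\<bar> \<le> (\<Sum>x\<in>X. \<bar>x\<bar>)" using X by (intro member_le_sum) auto
    thus "x \<in> {-int N..<int N}" using that by (auto simp: K_def)
  qed
  thus "\<forall>\<^sub>F N in sequentially. finite {-int N..<int N} \<and> X \<subseteq> {-int N..<int N} \<and> {-int N..<int N} \<subseteq> UNIV"
    unfolding eventually_sequentially by blast
qed

lemma has_sum_int_limit:
  assumes "(f has_sum s) (UNIV :: int set)"
  shows "(\<lambda>N::nat. \<Sum>n\<in>{-int N..<int N}. f n) \<longlonglongrightarrow> s"
  using filterlim_compose[OF assms[unfolded has_sum_def] filterlim_int_intervals] by simp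

lemma sum_int_telescope:
  fixes u :: "int \<Rightarrow> 'a::ab_group_add"
  shows "(\<Sum>n\<in>{-int N..<int N}. u n - u (n + 1)) = u (- int N) - u (int N)"
proof (induction N)
  case (Suc N)
  have *: "{-int (Suc N)..<int (Suc N)} = insert (-int (Suc N)) (insert (int N) {-int N..<int N})"
    by auto
  show ?case unfolding * using Suc.IH by (simp add: algebra_simps)
qed auto

text \<open>Since the sum exists unconditionally it may be evaluated along the windows
  \<open>{-N..<N}\<close>, where only two boundary terms survive. Different limits at the two ends
  will be the source of the correction term of \<open>E2\<close>.\<close>

lemma has_sum_int_telescope:
  fixes u :: "int \<Rightarrow> 'a::real_normed_vector"
  assumes "((\<lambda>n. u n - u (n + 1)) has_sum s) UNIV"
    and "(\<lambda>N::nat. u (int N)) \<longlonglongrightarrow> a" "(\<lambda>N::nat. u (- int N)) \<longlonglongrightarrow> b"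
  shows "s = b - a"
  using LIMSEQ_unique[OF has_sum_int_limit[OF assms(1)]] tendsto_diff[OF assms(3,2)]
  by (simp add: sum_int_telescope)

lemma has_sum_int_even:
  fixes f :: "int \<Rightarrow> complex"
  assumes "\<And>n. f (- n) = f n" "((\<lambda>n::nat. f (int n)) has_sum a) {1..}"
  shows "(f has_sum (f 0 + 2 * a)) UNIV"
proof -
  have "((\<lambda>n::nat. f (int n)) has_sum (f (int 0) + a)) (insert 0 {1..})"
    using assms(2) by (subst has_sum_insert) auto
  moreover have "insert 0 {1..} = (UNIV :: nat set)" by auto
  ultimately have 1: "((\<lambda>n::nat. f (int n)) has_sum (f 0 + a)) UNIV" by simp
  have "((\<lambda>n::nat. f (- 1 - int n)) has_sum a) UNIV \<longleftrightarrow> ((\<lambda>n::nat. f (int n)) has_sum a) {1..}"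
  proof (rule has_sum_reindex_bij_witness[of _ "\<lambda>n. n - 1" Suc])
    fix n :: nat
    show "f (int (Suc n)) = f (- 1 - int n)"
      using assms(1)[of "int (Suc n)"] by (simp add: algebra_simps)
  qed auto
  with assms(2) have 2: "((\<lambda>n::nat. f (- 1 - int n)) has_sum a) UNIV" by simp
  show ?thesis using has_sum_int_split[OF 1 2] by (simp add: algebra_simps)
qed

section \<open>The Lambert series behind \<open>E2\<close>\<close>

lemma norm_nome: "norm (nome \<tau>) = exp (- 2 * pi * Im \<tau>)"
  by (simp add: nome_def)

lemma norm_nome_less_1: "Im \<tau> > 0 \<Longrightarrow> norm (nome \<tau>) < 1"
  by (simp add: norm_nome)

lemma nome_nonzero [simp]: "nome \<tau> \<noteq> 0"
  by (simp add: nome_def)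

text \<open>From \<open>(d - 1) * (e - 1) >= 0\<close> follows \<open>d + e <= d * e + 1\<close>, so
  with \<open>s = norm q\<close> the terms are dominated by
  \<open>(1 / s) * (d * s^d) * s^e\<close>, a product of two convergent series. The division by
  \<open>s\<close> is why \<open>q = 0\<close> is separate.\<close>

lemma abs_summable_lambert:
  fixes q :: complex
  assumes "norm q < 1"
  shows "(\<lambda>x. norm (case x of (d,e) \<Rightarrow> of_nat d * q ^ (d * e))) summable_on ({1..} \<times> {1..} :: (nat \<times> nat) set)"
proof (cases "q = 0")
  case True
  have "(\<lambda>x. norm (case x of (d,e) \<Rightarrow> of_nat d * q ^ (d * e))) summable_on ({1..} \<times> {1..}) \<longleftrightarrow>
        (\<lambda>x::nat \<times> nat. 0::real) summable_on ({1..} \<times> {1..})"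
    by (rule summable_on_cong) (use True in auto)
  thus ?thesis by simp
next
  case False
  define s where "s = norm q"
  have s: "0 < s" "s < 1" using False assms by (auto simp: s_def)
  have 1: "(\<lambda>n. s ^ n) summable_on (UNIV :: nat set)"
    using s by (subst summable_on_UNIV_nonneg_real_iff) (auto simp: summable_geometric)
  have "summable (\<lambda>n. of_nat (Suc n) * s ^ n)"
    using geometric_deriv_sums[of s] s by (auto simp: sums_iff)
  hence "summable (\<lambda>n. of_nat n * s ^ n)"
    by (rule summable_comparison_test[rotated]) (use s in \<open>auto intro!: exI[of _ 0] mult_right_mono\<close>)
  hence 2: "(\<lambda>n. of_nat n * s ^ n) summable_on (UNIV :: nat set)"
    using s by (subst summable_on_UNIV_nonneg_real_iff) auto
  have 3: "(\<lambda>(d,e). (of_nat d * s ^ d) * s ^ e) summable_on (UNIV \<times> UNIV :: (nat \<times> nat) set)"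
  proof (rule summable_on_SigmaI)
    show "((\<lambda>e. case (d, e) of (d, e) \<Rightarrow> of_nat d * s ^ d * s ^ e) has_sum
            (of_nat d * s ^ d * infsum (\<lambda>e. s ^ e) UNIV)) UNIV" for d
      using has_sum_cmult_right[OF has_sum_infsum[OF 1], of "of_nat d * s ^ d"] by simp
    show "(\<lambda>d. of_nat d * s ^ d * infsum (\<lambda>e. s ^ e) UNIV) summable_on UNIV"
      by (rule summable_on_cmult_left[OF 2])
  qed (use s in auto)
  have "(\<lambda>(d,e). inverse s * ((of_nat d * s ^ d) * s ^ e)) summable_on (UNIV \<times> UNIV :: (nat \<times> nat) set)"
    using summable_on_cmult_right[OF 3, of "inverse s"] by (simp add: case_prod_unfold)
  hence 4: "(\<lambda>(d,e). inverse s * ((of_nat d * s ^ d) * s ^ e)) summable_on ({1..} \<times> {1..} :: (nat \<times> nat) set)"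
    by (rule summable_on_subset_banach) auto
  show ?thesis
  proof (rule summable_on_comparison_test[OF 4], safe)
    fix d e :: nat assume de: "1 \<le> d" "1 \<le> e"
    obtain d' e' where [simp]: "d = Suc d'" "e = Suc e'"
      using de by (metis One_nat_def Suc_le_D)
    have "s ^ (d * e) * s \<le> s ^ (d + e)"
      using s power_decreasing[of "d + e" "Suc (d * e)" s] by (simp add: mult_ac)
    hence "s ^ (d * e) \<le> inverse s * (s ^ d * s ^ e)"
      using s by (simp add: field_simps power_add)
    hence "of_nat d * s ^ (d * e) \<le> of_nat d * (inverse s * (s ^ d * s ^ e))"
      by (intro mult_left_mono) auto
    thus "norm (of_nat d * q ^ (d * e)) \<le> inverse s * (of_nat d * s ^ d * s ^ e)"
      by (simp only: norm_mult norm_power norm_of_nat s_def mult_ac)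
  qed auto
qed

text \<open>Grouping the pairs by \<open>n = d * e\<close> produces the divisor sums of
  \<open>E2\<close>; grouping the same absolutely convergent family by \<open>e\<close> will produce
  cosecants.\<close>

lemma lambert_has_sum:
  fixes q :: complex
  assumes "norm q < 1"
  defines "S \<equiv> infsum (\<lambda>(d,e). of_nat d * q ^ (d * e)) ({1..} \<times> {1..} :: (nat \<times> nat) set)"
  shows "((\<lambda>(d,e). of_nat d * q ^ (d * e)) has_sum S) ({1..} \<times> {1..} :: (nat \<times> nat) set)"
    and "(\<lambda>n. of_nat (\<Sum>d | d dvd Suc n. d) * q ^ Suc n) sums S"
proof -
  show S: "((\<lambda>(d,e). of_nat d * q ^ (d * e)) has_sum S) ({1..} \<times> {1..} :: (nat \<times> nat) set)"
    unfolding S_def by (rule has_sum_infsum, rule abs_summable_summable, rule abs_summable_lambert[OF assms(1)])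
  have "((\<lambda>(d,e). of_nat d * q ^ (d * e)) has_sum S) ({1..} \<times> {1..} :: (nat \<times> nat) set) \<longleftrightarrow>
        ((\<lambda>(n,d). of_nat d * q ^ n) has_sum S) (Sigma {1..} (\<lambda>n. {d. d dvd n}))"
    by (rule has_sum_reindex_bij_witness[of _ "\<lambda>(n,d). (d, n div d)" "\<lambda>(d,e). (d * e, d)"])
       (auto simp: Suc_le_eq div_greater_zero_iff dvd_imp_le intro!: Nat.gr0I)
  with S have "((\<lambda>(n,d). of_nat d * q ^ n) has_sum S) (Sigma {1..} (\<lambda>n. {d. d dvd n}))" by simp
  hence "((\<lambda>n. of_nat (\<Sum>d | d dvd n. d) * q ^ n) has_sum S) {1..}"
    by (rule has_sum_SigmaD) (auto intro!: has_sum_finiteI simp: sum_distrib_right)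
  also have "?this \<longleftrightarrow> ((\<lambda>n. of_nat (\<Sum>d | d dvd Suc n. d) * q ^ Suc n) has_sum S) UNIV"
    by (rule has_sum_reindex_bij_witness[of _ Suc "\<lambda>n. n - 1"]) auto
  finally show "(\<lambda>n. of_nat (\<Sum>d | d dvd Suc n. d) * q ^ Suc n) sums S"
    by (rule has_sum_imp_sums)
qed

text \<open>For fixed \<open>e\<close> and \<open>w = q^e\<close> the sum of \<open>d * w^d\<close>
  is \<open>w / (1 - w)^2\<close>, which equals \<open>-1/4\<close> times the squared cosecant at
  \<open>pi * e * \<tau>\<close>.\<close>

lemma E2_csc_has_sum:
  assumes "Im \<tau> > 0"
  shows "((\<lambda>m::nat. 1 / sin (of_real pi * (of_nat m * \<tau>)) ^ 2) has_sum ((E2 \<tau> - 1) / 6)) {1..}"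
proof -
  define q where "q = nome \<tau>"
  have q: "norm q < 1" "q \<noteq> 0" using assms by (auto simp: q_def norm_nome_less_1)
  define S where "S = infsum (\<lambda>(d,e). of_nat d * q ^ (d * e)) ({1..} \<times> {1..} :: (nat \<times> nat) set)"
  note S = lambert_has_sum(1)[OF q(1), folded S_def]
  have E2: "E2 \<tau> = 1 - 24 * S"
    using lambert_has_sum(2)[OF q(1)] by (simp add: E2_def q_def S_def sums_iff)
  have "((\<lambda>(e,d). of_nat d * q ^ (d * e)) has_sum S) ({1..} \<times> {1..} :: (nat \<times> nat) set)"
    using S by (subst has_sum_swap) (simp add: case_prod_unfold)
  hence "((\<lambda>e. - 1 / 4 * (1 / sin (of_real pi * (of_nat e * \<tau>)) ^ 2)) has_sum S) {1..}"
  proof (rule has_sum_SigmaD)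
    fix e :: nat assume e: "e \<in> {1..}"
    define w where "w = q ^ e"
    have w: "norm w < 1" "w \<noteq> 0"
      using e q by (auto simp: w_def norm_power power_less_one_iff)
    have "(\<lambda>n. of_nat (Suc n) * w ^ n) sums (1 / (1 - w) ^ 2)"
      by (rule geometric_deriv_sums[OF w(1)])
    hence 1: "(\<lambda>n. w * (of_nat (Suc n) * w ^ n)) sums (w * (1 / (1 - w) ^ 2))"
      by (rule sums_mult)
    have "(\<lambda>n. of_nat (Suc n) * norm w ^ n) sums (1 / (1 - norm w) ^ 2)"
      by (rule geometric_deriv_sums) (use w in auto)
    hence 2: "summable (\<lambda>n. norm (w * (of_nat (Suc n) * w ^ n)))"
      by (subst norm_mult, intro summable_mult) (auto simp: norm_mult norm_power sums_iff simp del: of_nat_Suc)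
    have "((\<lambda>n. w * (of_nat (Suc n) * w ^ n)) has_sum (w * (1 / (1 - w) ^ 2))) UNIV"
      by (rule norm_summable_imp_has_sum[OF 2 1])
    also have "?this \<longleftrightarrow> ((\<lambda>d. of_nat d * w ^ d) has_sum (w * (1 / (1 - w) ^ 2))) {1..}"
      by (rule has_sum_reindex_bij_witness[of _ "\<lambda>n. n - 1" Suc]) (auto simp: algebra_simps)
    also have "w * (1 / (1 - w) ^ 2) = - 1 / 4 * (1 / sin (of_real pi * (of_nat e * \<tau>)) ^ 2)"
    proof -
      \<comment> \<open>A square root of \<open>w\<close>, in terms of which the sine is
        \<open>(v - 1/v) / (2 * \<i>)\<close>.\<close>
      define v where "v = exp (\<i> * (of_real pi * (of_nat e * \<tau>)))"
      have "v ^ 2 = w"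
        by (simp add: v_def w_def q_def nome_def mult_ac flip: exp_of_nat_mult)
      moreover have "sin (of_real pi * (of_nat e * \<tau>)) = (v - inverse v) / (2 * \<i>)"
        unfolding sin_exp_eq v_def by (simp add: exp_minus)
      moreover have "v \<noteq> 0" by (simp add: v_def)
      moreover have "v ^ 2 \<noteq> 1" using w \<open>v ^ 2 = w\<close> by auto
      hence "1 - v ^ 2 \<noteq> 0" by simp
      moreover have "v - inverse v = - (1 - v ^ 2) / v"
        using \<open>v \<noteq> 0\<close> by (simp add: field_simps power2_eq_square)
      ultimately show ?thesis
        by (simp add: power_divide power_mult_distrib power2_commute[of w 1])
    qed
    finally show "((\<lambda>d. case (e, d) of (e, d) \<Rightarrow> of_nat d * q ^ (d * e)) has_sum
        - 1 / 4 * (1 / sin (of_real pi * (of_nat e * \<tau>)) ^ 2)) {1..}"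
      by (simp add: w_def flip: power_mult) (simp add: mult.commute)
  qed
  from has_sum_cmult_right[OF this, of "- 4"] show ?thesis
    by (simp add: E2)
qed


section \<open>The lattice sum and its two orders of summation\<close>

text \<open>With \<open>A = m \<tau> + n\<close> and \<open>B = A + 1\<close> the term is
  \<open>1 / (A * A * B)\<close>. Both factors are at least a constant times
  \<open>max (1 + |m|) (1 + |n|)\<close>, hence times the geometric mean, and the cube of that mean
  splits into a product of two convergent one-variable series.\<close>

lemma lattice_summable:
  assumes "Im \<tau> > 0"
  shows "(\<lambda>(m,n). if m = 0 then 0 else
            1 / (of_int m * \<tau> + of_int n) ^ 2 -
            1 / ((of_int m * \<tau> + of_int n) * (of_int m * \<tau> + of_int (n + 1))))
         summable_on (UNIV :: (int \<times> int) set)"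
proof -
  define g where "g = (\<lambda>(m,n). if m = 0 then 0 else
            1 / (of_int m * \<tau> + of_int n) ^ 2 -
            1 / ((of_int m * \<tau> + of_int n) * (of_int m * \<tau> + of_int (n + 1))))"
  \<comment> \<open>The power \<open>-3/2\<close> arises as the third power of the square root in
    the geometric mean.\<close>
  define w :: "int \<Rightarrow> real" where "w = (\<lambda>n. 1 / ((1 + \<bar>n\<bar>) * sqrt (1 + \<bar>n\<bar>)))"
  have w: "w summable_on UNIV"
  proof -
    have "summable (\<lambda>n. real n powr (- 3 / 2))"
      by (simp add: summable_real_powr_iff)
    hence *: "summable (\<lambda>n. real (Suc n) powr (- 3 / 2))"
      by (subst summable_Suc_iff)
    have eq: "x powr (- (3 / 2)) = 1 / (x * sqrt x)" if "x > 0" for x :: real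
    proof -
      have "x powr (- (3 / 2)) = 1 / x powr (1 + 1 / 2)"
        by (simp add: powr_minus_divide)
      also have "x powr (1 + 1 / 2) = x * sqrt x"
        using that by (subst powr_add) (simp add: powr_half_sqrt)
      finally show ?thesis .
    qed
    have 1: "(\<lambda>n::nat. w (int n)) summable_on UNIV"
      using * by (subst summable_on_UNIV_nonneg_real_iff) (auto simp: w_def eq add_ac simp del: powr_minus)
    have "summable (\<lambda>n. real (Suc (Suc n)) powr (- 3 / 2))"
      using * by (subst summable_Suc_iff)
    hence 2: "(\<lambda>n::nat. w (- 1 - int n)) summable_on UNIV"
      by (subst summable_on_UNIV_nonneg_real_iff) (auto simp: w_def eq add_ac)
    show ?thesis
      using has_sum_int_split[of w] 1 2 unfolding summable_on_def by blast
  qed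
  have ww: "(\<lambda>(m,n). w m * w n) summable_on UNIV \<times> UNIV"
  proof (rule summable_on_SigmaI)
    show "((\<lambda>n. case (m, n) of (m, n) \<Rightarrow> w m * w n) has_sum (w m * infsum w UNIV)) UNIV" for m
      using has_sum_cmult_right[OF has_sum_infsum[OF w], of "w m"] by simp
    show "(\<lambda>m. w m * infsum w UNIV) summable_on UNIV"
      by (rule summable_on_cmult_left[OF w])
  qed (auto simp: w_def)
  \<comment> \<open>The first entry comes from the imaginary part of \<open>m \<tau> + n\<close>,
    the second from solving for \<open>n\<close> with the triangle inequality. The factor 3 absorbs
    \<open>1 + |m| <= 3 |m|\<close> and the shift from \<open>n\<close> to
    \<open>n + 1\<close>.\<close>
  define c where "c = min (Im \<tau>) (1 / (1 + norm \<tau> / Im \<tau>)) / 3"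
  have c: "c > 0" using assms by (auto simp: c_def intro!: divide_pos_pos add_pos_nonneg)
  have bound: "norm (of_int m * \<tau> + of_int n) \<ge> 3 * c * \<bar>of_int m\<bar>"
              "norm (of_int m * \<tau> + of_int n) \<ge> 3 * c * \<bar>of_int n\<bar>" for m n :: int
  proof -
    define X where "X = norm (of_int m * \<tau> + of_int n)"
    have "\<bar>Im (of_int m * \<tau> + of_int n)\<bar> \<le> X" unfolding X_def by (rule abs_Im_le_cmod)
    hence 1: "\<bar>of_int m\<bar> * Im \<tau> \<le> X" using assms by (simp add: abs_mult)
    have "3 * c * \<bar>of_int m\<bar> \<le> Im \<tau> * \<bar>of_int m\<bar>"
      by (intro mult_right_mono) (auto simp: c_def)
    thus "X \<ge> 3 * c * \<bar>of_int m\<bar>" using 1 by (simp add: mult_ac)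
    have "norm (of_int n :: complex) \<le> X + norm (of_int m * \<tau>)"
      using norm_triangle_ineq4[of "of_int m * \<tau> + of_int n" "of_int m * \<tau>"] by (simp add: X_def)
    hence "\<bar>of_int n\<bar> \<le> X + \<bar>of_int m\<bar> * norm \<tau>" by (simp add: norm_mult)
    also have "\<bar>of_int m\<bar> * norm \<tau> \<le> X / Im \<tau> * norm \<tau>"
      using 1 assms by (intro mult_right_mono) (auto simp: field_simps)
    finally have 2: "\<bar>of_int n\<bar> \<le> X * (1 + norm \<tau> / Im \<tau>)" by (simp add: algebra_simps)
    have "0 < 1 + norm \<tau> / Im \<tau>" using assms by (intro add_pos_nonneg) auto
    have "3 * c * \<bar>of_int n\<bar> \<le> 1 / (1 + norm \<tau> / Im \<tau>) * \<bar>of_int n\<bar>"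
      by (intro mult_right_mono) (auto simp: c_def)
    also have "\<dots> \<le> X" using 2 \<open>0 < 1 + norm \<tau> / Im \<tau>\<close> by (simp add: divide_le_eq)
    finally show "X \<ge> 3 * c * \<bar>of_int n\<bar>" .
  qed
  have bound2: "norm (g (m, n)) \<le> 1 / c ^ 3 * (w m * w n)" for m n
  proof (cases "m = 0")
    case True
    thus ?thesis using c by (simp add: g_def w_def)
  next
    case False
    define A B where "A = of_int m * \<tau> + of_int n" and "B = of_int m * \<tau> + of_int (n + 1)"
    define M N where "M = 1 + real_of_int \<bar>m\<bar>" and "N = 1 + real_of_int \<bar>n\<bar>"
    have m1: "\<bar>m\<bar> \<ge> 1" using False by simp
    have MN: "M > 0" "N > 0" by (auto simp: M_def N_def)
    have *: "c * M \<le> norm (of_int m * \<tau> + of_int j)" "c * N \<le> norm (of_int m * \<tau> + of_int j)"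
      if j: "\<bar>n\<bar> \<le> \<bar>j\<bar> + 1" for j
    proof -
      have "M \<le> 3 * \<bar>of_int m\<bar>" using m1 by (simp add: M_def)
      hence "c * M \<le> c * (3 * \<bar>of_int m\<bar>)" using c by (intro mult_left_mono) auto
      thus "c * M \<le> norm (of_int m * \<tau> + of_int j)" using bound(1)[of m j] by simp
      show "c * N \<le> norm (of_int m * \<tau> + of_int j)"
      proof (cases "\<bar>j\<bar> \<ge> 1")
        case True
        hence "1 + \<bar>n\<bar> \<le> 3 * \<bar>j\<bar>" using j by simp
        hence "N \<le> 3 * \<bar>of_int j\<bar>" unfolding N_def by linarith
        hence "c * N \<le> c * (3 * \<bar>of_int j\<bar>)" using c by (intro mult_left_mono) auto
        thus ?thesis using bound(2)[of j m] by simp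
      next
        case False
        hence "1 + \<bar>n\<bar> \<le> 3 * \<bar>m\<bar>" using j m1 by simp
        hence "N \<le> 3 * \<bar>of_int m\<bar>" unfolding N_def by linarith
        hence "c * N \<le> c * (3 * \<bar>of_int m\<bar>)" using c by (intro mult_left_mono) auto
        thus ?thesis using bound(1)[of m j] by simp
      qed
    qed
    have A: "c * M \<le> norm A" "c * N \<le> norm A" using *[of n] by (auto simp: A_def)
    have B: "c * M \<le> norm B" "c * N \<le> norm B" using *[of "n + 1"] by (auto simp: B_def)
    define t where "t = c * sqrt (M * N)"
    have t: "t > 0" using c MN by (simp add: t_def)
    have tt: "t \<le> Y" if "c * M \<le> Y" "c * N \<le> Y" "Y \<ge> 0" for Y
    proof -
      have "t ^ 2 = (c * M) * (c * N)"
        using MN by (simp add: t_def power_mult_distrib power2_eq_square)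
      also have "\<dots> \<le> Y * Y" using that c MN by (intro mult_mono) auto
      finally show ?thesis using that by (simp add: power2_eq_square[symmetric] power_mono_iff t less_imp_le)
    qed
    have nA: "t \<le> norm A" and nB: "t \<le> norm B" using tt A B by auto
    hence nz: "A \<noteq> 0" "B \<noteq> 0" using t by auto
    have "g (m, n) = 1 / A ^ 2 - 1 / (A * B)" using False by (simp add: g_def A_def B_def)
    also have "\<dots> = (B - A) / (A * A * B)" using nz by (simp add: field_simps power2_eq_square)
    also have "B - A = 1" by (simp add: A_def B_def)
    finally have "norm (g (m, n)) = 1 / (norm A * norm A * norm B)" by (simp add: norm_divide norm_mult)
    also have "\<dots> \<le> 1 / (t * t * t)" using nA nB t by (intro divide_left_mono mult_mono mult_pos_pos) auto
    also have "t * t * t = c ^ 3 * ((M * sqrt M) * (N * sqrt N))"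
    proof -
      have "t * t * t = c ^ 3 * (sqrt (M * N) * sqrt (M * N)) * sqrt (M * N)"
        by (simp add: t_def power3_eq_cube)
      also have "sqrt (M * N) * sqrt (M * N) = M * N" using MN by simp
      finally show ?thesis by (simp add: real_sqrt_mult)
    qed
    also have "1 / \<dots> = 1 / c ^ 3 * (w m * w n)" by (simp add: w_def M_def N_def)
    finally show ?thesis .
  qed
  have "(\<lambda>x. norm (g x)) summable_on (UNIV \<times> UNIV)"
  proof (rule summable_on_comparison_test)
    show "(\<lambda>x. 1 / c ^ 3 * (case x of (m,n) \<Rightarrow> w m * w n)) summable_on UNIV \<times> UNIV"
      by (rule summable_on_cmult_right[OF ww])
  qed (use bound2 in auto)
  hence "g summable_on (UNIV \<times> UNIV)" by (rule abs_summable_summable)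
  thus ?thesis by (simp add: g_def)
qed

text \<open>Hecke's device: subtracting the telescoping terms \<open>1 / ((m\<tau> + n) (m\<tau> + n + 1))\<close> makes the
  double series of \<open>1 / (m\<tau> + n)\<^sup>2\<close> absolutely convergent; the telescoping part causes the
  non-modular correction when the order of summation is exchanged.\<close>

lemma E2_minus_inverse:
  assumes "Im \<tau> > 0"
  shows "E2 (- 1 / \<tau>) = \<tau> ^ 2 * E2 \<tau> + 6 * \<tau> / (of_real pi * \<i>)"
proof -
  have \<tau>: "\<tau> \<noteq> 0" using assms by auto
  have Im': "Im (- 1 / \<tau>) > 0"
    using assms by (simp add: Im_divide sum_power2_gt_zero_iff)
  have notint: "z \<notin> \<int>" if "Im z \<noteq> 0" for z using that by (auto elim!: Ints_cases)
  have nz: "of_int m * \<tau> + of_int n \<noteq> 0" if "m \<noteq> 0" for m n :: int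
  proof
    assume "of_int m * \<tau> + of_int n = 0"
    hence "Im (of_int m * \<tau> + of_int n) = 0" by simp
    thus False using that assms by simp
  qed
  define A where "A = (\<lambda>m n. if m = 0 then 0 else 1 / (of_int m * \<tau> + of_int n) ^ 2)"
  define B where "B = (\<lambda>m n. if m = 0 then 0 else
          1 / ((of_int m * \<tau> + of_int n) * (of_int m * \<tau> + of_int (n + 1))))"
  have sg: "(\<lambda>(m,n). A m n - B m n) summable_on (UNIV \<times> UNIV)"
    using lattice_summable[OF assms] unfolding A_def B_def UNIV_Times_UNIV
    by (rule summable_on_cong[THEN iffD1, rotated]) auto
  define S where "S = infsum (\<lambda>(m,n). A m n - B m n) (UNIV \<times> UNIV)"
  have S1: "((\<lambda>(m,n). A m n - B m n) has_sum S) (UNIV \<times> UNIV)"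
    unfolding S_def by (rule has_sum_infsum[OF sg])
  have S2: "((\<lambda>(n,m). A m n - B m n) has_sum S) (UNIV \<times> UNIV)"
    using S1 by (subst has_sum_swap) (simp add: case_prod_unfold)
  have Bdiff: "B m n = u (of_int n) - u (of_int (n + 1))"
    if "m \<noteq> 0" "\<And>x. u x = 1 / (of_int m * \<tau> + x)" for m n and u :: "complex \<Rightarrow> complex"
    using nz[OF that(1), of n] nz[OF that(1), of "n + 1"]
    by (simp add: B_def that field_simps)

  \<comment> \<open>summation over \<open>n\<close> first\<close>
  define R where "R = (\<lambda>m. if m = 0 then 0 else of_real pi ^ 2 / sin (of_real pi * (of_int m * \<tau>)) ^ 2)"
  have rowA: "((\<lambda>n. A m n) has_sum R m) UNIV" for m
    using csc_squared_partial_fractions[of "of_int m * \<tau>"] assms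
    by (cases "m = 0") (auto simp: A_def R_def notint)
  \<comment> \<open>In a row \<open>1 / (m \<tau> + n)\<close> tends to 0 at both ends, so the
    telescoping part contributes nothing: summing over \<open>n\<close> first gives the cosecants of
    \<open>E2 \<tau>\<close> alone.\<close>
  have row: "((\<lambda>n. A m n - B m n) has_sum R m) UNIV" for m
  proof (cases "m = 0")
    case False
    have "(\<lambda>n. A m n - B m n) summable_on UNIV"
      using summable_on_SigmaD1[of "\<lambda>m n. A m n - B m n" UNIV "\<lambda>_. UNIV" m] sg by simp
    then obtain r where r: "((\<lambda>n. A m n - B m n) has_sum r) UNIV"
      by (auto simp: summable_on_def)
    have "((\<lambda>n. A m n - (A m n - B m n)) has_sum (R m - r)) UNIV"
      by (rule has_sum_diff[OF rowA r])
    hence rB: "((\<lambda>n. B m n) has_sum (R m - r)) UNIV" by simp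
    define u where "u = (\<lambda>n::int. 1 / (of_int m * \<tau> + of_int n))"
    have tele: "((\<lambda>n. u n - u (n + 1)) has_sum (R m - r)) UNIV"
      using rB Bdiff[OF False refl] by (simp add: u_def)
    have lim0: "(\<lambda>N::nat. 1 / (a + of_nat N)) \<longlonglongrightarrow> 0" for a :: complex
      by (intro tendsto_divide_0[OF tendsto_const] tendsto_add_filterlim_at_infinity[OF tendsto_const]
            tendsto_of_nat)
    have "(\<lambda>N::nat. u (int N)) \<longlonglongrightarrow> 0" "(\<lambda>N::nat. u (- int N)) \<longlonglongrightarrow> 0"
    proof -
      show "(\<lambda>N::nat. u (int N)) \<longlonglongrightarrow> 0" using lim0 by (simp add: u_def)
      have "u (- int N) = - (1 / (- (of_int m * \<tau>) + of_nat N))" for N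
        unfolding u_def by (subst minus_divide_right) simp
      thus "(\<lambda>N::nat. u (- int N)) \<longlonglongrightarrow> 0"
        using tendsto_minus[OF lim0[of "- (of_int m * \<tau>)"]] by simp
    qed
    from has_sum_int_telescope[OF tele this] have "R m - r = 0 - 0" .
    thus ?thesis using r by simp
  qed (auto simp: A_def B_def R_def)
  have "(R has_sum S) UNIV"
    using has_sum_SigmaD[OF S1] row by simp
  moreover have "(R has_sum (R 0 + 2 * (of_real pi ^ 2 * ((E2 \<tau> - 1) / 6)))) UNIV"
  proof (rule has_sum_int_even)
    show "R (- n) = R n" for n by (simp add: R_def)
    have "((\<lambda>n::nat. R (int n)) has_sum (of_real pi ^ 2 * ((E2 \<tau> - 1) / 6))) {1..} \<longleftrightarrow>
          ((\<lambda>m::nat. of_real pi ^ 2 * (1 / sin (of_real pi * (of_nat m * \<tau>)) ^ 2)) has_sum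
             (of_real pi ^ 2 * ((E2 \<tau> - 1) / 6))) {1..}"
      by (rule has_sum_cong) (auto simp: R_def)
    thus "((\<lambda>n::nat. R (int n)) has_sum (of_real pi ^ 2 * ((E2 \<tau> - 1) / 6))) {1..}"
      using has_sum_cmult_right[OF E2_csc_has_sum[OF assms], of "of_real pi ^ 2"] by simp
  qed
  ultimately have Seq1: "S = 2 * (of_real pi ^ 2 * ((E2 \<tau> - 1) / 6))"
    using has_sum_unique by (fastforce simp: R_def)

  \<comment> \<open>summation over \<open>m\<close> first\<close>
  have zeta2: "((\<lambda>n::nat. 1 / (of_nat n :: complex) ^ 2) has_sum (of_real pi ^ 2 / 6)) {1..}"
  proof -
    have "((\<lambda>n::nat. 1 / real (n + 1) ^ 2) has_sum (pi ^ 2 / 6)) UNIV"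
      by (rule sums_nonneg_imp_has_sum) (use inverse_squares_sums in auto)
    also have "?this \<longleftrightarrow> ((\<lambda>n::nat. 1 / real n ^ 2) has_sum (pi ^ 2 / 6)) {1..}"
      by (rule has_sum_reindex_bij_witness[of _ "\<lambda>n. n - 1" Suc]) auto
    finally have "((\<lambda>n::nat. complex_of_real (1 / real n ^ 2)) has_sum of_real (pi ^ 2 / 6)) {1..}"
      by (rule has_sum_of_real)
    thus ?thesis by simp
  qed
  \<comment> \<open>The column sums of \<open>A\<close>. For \<open>n = 0\<close> this is
    \<open>2 / \<tau>^2\<close> times the sum of inverse squares; for other \<open>n\<close> it is
    the full cosecant series at \<open>n / \<tau>\<close> without its term \<open>m = 0\<close>,
    namely \<open>1 / n^2\<close>.\<close>
  define C1 where "C1 = (\<lambda>n::int. if n = 0 then of_real pi ^ 2 / (3 * \<tau> ^ 2) else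
      of_real pi ^ 2 / (\<tau> ^ 2 * sin (of_real pi * (of_int n / \<tau>)) ^ 2) - 1 / of_int n ^ 2)"
  have Im2: "Im (of_int n / \<tau>) \<noteq> 0" if "n \<noteq> 0" for n :: int
    using that assms \<tau> by (simp add: Im_divide)
  have colA: "((\<lambda>m. A m n) has_sum C1 n) UNIV" for n
  proof (cases "n = 0")
    case True
    have "((\<lambda>m. A m 0) has_sum (A 0 0 + 2 * (1 / \<tau> ^ 2 * (of_real pi ^ 2 / 6)))) UNIV"
    proof (rule has_sum_int_even)
      have "((\<lambda>m::nat. A (int m) 0) has_sum (1 / \<tau> ^ 2 * (of_real pi ^ 2 / 6))) {1..} \<longleftrightarrow>
            ((\<lambda>m::nat. 1 / \<tau> ^ 2 * (1 / of_nat m ^ 2)) has_sum (1 / \<tau> ^ 2 * (of_real pi ^ 2 / 6))) {1..}"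
        by (rule has_sum_cong) (auto simp: A_def power_mult_distrib)
      thus "((\<lambda>m::nat. A (int m) 0) has_sum (1 / \<tau> ^ 2 * (of_real pi ^ 2 / 6))) {1..}"
        using has_sum_cmult_right[OF zeta2, of "1 / \<tau> ^ 2"] by simp
    qed (auto simp: A_def)
    thus ?thesis using True by (simp add: C1_def A_def)
  next
    case False
    have "((\<lambda>m. 1 / (of_int n / \<tau> + of_int m) ^ 2) has_sum
             (of_real pi ^ 2 / sin (of_real pi * (of_int n / \<tau>)) ^ 2)) UNIV"
      by (rule csc_squared_partial_fractions[OF notint[OF Im2[OF False]]])
    from has_sum_cmult_right[OF this, of "1 / \<tau> ^ 2"]
    have "((\<lambda>m. 1 / \<tau> ^ 2 * (1 / (of_int n / \<tau> + of_int m) ^ 2)) has_sum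
             (of_real pi ^ 2 / (\<tau> ^ 2 * sin (of_real pi * (of_int n / \<tau>)) ^ 2))) UNIV"
      by simp
    moreover have "1 / \<tau> ^ 2 * (1 / (of_int n / \<tau> + of_int m) ^ 2) = 1 / (of_int m * \<tau> + of_int n) ^ 2" for m
    proof -
      have "of_int m * \<tau> + of_int n = \<tau> * (of_int n / \<tau> + of_int m)"
        using \<tau> by (simp add: field_simps)
      thus ?thesis by (simp only: power_mult_distrib) simp
    qed
    ultimately have 1: "((\<lambda>m. 1 / (of_int m * \<tau> + of_int n) ^ 2) has_sum
             (of_real pi ^ 2 / (\<tau> ^ 2 * sin (of_real pi * (of_int n / \<tau>)) ^ 2))) UNIV"
      by simp
    have 2: "((\<lambda>m::int. if m = 0 then 1 / of_int n ^ 2 else 0 :: complex) has_sum (1 / of_int n ^ 2)) UNIV"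
      by (rule has_sum_finite_neutralI[of "{0}"]) auto
    have "((\<lambda>m. 1 / (of_int m * \<tau> + of_int n) ^ 2 - (if m = 0 then 1 / of_int n ^ 2 else 0)) has_sum C1 n) UNIV"
      using has_sum_diff[OF 1 2] False by (simp add: C1_def)
    thus ?thesis by (rule has_sum_cong[THEN iffD1, rotated]) (auto simp: A_def)
  qed
  \<comment> \<open>The window limit over \<open>m\<close>, with \<open>m = 0\<close> omitted, of
    \<open>1 / (m \<tau> + n)\<close>: a cotangent minus the omitted term, and 0 for
    \<open>n = 0\<close>. Since \<open>B\<close> is a difference in \<open>n\<close>, its column
    sums are \<open>c n - c (n + 1)\<close>.\<close>
  define c where "c = (\<lambda>n::int. if n = 0 then 0 else
      1 / \<tau> * (of_real pi * cot (of_real pi * (of_int n / \<tau>))) - 1 / of_int n)"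
  have c_lim: "(\<lambda>N::nat. \<Sum>m\<in>{-int N..<int N}. if m = 0 then 0 else 1 / (of_int m * \<tau> + of_int n)) \<longlonglongrightarrow> c n" for n
  proof (cases "n = 0")
    case True
    \<comment> \<open>For \<open>n = 0\<close> the terms of \<open>m\<close> and \<open>-m\<close>
      cancel; the half-open window leaves only \<open>m = -N\<close>.\<close>
    have eq: "(\<Sum>m\<in>{-int N..<int N}. if m = 0 then 0 else 1 / (of_int m * \<tau> + of_int n)) =
          - inverse (of_nat N * \<tau>)" for N
    proof (induction N)
      case (Suc N)
      have *: "{-int (Suc N)..<int (Suc N)} = insert (-int (Suc N)) (insert (int N) {-int N..<int N})"
        by auto
      have "1 / ((- 1 - of_nat N) * \<tau>) = - 1 / ((1 + of_nat N) * \<tau>)"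
        by (metis (no_types, opaque_lifting) minus_diff_eq minus_divide_left minus_divide_right minus_mult_left diff_minus_eq_add uminus_add_conv_diff add.commute)
      thus ?case unfolding * using Suc.IH True by (simp add: inverse_eq_divide)
    qed auto
    have "(\<lambda>N::nat. - (inverse (of_nat N) * inverse \<tau>)) \<longlonglongrightarrow> - (0 * inverse \<tau>)"
      by (intro tendsto_intros tendsto_inverse_0 filterlim_compose[OF tendsto_inverse_0 tendsto_of_nat])
    hence "(\<lambda>N::nat. - inverse (of_nat N * \<tau>)) \<longlonglongrightarrow> 0" by (simp add: mult_ac)
    thus ?thesis using True eq by (simp add: c_def)
  next
    case False
    define z where "z = of_int n / \<tau>"
    have "(\<lambda>N::nat. 1 / \<tau> * (\<Sum>m\<in>{-int N..<int N}. 1 / (z + of_int m)) - 1 / of_int n) \<longlonglongrightarrow> c n"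
      using cot_partial_fractions[OF notint[OF Im2[OF False]]] False
      unfolding c_def z_def using \<tau> by (auto intro!: tendsto_intros)
    moreover have "eventually (\<lambda>N::nat. 1 / \<tau> * (\<Sum>m\<in>{-int N..<int N}. 1 / (z + of_int m)) - 1 / of_int n =
        (\<Sum>m\<in>{-int N..<int N}. if m = 0 then 0 else 1 / (of_int m * \<tau> + of_int n))) sequentially"
      using eventually_gt_at_top[of 0]
    proof eventually_elim
      case (elim N)
      have "1 / \<tau> * (\<Sum>m\<in>{-int N..<int N}. 1 / (z + of_int m)) = (\<Sum>m\<in>{-int N..<int N}. 1 / (of_int m * \<tau> + of_int n))"
        unfolding sum_distrib_left z_def using \<tau> by (intro sum.cong) (auto simp: field_simps)
      also have "\<dots> = (\<Sum>m\<in>{-int N..<int N}. (if m = 0 then 0 else 1 / (of_int m * \<tau> + of_int n)) +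
                          (if m = 0 then 1 / of_int n else 0))"
        by (intro sum.cong) auto
      also have "\<dots> = (\<Sum>m\<in>{-int N..<int N}. if m = 0 then 0 else 1 / (of_int m * \<tau> + of_int n)) + 1 / of_int n"
        using elim by (subst sum.distrib, subst sum.delta) auto
      finally show ?case by simp
    qed
    ultimately show ?thesis by (rule Lim_transform_eventually)
  qed
  define b where "b = (\<lambda>n. c n - c (n + 1))"
  have col: "((\<lambda>m. A m n - B m n) has_sum (C1 n - b n)) UNIV" for n
  proof -
    have "(\<lambda>m. A m n - B m n) summable_on UNIV"
      using summable_on_SigmaD1[of "\<lambda>n m. A m n - B m n" UNIV "\<lambda>_. UNIV" n] has_sum_imp_summable[OF S2] by simp
    then obtain r where r: "((\<lambda>m. A m n - B m n) has_sum r) UNIV"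
      by (auto simp: summable_on_def)
    have "((\<lambda>m. A m n - (A m n - B m n)) has_sum (C1 n - r)) UNIV"
      by (rule has_sum_diff[OF colA r])
    hence "((\<lambda>m. B m n) has_sum (C1 n - r)) UNIV" by simp
    hence "(\<lambda>N::nat. \<Sum>m\<in>{-int N..<int N}. B m n) \<longlonglongrightarrow> C1 n - r" by (rule has_sum_int_limit)
    moreover have "(\<lambda>N::nat. \<Sum>m\<in>{-int N..<int N}. B m n) \<longlonglongrightarrow> b n"
    proof -
      have "(\<Sum>m\<in>{-int N..<int N}. B m n) =
            (\<Sum>m\<in>{-int N..<int N}. if m = 0 then 0 else 1 / (of_int m * \<tau> + of_int n)) -
            (\<Sum>m\<in>{-int N..<int N}. if m = 0 then 0 else 1 / (of_int m * \<tau> + of_int (n + 1)))" for N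
        unfolding sum_subtractf [symmetric]
        by (intro sum.cong) (use Bdiff[OF _ refl] in \<open>auto simp: B_def\<close>)
      thus ?thesis using tendsto_diff[OF c_lim[of n] c_lim[of "n + 1"]] by (simp add: b_def)
    qed
    ultimately have "C1 n - r = b n" by (rule LIMSEQ_unique)
    thus ?thesis using r by (simp add: algebra_simps)
  qed
  have totC: "((\<lambda>n. C1 n - b n) has_sum S) UNIV"
    using has_sum_SigmaD[OF S2] col by simp
  \<comment> \<open>The squared sine is even, so \<open>n / \<tau>\<close> may be replaced by
    \<open>n * (- 1 / \<tau>)\<close>, whose imaginary part is positive for \<open>n > 0\<close>;
    this brings in \<open>E2 (- 1 / \<tau>)\<close>.\<close>
  define T where "T = C1 0 + 2 * (of_real pi ^ 2 / \<tau> ^ 2 * ((E2 (- 1 / \<tau>) - 1) / 6) - of_real pi ^ 2 / 6)"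
  have totC1: "(C1 has_sum T) UNIV"
    unfolding T_def
  proof (rule has_sum_int_even)
    show "C1 (- n) = C1 n" for n by (simp add: C1_def)
    have "((\<lambda>m::nat. of_real pi ^ 2 / \<tau> ^ 2 * (1 / sin (of_real pi * (of_nat m * (- 1 / \<tau>))) ^ 2) - 1 / of_nat m ^ 2)
        has_sum (of_real pi ^ 2 / \<tau> ^ 2 * ((E2 (- 1 / \<tau>) - 1) / 6) - of_real pi ^ 2 / 6)) {1..}"
      by (intro has_sum_diff has_sum_cmult_right E2_csc_has_sum Im' zeta2)
    thus "((\<lambda>n::nat. C1 (int n)) has_sum
         (of_real pi ^ 2 / \<tau> ^ 2 * ((E2 (- 1 / \<tau>) - 1) / 6) - of_real pi ^ 2 / 6)) {1..}"
      by (rule has_sum_cong[THEN iffD1, rotated]) (auto simp: C1_def)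
  qed
  have "((\<lambda>n. C1 n - (C1 n - b n)) has_sum (T - S)) UNIV"
    by (rule has_sum_diff[OF totC1 totC])
  hence totb: "((\<lambda>n. c n - c (n + 1)) has_sum (T - S)) UNIV" by (simp add: b_def)
  \<comment> \<open>Here the telescoping part does not vanish: \<open>Im (pi / \<tau>) < 0\<close>
    makes the cotangent tend to \<open>\<i>\<close> at one end, and by oddness to
    \<open>- \<i>\<close> at the other. This jump is the non-modular term.\<close>
  have limc: "(\<lambda>N::nat. c (int N)) \<longlonglongrightarrow> of_real pi * \<i> / \<tau>"
  proof -
    define z where "z = of_real pi / \<tau>"
    have z: "Im z < 0"
      using assms by (simp add: z_def Im_divide sum_power2_gt_zero_iff)
    define v where "v = exp (- 2 * \<i> * z)"
    have v: "norm v < 1" using z by (simp add: v_def)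
    have cot_eq: "cot (of_nat N * z) = \<i> * (1 + v ^ N) / (1 - v ^ N)" for N
    proof -
      define e where "e = exp (\<i> * (of_nat N * z))"
      have e: "e \<noteq> 0" by (simp add: e_def)
      have ve: "v ^ N = inverse (e ^ 2)"
        by (simp add: v_def e_def flip: exp_of_nat_mult exp_minus) (simp add: mult_ac)
      have "cot (of_nat N * z) = ((e + inverse e) / 2) / ((e - inverse e) / (2 * \<i>))"
        unfolding cot_def cos_exp_eq sin_exp_eq e_def by (simp add: exp_minus)
      also have "\<dots> = \<i> * ((e + inverse e) / (e - inverse e))"
      proof -
        have "(x / 2) / (y / (2 * \<i>)) = \<i> * (x / y)" for x y
          by (cases "y = 0") (auto simp: field_simps)
        thus ?thesis by blast
      qed
      also have "(e + inverse e) / (e - inverse e) = (1 + v ^ N) / (1 - v ^ N)"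
      proof -
        have "e + inverse e = e * (1 + v ^ N)" "e - inverse e = e * (1 - v ^ N)"
          using e by (simp_all add: ve field_simps power2_eq_square)
        thus ?thesis using e by simp
      qed
      finally show ?thesis by simp
    qed
    have vN: "(\<lambda>N. v ^ N) \<longlonglongrightarrow> 0" by (rule LIMSEQ_power_zero[OF v])
    have "(\<lambda>N::nat. 1 / \<tau> * (of_real pi * (\<i> * (1 + v ^ N) / (1 - v ^ N))) - 1 / of_nat N) \<longlonglongrightarrow>
            1 / \<tau> * (of_real pi * (\<i> * (1 + 0) / (1 - 0))) - 0"
      by (intro tendsto_intros vN lim_1_over_n) auto
    moreover have "eventually (\<lambda>N::nat. 1 / \<tau> * (of_real pi * (\<i> * (1 + v ^ N) / (1 - v ^ N))) - 1 / of_nat N = c (int N)) sequentially"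
      using eventually_gt_at_top[of 0]
    proof eventually_elim
      case (elim N)
      show ?case using elim by (simp add: c_def cot_eq[symmetric] z_def mult_ac)
    qed
    ultimately show ?thesis by (simp add: Lim_transform_eventually mult_ac)
  qed
  have "c (- n) = - c n" for n by (simp add: c_def)
  hence "(\<lambda>N::nat. c (- int N)) \<longlonglongrightarrow> - (of_real pi * \<i> / \<tau>)"
    using tendsto_minus[OF limc] by simp
  from has_sum_int_telescope[OF totb limc this]
  have Seq2: "T - S = - (2 * of_real pi * \<i> / \<tau>)" by simp
  have "of_real pi ^ 2 * (E2 (- 1 / \<tau>) - \<tau> ^ 2 * E2 \<tau>) = 3 * \<tau> ^ 2 * (T - S)"
    using \<tau> by (simp add: T_def Seq1 C1_def field_simps)
  also have "\<dots> = - (6 * of_real pi * \<i> * \<tau>)"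
    unfolding Seq2 using \<tau> by (simp add: power2_eq_square)
  finally have "of_real pi * (of_real pi * (E2 (- 1 / \<tau>) - \<tau> ^ 2 * E2 \<tau>)) = of_real pi * (- (6 * \<i> * \<tau>))"
    by (simp add: power2_eq_square mult_ac)
  hence "of_real pi * (E2 (- 1 / \<tau>) - \<tau> ^ 2 * E2 \<tau>) = - (6 * \<i> * \<tau>)"
    by (subst (asm) mult_cancel_left) simp
  moreover have "of_real pi * (6 * \<tau> / (of_real pi * \<i>)) = - (6 * \<i> * \<tau>)"
    by (simp add: field_simps)
  ultimately have "of_real pi * (E2 (- 1 / \<tau>) - \<tau> ^ 2 * E2 \<tau>) = of_real pi * (6 * \<tau> / (of_real pi * \<i>))"
    by (rule trans_sym)
  hence "E2 (- 1 / \<tau>) - \<tau> ^ 2 * E2 \<tau> = 6 * \<tau> / (of_real pi * \<i>)"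
    by (subst (asm) mult_cancel_left) simp
  thus ?thesis by (simp add: algebra_simps)
qed

section \<open>\<open>E2p\<close> under the two involutions\<close>

lemma E2_cong_nome: "nome \<tau> = nome \<tau>' \<Longrightarrow> E2 \<tau> = E2 \<tau>'"
  by (simp add: E2_def)

lemma nome_add_of_int [simp]: "nome (\<tau> + of_int n) = nome \<tau>"
proof -
  have "nome (\<tau> + of_int n) = nome \<tau> * exp (\<i> * (2 * of_int n * of_real pi))"
    by (simp add: nome_def algebra_simps flip: exp_add)
  also have "exp (\<i> * (2 * of_int n * of_real pi)) = 1"
    using exp_integer_2pi[of "of_int n"] by (simp add: mult_ac)
  finally show ?thesis by simp
qed

lemma E2_add_of_int: "E2 (\<tau> + of_int n) = E2 \<tau>"
  by (rule E2_cong_nome) simp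

text \<open>The map is inversion, translation by \<open>-2\<close>, and inversion again, so the
  inversion formula is applied twice.\<close>

lemma E2_congruence_level_2:
  assumes "Im \<tau> > 0"
  shows "E2 (\<tau> / (2 * \<tau> + 1)) = (2 * \<tau> + 1) ^ 2 * E2 \<tau> + 12 * (2 * \<tau> + 1) / (of_real pi * \<i>)"
proof -
  have \<tau>: "\<tau> \<noteq> 0" "2 * \<tau> + 1 \<noteq> 0"
    using assms by (auto simp: complex_eq_iff)
  define w where "w = - 1 / \<tau> + of_int (- 2)"
  have w: "w = - (2 * \<tau> + 1) / \<tau>" using \<tau> by (simp add: w_def field_simps)
  have "Im w > 0"
    using assms by (simp add: w_def Im_divide sum_power2_gt_zero_iff)
  have "a / b = - 1 / (- b / a)" if "a \<noteq> 0" "b \<noteq> 0" for a b :: complex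
    using that by simp
  from this[OF \<tau>] have "\<tau> / (2 * \<tau> + 1) = - 1 / w" by (simp only: w)
  hence "E2 (\<tau> / (2 * \<tau> + 1)) = w ^ 2 * E2 w + 6 * w / (of_real pi * \<i>)"
    using E2_minus_inverse[OF \<open>Im w > 0\<close>] by simp
  also have "E2 w = \<tau> ^ 2 * E2 \<tau> + 6 * \<tau> / (of_real pi * \<i>)"
    unfolding w_def E2_add_of_int by (rule E2_minus_inverse[OF assms])
  also have "w ^ 2 * (\<tau> ^ 2 * E2 \<tau> + 6 * \<tau> / (of_real pi * \<i>)) + 6 * w / (of_real pi * \<i>) =
      (w * \<tau>) ^ 2 * E2 \<tau> + 6 * w * (w * \<tau> + 1) / (of_real pi * \<i>)"
    by (simp add: field_simps power2_eq_square)
  also have "w * \<tau> = - (2 * \<tau> + 1)" using \<tau> by (simp add: w)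
  also have "6 * w * (- (2 * \<tau> + 1) + 1) = 12 * (2 * \<tau> + 1)"
    using \<tau> by (simp add: w)
  also have "(- (2 * \<tau> + 1)) ^ 2 = (2 * \<tau> + 1) ^ 2" by (rule power2_minus)
  finally show ?thesis .
qed

text \<open>The involution exchanges the two summands of \<open>E2p\<close> up to the weight factor;
  this is the reason for the combination \<open>p * E2 (p \<tau>) + E2 \<tau>\<close>.\<close>

lemma E2p_Fricke:
  assumes "Im \<tau> > 0" "p > 0"
  shows "E2p p (- 1 / (of_nat p * \<tau>)) =
    of_nat p * \<tau> ^ 2 * E2p p \<tau> + 12 / (of_nat (p + 1) * of_real pi * \<i>) * (of_nat p * \<tau>)"
proof -
  have p: "(of_nat p :: complex) \<noteq> 0" "(1 + of_nat p :: complex) \<noteq> 0"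
    using assms by (auto simp flip: of_nat_Suc)
  define K where "K = 6 / (of_real pi * \<i>)"
  have K: "6 * x / (of_real pi * \<i>) = K * x" "12 / (y * of_real pi * \<i>) = 2 * K * (1 / y)" for x y
    by (auto simp: K_def field_simps)
  have 1: "E2 (- 1 / (of_nat p * \<tau>)) = (of_nat p * \<tau>) ^ 2 * E2 (of_nat p * \<tau>) + K * (of_nat p * \<tau>)"
    unfolding K(1)[symmetric] by (rule E2_minus_inverse) (use assms in auto)
  have "of_nat p * (- 1 / (of_nat p * \<tau>)) = - 1 / \<tau>" using p by simp
  hence 2: "E2 (of_nat p * (- 1 / (of_nat p * \<tau>))) = \<tau> ^ 2 * E2 \<tau> + K * \<tau>"
    using E2_minus_inverse[OF assms(1)] by (simp add: K)
  define Q where "Q = 1 / (of_nat (p + 1) :: complex)"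
  show ?thesis
    unfolding E2p_def K 1 2 Q_def[symmetric] by (simp add: algebra_simps power2_eq_square)
qed

text \<open>This involution belongs to the circle of radius \<open>1 / (2 * sqrt p)\<close> around
  \<open>-1/2\<close>. Writing \<open>p = 2 j + 1\<close>, the image is, modulo integers,
  \<open>u / (2 u + 1)\<close> with \<open>u = p \<tau> + j\<close>, and \<open>p\<close> times the
  image is \<open>\<tau> / (2 \<tau> + 1)\<close>. So the two summands of \<open>E2p\<close> are
  exchanged again; oddness of \<open>p\<close> makes \<open>j\<close> an integer.\<close>

lemma E2p_involution:
  assumes "Im \<tau> > 0" "odd p"
  shows "E2p p (- 1 / 2 - 1 / (4 * of_nat p * (\<tau> + 1 / 2))) =
    of_nat p * (2 * \<tau> + 1) ^ 2 * E2p p \<tau> +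
    12 / (of_nat (p + 1) * of_real pi * \<i>) * (2 * of_nat p * (2 * \<tau> + 1))"
proof -
  have p0: "p > 0" using assms(2) by (auto intro!: Nat.gr0I)
  have p: "(of_nat p :: complex) \<noteq> 0" "(1 + of_nat p :: complex) \<noteq> 0"
    using p0 by (auto simp flip: of_nat_Suc)
  obtain j where j: "p = 2 * j + 1" using assms(2) by (elim oddE)
  have t: "2 * \<tau> + 1 \<noteq> 0" "\<tau> + 1 / 2 \<noteq> 0" "\<tau> * 2 \<noteq> - 1" using assms by (auto simp: complex_eq_iff)
  define \<sigma> where "\<sigma> = - 1 / 2 - 1 / (4 * of_nat p * (\<tau> + 1 / 2))"
  have \<sigma>: "\<sigma> = - 1 / 2 - 1 / (2 * of_nat p * (2 * \<tau> + 1))"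
  proof -
    have "4 * of_nat p * (\<tau> + 1 / 2) = 2 * of_nat p * (2 * \<tau> + 1)"
      by (simp add: algebra_simps)
    thus ?thesis unfolding \<sigma>_def by simp
  qed
  define P :: complex where "P = of_nat p"
  have j': "of_nat j = (P - 1) / 2" by (simp add: P_def j)
  define w where "w = 2 * \<tau> + 1"
  have w: "w \<noteq> 0" "\<tau> = (w - 1) / 2" using t by (simp_all add: w_def)
  have P: "P \<noteq> 0" "1 + P \<noteq> 0" using p by (auto simp: P_def)
  define u where "u = P * \<tau> + of_int (int j)"
  have u: "u = (P * w - 1) / 2" by (simp add: u_def j' w field_simps)
  have "\<sigma> = u / (2 * u + 1) + of_int (- 1)"
    unfolding \<sigma> u P_def[symmetric] w_def[symmetric] using w P by (simp add: field_simps)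
  hence "E2 \<sigma> = E2 (u / (2 * u + 1))" by (simp only: E2_add_of_int)
  also have "\<dots> = (2 * u + 1) ^ 2 * E2 u + 12 * (2 * u + 1) / (of_real pi * \<i>)"
    by (rule E2_congruence_level_2) (use assms p0 in \<open>auto simp: u_def P_def\<close>)
  also have "E2 u = E2 (P * \<tau>)" unfolding u_def by (rule E2_add_of_int)
  also have "2 * u + 1 = P * w" by (simp add: u field_simps)
  finally have 1: "E2 \<sigma> = (P * w) ^ 2 * E2 (P * \<tau>) + 12 * (P * w) / (of_real pi * \<i>)" .
  have "P * \<sigma> = \<tau> / w + of_int (- int j - 1)"
    unfolding \<sigma> P_def[symmetric] w_def[symmetric] using w P by (simp add: field_simps j')
  hence "E2 (P * \<sigma>) = E2 (\<tau> / w)" by (simp only: E2_add_of_int)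
  also have "\<dots> = w ^ 2 * E2 \<tau> + 12 * w / (of_real pi * \<i>)"
    unfolding w_def by (rule E2_congruence_level_2[OF assms(1)])
  finally have 2: "E2 (P * \<sigma>) = w ^ 2 * E2 \<tau> + 12 * w / (of_real pi * \<i>)" .
  define K where "K = 12 / (of_real pi * \<i>)"
  have K: "12 * x / (of_real pi * \<i>) = K * x" "12 / (y * of_real pi * \<i>) = K * (1 / y)" for x y
    by (auto simp: K_def field_simps)
  define Q where "Q = 1 / (of_nat (p + 1) :: complex)"
  show ?thesis
    unfolding \<sigma>_def[symmetric] E2p_def K Q_def[symmetric]
    unfolding P_def[symmetric] w_def[symmetric] 1 2 K
    by (simp add: algebra_simps power2_eq_square)
qed

section \<open>Boundary behaviour of holomorphic functions\<close>

text \<open>Stated with upper limits at the frontier because the functions it is used for may have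
  poles there. If \<open>Im F\<close> were positive somewhere, its supremum would be attained
  inside, and the set of maximum points would be nonempty, compact and open in the plane.\<close>

lemma Im_maximum_principle:
  assumes "open \<Omega>" "F holomorphic_on \<Omega>"
    and frontier: "\<And>z e. z \<in> frontier \<Omega> \<Longrightarrow> e > 0 \<Longrightarrow> \<exists>d>0. \<forall>w\<in>\<Omega>. dist w z < d \<longrightarrow> Im (F w) < e"
    and infinity: "\<And>e. e > 0 \<Longrightarrow> \<exists>B. \<forall>w\<in>\<Omega>. norm w > B \<longrightarrow> Im (F w) < e"
    and "z0 \<in> \<Omega>"
  shows "Im (F z0) \<le> 0"
proof (rule ccontr)
  assume "\<not> Im (F z0) \<le> 0"
  define s where "s = Im (F z0)"
  have s: "s > 0" using \<open>\<not> _\<close> by (simp add: s_def)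
  have cont: "continuous_on \<Omega> (\<lambda>w. Im (F w))"
    using assms(2) by (intro continuous_intros holomorphic_on_imp_continuous_on)
  define K where "K = {w\<in>\<Omega>. Im (F w) \<ge> s / 2}"
  have "z0 \<in> K" using s assms(5) by (simp add: K_def s_def)
  obtain B where B: "\<And>w. w \<in> \<Omega> \<Longrightarrow> norm w > B \<Longrightarrow> Im (F w) < s / 2"
    using infinity[of "s / 2"] s by auto
  have "bounded K"
    unfolding bounded_iff K_def using B by (intro exI[of _ B]) (force simp: not_less)
  moreover have "closed K"
    unfolding closed_sequential_limits
  proof safe
    fix x l assume x: "\<forall>n. x n \<in> K" "x \<longlonglongrightarrow> l"
    have "l \<in> closure \<Omega>" using x unfolding closure_sequential K_def by blast
    have "l \<in> \<Omega>"
    proof (rule ccontr)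
      assume "l \<notin> \<Omega>"
      hence "l \<in> frontier \<Omega>"
        using \<open>l \<in> closure \<Omega>\<close> assms(1) by (simp add: frontier_def interior_open)
      then obtain d where d: "d > 0" "\<forall>w\<in>\<Omega>. dist w l < d \<longrightarrow> Im (F w) < s / 2"
        using frontier[of l "s / 2"] s by auto
      obtain n where "dist (x n) l < d"
        using metric_LIMSEQ_D[OF x(2) d(1)] by blast
      thus False using d(2) x(1) by (force simp: K_def)
    qed
    hence "(\<lambda>n. Im (F (x n))) \<longlonglongrightarrow> Im (F l)"
      using cont x assms(1) unfolding continuous_on_sequentially K_def by (auto simp: o_def)
    hence "Im (F l) \<ge> s / 2"
      by (rule LIMSEQ_le_const) (use x in \<open>auto simp: K_def\<close>)
    thus "l \<in> K" using \<open>l \<in> \<Omega>\<close> by (simp add: K_def)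
  qed
  ultimately have "compact K" by (simp add: compact_eq_bounded_closed)
  have contK: "continuous_on K (\<lambda>w. Im (F w))"
    by (rule continuous_on_subset[OF cont]) (auto simp: K_def)
  obtain z1 where z1: "z1 \<in> K" "\<And>w. w \<in> K \<Longrightarrow> Im (F w) \<le> Im (F z1)"
    using continuous_attains_sup[OF \<open>compact K\<close> _ contK] \<open>z0 \<in> K\<close> by blast
  define M where "M = Im (F z1)"
  have M: "M \<ge> s" using z1(2)[OF \<open>z0 \<in> K\<close>] by (simp add: M_def s_def)
  have le: "Im (F w) \<le> M" if "w \<in> \<Omega>" for w
    using z1(2)[of w] that M s by (cases "w \<in> K") (auto simp: M_def K_def)
  define L where "L = {w\<in>\<Omega>. Im (F w) = M}"
  have "L = {w\<in>K. Im (F w) = M}" using M s by (auto simp: L_def K_def)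
  hence "closed L"
    using continuous_closed_preimage_constant[OF contK] \<open>compact K\<close>
    by (simp add: compact_imp_closed)
  moreover have "L \<subseteq> K" using M s by (auto simp: L_def K_def)
  ultimately have "compact L" using compact_Int_closed[OF \<open>compact K\<close>, of L] by (simp add: Int_absorb1)
  moreover have "open L"
    unfolding open_contains_ball
  proof
    fix z assume z: "z \<in> L"
    then obtain e where e: "e > 0" "ball z e \<subseteq> \<Omega>"
      using assms(1) by (auto simp: L_def open_contains_ball)
    \<comment> \<open>The modulus of \<open>G\<close> is \<open>exp (Im F)\<close>, so the maximum
      modulus principle applies.\<close>
    define G where "G = (\<lambda>w. exp (- \<i> * F w))"
    have nG: "norm (G w) = exp (Im (F w))" for w by (simp add: G_def)
    have "G holomorphic_on ball z e"
      unfolding G_def using assms(2) e(2) by (intro holomorphic_intros) (auto intro: holomorphic_on_subset)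
    hence "G constant_on ball z e"
      by (rule maximum_modulus_principle[where U = "ball z e" and \<xi> = z])
         (use e z le in \<open>auto simp: nG L_def\<close>)
    then obtain c where "\<And>w. w \<in> ball z e \<Longrightarrow> G w = c" by (auto simp: constant_on_def)
    hence "Im (F w) = M" if "w \<in> ball z e" for w
      using that nG[of w] nG[of z] e(1) z by (auto simp: L_def)
    thus "\<exists>e>0. ball z e \<subseteq> L" using e by (intro exI[of _ e]) (auto simp: L_def)
  qed
  moreover have "z1 \<in> L" using z1 by (auto simp: L_def M_def K_def)
  ultimately show False using compact_open[of L] by auto
qed

text \<open>The points \<open>c + (\<tau>0 - c) * cis (1 / (n + 1))\<close> approach
  \<open>\<tau>0\<close> on the circle, and the reals are closed. It is applied to the regular parts
  left over when a pole on the circle has been split off.\<close>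

lemma circle_approach_eventually:
  fixes F :: "complex \<Rightarrow> complex"
  assumes "\<tau>0 \<noteq> c" and F: "(F \<longlongrightarrow> L) (at \<tau>0)"
    and ev: "eventually (\<lambda>\<tau>. norm (\<tau> - c) = norm (\<tau>0 - c) \<longrightarrow> F \<tau> \<in> \<real>) (at \<tau>0)"
  shows "L \<in> \<real>"
proof -
  define x where "x = (\<lambda>n::nat. c + (\<tau>0 - c) * cis (1 / (real n + 1)))"
  have "x \<longlonglongrightarrow> c + (\<tau>0 - c) * cis 0"
    unfolding x_def by (intro tendsto_intros tendsto_cis)
      (use LIMSEQ_inverse_real_of_nat in \<open>simp add: inverse_eq_divide add_ac\<close>)
  hence lim: "x \<longlonglongrightarrow> \<tau>0" by simp
  have ne: "x n \<noteq> \<tau>0" for n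
  proof
    assume "x n = \<tau>0"
    hence "(\<tau>0 - c) * (cis (1 / (real n + 1)) - 1) = 0" by (simp add: x_def algebra_simps)
    hence "cis (1 / (real n + 1)) = 1" using assms(1) by simp
    hence "sin (1 / (real n + 1)) = 0" by (metis cis.sel(2) one_complex.sel(2))
    moreover have "0 < 1 / (real n + 1)" "1 / (real n + 1) \<le> 1" by (auto simp: field_simps)
    hence "sin (1 / (real n + 1)) > 0" using pi_gt3 by (intro sin_gt_zero) linarith+
    ultimately show False by simp
  qed
  have "filterlim x (at \<tau>0) sequentially"
    using lim ne by (simp add: filterlim_at)
  hence *: "(\<lambda>n. F (x n)) \<longlonglongrightarrow> L"
    and **: "eventually (\<lambda>n. norm (x n - c) = norm (\<tau>0 - c) \<longrightarrow> F (x n) \<in> \<real>) sequentially"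
    using F ev by (auto intro: filterlim_compose simp: filterlim_iff)
  have "norm (x n - c) = norm (\<tau>0 - c)" for n by (simp add: x_def norm_mult)
  hence "eventually (\<lambda>n. F (x n) \<in> \<real>) sequentially" using ** by simp
  from Lim_in_closed_set[OF closed_complex_Reals this _ *] show ?thesis by simp
qed

text \<open>Splitting off the pole gives \<open>(\<tau> - c) h = C - \<i> m / (4 pi) W\<close>,
  where \<open>Re W\<close> vanishes on the circle and is positive outside. Hence \<open>C\<close>
  is real along the circle, so its imaginary part tends to 0, and outside the circle the pole term
  can only lower \<open>Im ((\<tau> - c) h)\<close>. This is where the sign of the residue
  enters.\<close>

lemma circle_boundary_behaviour:
  fixes h Q b :: "complex \<Rightarrow> complex" and m :: real
  assumes "m \<ge> 0" "e > 0" "\<tau>0 \<noteq> c"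
    and b: "b holomorphic_on ball \<tau>0 e"
    and h: "\<And>\<tau>. \<tau> \<in> ball \<tau>0 e \<Longrightarrow> \<tau> \<noteq> \<tau>0 \<Longrightarrow> h \<tau> = m / (2 * of_real pi * \<i> * (\<tau> - \<tau>0)) + b \<tau>"
    and real: "\<And>\<tau>. \<tau> \<in> ball \<tau>0 e \<Longrightarrow> \<tau> \<noteq> \<tau>0 \<Longrightarrow> norm (\<tau> - c) = norm (\<tau>0 - c) \<Longrightarrow> (\<tau> - c) * h \<tau> \<in> \<real>"
    and Q: "Q holomorphic_on ball \<tau>0 e"
    and Qreal: "\<And>\<tau>. \<tau> \<in> ball \<tau>0 e \<Longrightarrow> norm (\<tau> - c) = norm (\<tau>0 - c) \<Longrightarrow> Q \<tau> \<in> \<real>"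
    and Qpos: "Re (Q \<tau>0) \<ge> 0"
    and "\<epsilon> > 0"
  shows "\<exists>d>0. \<forall>\<tau>. dist \<tau> \<tau>0 < d \<and> norm (\<tau> - c) > norm (\<tau>0 - c) \<longrightarrow> - Im (Q \<tau> * (\<tau> - c) * h \<tau>) > - \<epsilon>"
proof -
  define Q0 where "Q0 = Re (Q \<tau>0)"
  have Q0: "Q \<tau>0 = of_real Q0"
    using Qreal[of \<tau>0] assms(2) by (simp add: Q0_def)
  define C where "C = (\<lambda>\<tau>. (\<tau> - c) * b \<tau> - \<i> * of_real (m / (4 * pi)))"
  \<comment> \<open>Sends the circle to the imaginary axis and its exterior to the right half-plane.
    The constant in \<open>C\<close> compensates for writing \<open>2 (\<tau> - c)\<close> as
    \<open>(\<tau> - \<tau>0) * (W + 1)\<close>.\<close>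
  define W where "W = (\<lambda>\<tau>. ((\<tau> - c) + (\<tau>0 - c)) / (\<tau> - \<tau>0))"
  \<comment> \<open>The error of replacing \<open>Q\<close> by its value at \<open>\<tau>0\<close>;
    the zero of \<open>Q \<tau> - Q \<tau>0\<close> cancels the simple pole of
    \<open>h\<close>.\<close>
  define D where "D = (\<lambda>\<tau>. (\<tau> - c) * ((Q \<tau> - Q \<tau>0) / (\<tau> - \<tau>0)) * (m / (2 * of_real pi * \<i>) + (\<tau> - \<tau>0) * b \<tau>))"
  have ev_ball: "eventually (\<lambda>\<tau>. \<tau> \<in> ball \<tau>0 e \<and> \<tau> \<noteq> \<tau>0) (at \<tau>0)"
    using eventually_at_in_open[of "ball \<tau>0 e" \<tau>0] assms(2) by simp
  have bcont: "isCont b \<tau>0"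
    using holomorphic_on_imp_continuous_on[OF b] assms(2) by (simp add: continuous_on_eq_continuous_at)
  have hC: "(\<tau> - c) * h \<tau> = C \<tau> - \<i> * of_real (m / (4 * pi)) * W \<tau>"
    if "\<tau> \<in> ball \<tau>0 e" "\<tau> \<noteq> \<tau>0" for \<tau>
  proof -
    define s where "s = \<tau> - \<tau>0"
    have \<tau>: "\<tau> = \<tau>0 + s" and "s \<noteq> 0" using that by (auto simp: s_def)
    define K where "K = complex_of_real (m / (4 * pi))"
    have "m / (2 * of_real pi * \<i> * s) = - 2 * \<i> * K / s"
      using \<open>s \<noteq> 0\<close> by (simp add: K_def field_simps)
    hence hs: "h \<tau> = - 2 * \<i> * K / s + b \<tau>"
      using h[OF that] by (simp add: s_def)
    show ?thesis
      using \<open>s \<noteq> 0\<close> unfolding C_def W_def hs K_def[symmetric] by (simp add: \<tau> field_simps)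
  qed
  have ReW: "Re (W \<tau>) = (norm (\<tau> - c) ^ 2 - norm (\<tau>0 - c) ^ 2) / norm (\<tau> - \<tau>0) ^ 2" for \<tau>
    unfolding W_def Re_divide cmod_power2 by (simp add: power2_eq_square algebra_simps)
  have "(C \<longlongrightarrow> C \<tau>0) (at \<tau>0)"
    unfolding C_def by (intro tendsto_intros) (use bcont in \<open>simp add: isCont_def\<close>)
  have "C \<tau>0 \<in> \<real>"
  proof (rule circle_approach_eventually[OF assms(3) \<open>(C \<longlongrightarrow> C \<tau>0) (at \<tau>0)\<close>])
    show "eventually (\<lambda>\<tau>. norm (\<tau> - c) = norm (\<tau>0 - c) \<longrightarrow> C \<tau> \<in> \<real>) (at \<tau>0)"
      using ev_ball
    proof eventually_elim
      case (elim \<tau>)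
      show ?case
      proof
        assume *: "norm (\<tau> - c) = norm (\<tau>0 - c)"
        define P where "P = (\<tau> - c) * h \<tau>"
        have "Im P = 0" using real[of \<tau>] elim * by (auto simp: complex_is_Real_iff P_def)
        moreover have "C \<tau> = P + \<i> * of_real (m / (4 * pi)) * W \<tau>"
          using hC[of \<tau>] elim by (simp add: P_def)
        ultimately have "Im (C \<tau>) = 0" using ReW[of \<tau>] * by simp
        thus "C \<tau> \<in> \<real>" by (simp add: complex_is_Real_iff)
      qed
    qed
  qed
  hence limC: "((\<lambda>\<tau>. Im (C \<tau>)) \<longlongrightarrow> 0) (at \<tau>0)"
    using tendsto_Im[OF \<open>(C \<longlongrightarrow> C \<tau>0) (at \<tau>0)\<close>] by (simp add: complex_is_Real_iff)
  obtain Q' where "(Q has_field_derivative Q') (at \<tau>0)"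
    using Q assms(2) by (meson centre_in_ball field_differentiable_def holomorphic_on_imp_differentiable_at open_ball)
  hence Q': "((\<lambda>\<tau>. (Q \<tau> - Q \<tau>0) / (\<tau> - \<tau>0)) \<longlongrightarrow> Q') (at \<tau>0)"
    by (simp add: has_field_derivative_iff)
  define L where "L = (\<tau>0 - c) * Q' * (m / (2 * of_real pi * \<i>) + (\<tau>0 - \<tau>0) * b \<tau>0)"
  have limD: "(D \<longlongrightarrow> L) (at \<tau>0)"
    unfolding D_def L_def by (intro tendsto_intros Q') (use bcont in \<open>simp_all add: isCont_def\<close>)
  have hD: "D \<tau> = (Q \<tau> - Q \<tau>0) * ((\<tau> - c) * h \<tau>)" if "\<tau> \<in> ball \<tau>0 e" "\<tau> \<noteq> \<tau>0" for \<tau>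
  proof -
    have "(\<tau> - \<tau>0) * h \<tau> = m / (2 * of_real pi * \<i>) + (\<tau> - \<tau>0) * b \<tau>"
      using that h[OF that] by (simp add: field_simps)
    hence "D \<tau> = (\<tau> - c) * ((Q \<tau> - Q \<tau>0) / (\<tau> - \<tau>0)) * ((\<tau> - \<tau>0) * h \<tau>)" by (simp only: D_def)
    thus ?thesis using that by simp
  qed
  have "L \<in> \<real>"
  proof (rule circle_approach_eventually[OF assms(3) limD])
    show "eventually (\<lambda>\<tau>. norm (\<tau> - c) = norm (\<tau>0 - c) \<longrightarrow> D \<tau> \<in> \<real>) (at \<tau>0)"
      using ev_ball
    proof eventually_elim
      case (elim \<tau>)
      thus ?case using hD[of \<tau>] real[of \<tau>] Qreal[of \<tau>] Q0 by (auto intro!: Reals_mult Reals_diff)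
    qed
  qed
  hence limD': "((\<lambda>\<tau>. Im (D \<tau>)) \<longlongrightarrow> 0) (at \<tau>0)"
    using tendsto_Im[OF limD] by (simp add: complex_is_Real_iff)
  have "((\<lambda>\<tau>. - (Q0 * Im (C \<tau>)) - Im (D \<tau>)) \<longlongrightarrow> - (Q0 * 0) - 0) (at \<tau>0)"
    by (intro tendsto_intros limC limD')
  hence "eventually (\<lambda>\<tau>. - (Q0 * Im (C \<tau>)) - Im (D \<tau>) > - \<epsilon>) (at \<tau>0)"
    by (rule order_tendstoD) (use assms in auto)
  with ev_ball have "eventually (\<lambda>\<tau>. norm (\<tau> - c) > norm (\<tau>0 - c) \<longrightarrow> - Im (Q \<tau> * (\<tau> - c) * h \<tau>) > - \<epsilon>) (at \<tau>0)"
  proof eventually_elim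
    case (elim \<tau>)
    show ?case
    proof
      assume gt: "norm (\<tau> - c) > norm (\<tau>0 - c)"
      have "norm (\<tau> - c) ^ 2 > norm (\<tau>0 - c) ^ 2" using gt by (intro power_strict_mono) auto
      hence W: "Re (W \<tau>) \<ge> 0"
        unfolding ReW by (intro divide_nonneg_nonneg) (simp_all only: diff_ge_0_iff_ge less_imp_le zero_le_power2)
      have "Q \<tau> * (\<tau> - c) * h \<tau> = of_real Q0 * ((\<tau> - c) * h \<tau>) + D \<tau>"
        using elim hD[of \<tau>] Q0 by (simp add: algebra_simps)
      also have "\<dots> = of_real Q0 * C \<tau> - of_real Q0 * (\<i> * of_real (m / (4 * pi)) * W \<tau>) + D \<tau>"
        by (subst hC) (use elim in \<open>auto simp: right_diff_distrib\<close>)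
      finally have "- Im (Q \<tau> * (\<tau> - c) * h \<tau>) =
          Q0 * (m / (4 * pi)) * Re (W \<tau>) - (Q0 * Im (C \<tau>)) - Im (D \<tau>)" by simp
      moreover have "Q0 * (m / (4 * pi)) * Re (W \<tau>) \<ge> 0"
        using W assms by (intro mult_nonneg_nonneg) (auto simp: Q0_def)
      ultimately show "- Im (Q \<tau> * (\<tau> - c) * h \<tau>) > - \<epsilon>" using elim by linarith
    qed
  qed
  then obtain d where d: "d > 0" "\<And>\<tau>. \<tau> \<noteq> \<tau>0 \<Longrightarrow> dist \<tau> \<tau>0 < d \<Longrightarrow>
      norm (\<tau> - c) > norm (\<tau>0 - c) \<longrightarrow> - Im (Q \<tau> * (\<tau> - c) * h \<tau>) > - \<epsilon>"
    unfolding eventually_at by auto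
  show ?thesis
  proof (intro exI[of _ d] conjI allI impI)
    fix \<tau> assume *: "dist \<tau> \<tau>0 < d \<and> norm (\<tau> - c) > norm (\<tau>0 - c)"
    hence "\<tau> \<noteq> \<tau>0" by auto
    thus "- Im (Q \<tau> * (\<tau> - c) * h \<tau>) > - \<epsilon>" using d(2) * by blast
  qed (rule d(1))
qed

text \<open>Makes a pointwise estimate at the arc uniform, as needed for whole concentric arcs:
  counterexamples with \<open>g\<close> tending to \<open>r\<close> would accumulate at a point of
  the level set.\<close>

lemma compact_uniform_near:
  fixes g :: "complex \<Rightarrow> real"
  assumes "compact C" "continuous_on C g"
    and "\<And>z. z \<in> C \<Longrightarrow> g z = r \<Longrightarrow> \<exists>d>0. \<forall>w. dist w z < d \<and> g w > r \<longrightarrow> P w"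
  shows "\<exists>\<delta>>0. \<forall>w\<in>C. r < g w \<and> g w < r + \<delta> \<longrightarrow> P w"
proof (rule ccontr)
  assume "\<not> ?thesis"
  hence "\<exists>w\<in>C. r < g w \<and> g w < r + 1 / (real n + 1) \<and> \<not> P w" for n :: nat
    by (metis add_pos_nonneg divide_pos_pos of_nat_0_le_iff zero_less_one add.commute)
  then obtain x where x: "\<And>n::nat. x n \<in> C" "\<And>n. r < g (x n)" "\<And>n. g (x n) < r + 1 / (real n + 1)" "\<And>n. \<not> P (x n)"
    by metis
  obtain l s where l: "l \<in> C" "strict_mono s" "(x \<circ> s) \<longlonglongrightarrow> l"
    using assms(1) x(1) unfolding compact_def by blast
  have "(\<lambda>n. g ((x \<circ> s) n)) \<longlonglongrightarrow> g l"
    using continuous_on_tendsto_compose[OF assms(2) l(3,1)] x(1) by auto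
  moreover have "(\<lambda>n. g ((x \<circ> s) n)) \<longlonglongrightarrow> r"
  proof -
    have "(\<lambda>n. r + 1 / (real n + 1)) \<longlonglongrightarrow> r + 0"
      by (intro tendsto_intros) (use LIMSEQ_inverse_real_of_nat in \<open>simp add: inverse_eq_divide add_ac\<close>)
    from LIMSEQ_subseq_LIMSEQ[OF this l(2)]
    have 1: "(\<lambda>n. r + 1 / (real (s n) + 1)) \<longlonglongrightarrow> r" by (simp add: o_def)
    have 2: "eventually (\<lambda>n. r \<le> g ((x \<circ> s) n)) sequentially"
      using x(2) by (auto intro!: always_eventually less_imp_le)
    have 3: "eventually (\<lambda>n. g ((x \<circ> s) n) \<le> r + 1 / (real (s n) + 1)) sequentially"
      using x(3) by (auto intro!: always_eventually less_imp_le)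
    show ?thesis by (rule tendsto_sandwich[OF 2 3 tendsto_const 1])
  qed
  ultimately have "g l = r" by (rule LIMSEQ_unique)
  then obtain d where d: "d > 0" "\<And>w. dist w l < d \<Longrightarrow> g w > r \<Longrightarrow> P w"
    using assms(3)[OF l(1)] by auto
  obtain n where "dist ((x \<circ> s) n) l < d" using metric_LIMSEQ_D[OF l(3) d(1)] by blast
  thus False using d(2) x(2,4) by auto
qed

text \<open>The angular derivative of \<open>Re H\<close> is \<open>Re (\<i> \<rho> cis \<theta> h)
  = - Im (\<rho> cis \<theta> h)\<close>; adding \<open>\<epsilon> \<theta>\<close> makes it
  nonnegative.\<close>

lemma Re_primitive_mono_circle:
  fixes H h :: "complex \<Rightarrow> complex"
  assumes "\<theta>1 \<le> \<theta>2"
    and H: "\<And>\<theta>. \<theta>1 \<le> \<theta> \<Longrightarrow> \<theta> \<le> \<theta>2 \<Longrightarrow>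
       (H has_field_derivative h (c + of_real \<rho> * cis \<theta>)) (at (c + of_real \<rho> * cis \<theta>))"
    and h: "\<And>\<theta>. \<theta>1 \<le> \<theta> \<Longrightarrow> \<theta> \<le> \<theta>2 \<Longrightarrow> - Im (of_real \<rho> * cis \<theta> * h (c + of_real \<rho> * cis \<theta>)) \<ge> - \<epsilon>"
  shows "Re (H (c + of_real \<rho> * cis \<theta>1)) \<le> Re (H (c + of_real \<rho> * cis \<theta>2)) + \<epsilon> * (\<theta>2 - \<theta>1)"
proof -
  have "Re (H (c + of_real \<rho> * cis \<theta>1)) + \<epsilon> * \<theta>1 \<le> Re (H (c + of_real \<rho> * cis \<theta>2)) + \<epsilon> * \<theta>2"
  proof (rule DERIV_nonneg_imp_nondecreasing[OF assms(1)])
    fix \<theta> assume \<theta>: "\<theta>1 \<le> \<theta>" "\<theta> \<le> \<theta>2"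
    have 1: "((\<lambda>t. c + of_real \<rho> * cis t) has_vector_derivative (of_real \<rho> * (\<i> * cis \<theta>))) (at \<theta>)"
      unfolding cis_conv_exp by (rule has_vector_derivative_real_field) (auto intro!: derivative_eq_intros)
    have "((\<lambda>t. H (c + of_real \<rho> * cis t)) has_vector_derivative
            (of_real \<rho> * (\<i> * cis \<theta>)) * h (c + of_real \<rho> * cis \<theta>)) (at \<theta>)"
      using field_vector_diff_chain_at[OF 1 H[OF \<theta>]] by (simp add: o_def)
    hence "((\<lambda>t. Re (H (c + of_real \<rho> * cis t))) has_vector_derivative
            Re ((of_real \<rho> * (\<i> * cis \<theta>)) * h (c + of_real \<rho> * cis \<theta>))) (at \<theta>)"
      by (rule bounded_linear.has_vector_derivative[OF bounded_linear_Re])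
    hence "((\<lambda>t. Re (H (c + of_real \<rho> * cis t)) + \<epsilon> * t) has_real_derivative
            (Re ((of_real \<rho> * (\<i> * cis \<theta>)) * h (c + of_real \<rho> * cis \<theta>)) + \<epsilon>)) (at \<theta>)"
      unfolding has_real_derivative_iff_has_vector_derivative[symmetric]
      by (intro DERIV_add DERIV_cmult_Id)
    moreover have "(of_real \<rho> * (\<i> * cis \<theta>)) * h (c + of_real \<rho> * cis \<theta>) = \<i> * (of_real \<rho> * cis \<theta> * h (c + of_real \<rho> * cis \<theta>))"
      by (simp add: mult_ac)
    hence "Re ((of_real \<rho> * (\<i> * cis \<theta>)) * h (c + of_real \<rho> * cis \<theta>)) + \<epsilon> \<ge> 0"
      using h[OF \<theta>] by simp
    ultimately show "\<exists>y. ((\<lambda>t. Re (H (c + of_real \<rho> * cis t)) + \<epsilon> * t) has_real_derivative y) (at \<theta>) \<and> y \<ge> 0"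
      by blast
  qed
  thus ?thesis by (simp add: algebra_simps)
qed

text \<open>A zero of order \<open>n \<ge> 2\<close> turns a half-disc into a sector of angle at least \<open>2\<pi>\<close>.\<close>

lemma half_disc_double_zero:
  fixes G :: "complex \<Rightarrow> complex" and \<sigma> :: real
  assumes G: "G holomorphic_on ball z0 e" and "e > 0" "G z0 = 0" "deriv G z0 = 0"
    and neg: "\<And>w. w \<in> ball z0 e \<Longrightarrow> \<sigma> * (Re w - Re z0) > 0 \<Longrightarrow> Im (G w) < 0"
    and \<sigma>: "\<bar>\<sigma>\<bar> = 1"
  shows False
proof -
  have "\<not> G constant_on ball z0 e"
  proof
    assume "G constant_on ball z0 e"
    hence "G w = 0" if "w \<in> ball z0 e" for w
      using that assms(2,3) unfolding constant_on_def by (metis centre_in_ball)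
    moreover have "z0 + of_real (\<sigma> * e / 2) \<in> ball z0 e"
      using assms(2) \<sigma> by (simp add: dist_norm norm_mult)
    moreover have "\<sigma> * (Re (z0 + of_real (\<sigma> * e / 2)) - Re z0) > 0"
      using assms(2) \<sigma> by (auto simp: abs_if split: if_splits)
    ultimately show False using neg by force
  qed
  then obtain g r n where n: "0 < n" and r: "0 < r" "ball z0 r \<subseteq> ball z0 e"
    and g: "g holomorphic_on ball z0 r" "\<And>w. w \<in> ball z0 r \<Longrightarrow> G w = (w - z0) ^ n * g w"
      "\<And>w. w \<in> ball z0 r \<Longrightarrow> g w \<noteq> 0"
    using holomorphic_factor_zero_nonconstant[OF G open_ball connected_ball] assms(2,3)
    by (metis centre_in_ball)
  have gcont: "isCont g z0"
    using holomorphic_on_imp_continuous_on[OF g(1)] r(1) by (simp add: continuous_on_eq_continuous_at)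
  have "n \<noteq> 1"
  proof
    assume "n = 1"
    have "(G has_field_derivative g z0) (at z0)"
      unfolding has_field_derivative_iff
    proof (rule Lim_transform_eventually)
      show "(g \<longlongrightarrow> g z0) (at z0)" using gcont by (simp add: isCont_def)
      show "eventually (\<lambda>w. g w = (G w - G z0) / (w - z0)) (at z0)"
        using eventually_at_in_open[of "ball z0 r" z0] r(1) by (auto elim!: eventually_mono simp: \<open>n = 1\<close> g assms(3))
    qed
    thus False using assms(4) g(3)[of z0] r(1) DERIV_imp_deriv by fastforce
  qed
  hence n2: "n \<ge> 2" using n by simp
  define g0 where "g0 = of_real \<sigma> ^ n * g z0"
  have g0: "g0 \<noteq> 0" using g(3)[of z0] r(1) \<sigma> by (auto simp: g0_def)
  define \<phi> where "\<phi> = Arg g0"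
  have \<phi>: "- pi < \<phi>" "\<phi> \<le> pi" using Arg_bounded[of g0] by (auto simp: \<phi>_def)
  \<comment> \<open>\<open>\<beta>\<close> is an argument in the upper half-plane that
    \<open>G\<close> is to take, reached from \<open>\<phi>\<close> by turning less than
    \<open>pi\<close>. The direction then turns by \<open>(\<beta> - \<phi>) / n\<close>, less than
    \<open>pi / 2\<close> since \<open>n >= 2\<close>, and stays in the half-disc. For
    \<open>\<phi>\<close> near \<open>- pi\<close> the argument \<open>pi / 2\<close> is too far, so
    it is taken a full turn lower.\<close>
  obtain \<beta> where \<beta>: "\<bar>\<beta> - \<phi>\<bar> < pi" "sin \<beta> > 0"
  proof (cases "\<phi> \<ge> - (pi / 2)")
    case True
    show ?thesis
      by (rule that[of "pi / 4"]) (use True \<phi> in \<open>auto simp: abs_if intro!: sin_gt_zero\<close>)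
  next
    case False
    have "sin (- (3 * pi / 2)) = sin (pi / 2 - 2 * pi)" by (rule arg_cong[where f = sin]) simp
    also have "\<dots> = 1" by (simp only: sin_diff) simp
    finally have "sin (- (3 * pi / 2)) = 1" .
    thus ?thesis
      by (intro that[of "- (3 * pi / 2)"]) (use False \<phi> in \<open>auto simp: abs_if\<close>)
  qed
  define \<alpha> where "\<alpha> = (\<beta> - \<phi>) / n"
  have "\<bar>\<alpha>\<bar> < pi / 2"
  proof -
    have "\<bar>\<alpha>\<bar> = \<bar>\<beta> - \<phi>\<bar> / n" by (simp add: \<alpha>_def)
    also have "\<dots> \<le> \<bar>\<beta> - \<phi>\<bar> / 2" using n2 by (intro divide_left_mono) auto
    also have "\<dots> < pi / 2" using \<beta> by simp
    finally show ?thesis .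
  qed
  hence cos: "cos \<alpha> > 0" by (intro cos_gt_zero_pi) auto
  define d where "d = of_real \<sigma> * cis \<alpha>"
  have nd: "norm d = 1" using \<sigma> by (simp add: d_def norm_mult)
  have "d ^ n * g z0 = cis \<alpha> ^ n * g0" by (simp add: d_def g0_def power_mult_distrib)
  also have "cis \<alpha> ^ n = cis (\<beta> - \<phi>)" using n by (simp add: Complex.DeMoivre \<alpha>_def)
  also have "g0 = norm g0 * cis \<phi>" using g0 by (simp add: \<phi>_def cis_Arg sgn_eq)
  also have "cis (\<beta> - \<phi>) * (norm g0 * cis \<phi>) = norm g0 * cis \<beta>"
    by (simp add: cis_mult mult.left_commute)
  finally have "Im (d ^ n * g z0) > 0" using g0 \<beta> by simp
  moreover have "((\<lambda>t::real. Im (d ^ n * g (z0 + of_real t * d))) \<longlongrightarrow> Im (d ^ n * g z0)) (at_right 0)"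
  proof -
    have "((\<lambda>t::real. z0 + of_real t * d) \<longlongrightarrow> z0 + of_real 0 * d) (at_right 0)"
      by (intro tendsto_intros)
    hence "((\<lambda>t::real. z0 + of_real t * d) \<longlongrightarrow> z0) (at_right 0)" by simp
    hence "((\<lambda>t::real. g (z0 + of_real t * d)) \<longlongrightarrow> g z0) (at_right 0)"
      by (rule isCont_tendsto_compose[OF gcont])
    thus ?thesis by (intro tendsto_Im tendsto_mult tendsto_const)
  qed
  ultimately have "eventually (\<lambda>t. Im (d ^ n * g (z0 + of_real t * d)) > 0) (at_right (0::real))"
    using order_tendstoD(1) by blast
  moreover have "eventually (\<lambda>t. t \<in> {0<..<r}) (at_right (0::real))"
    by (rule eventually_at_right_real[OF r(1)])
  ultimately have "eventually (\<lambda>t::real. False) (at_right 0)"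
  proof eventually_elim
    case (elim t)
    define w where "w = z0 + of_real t * d"
    have w: "w \<in> ball z0 r" using elim nd by (simp add: w_def dist_norm norm_mult)
    have "Im (G w) = t ^ n * Im (d ^ n * g w)"
      using g(2)[OF w] by (simp add: w_def power_mult_distrib mult.assoc flip: of_real_power)
    hence "Im (G w) > 0" using elim by (simp add: w_def)
    moreover have "\<sigma> * (Re w - Re z0) = \<sigma> ^ 2 * t * cos \<alpha>"
      by (simp add: w_def d_def power2_eq_square)
    hence "\<sigma> * (Re w - Re z0) > 0" using elim cos \<sigma> by (auto simp: power2_eq_square abs_if split: if_splits)
    ultimately show False using neg[of w] w r(2) by force
  qed
  thus False by simp
qed

text \<open>Differentiating along the ray keeps real values real, and continuity carries this to the
  endpoint, where reality is known only from one side.\<close>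

lemma higher_deriv_Reals:
  fixes Q :: "complex \<Rightarrow> complex"
  assumes "Q holomorphic_on ball 0 e" "e > 0" "\<And>t. 0 < t \<Longrightarrow> t < e \<Longrightarrow> Q (of_real t) \<in> \<real>"
  shows "(deriv ^^ j) Q 0 \<in> \<real>"
proof -
  have hol: "(deriv ^^ j) Q holomorphic_on ball 0 e" for j
    by (rule holomorphic_higher_deriv[OF assms(1) open_ball])
  have *: "(deriv ^^ j) Q (of_real t) \<in> \<real>" if "0 < t" "t < e" for t j
    using that
  proof (induction j arbitrary: t)
    case (Suc j)
    define F where "F = (deriv ^^ j) Q"
    have "(F has_field_derivative deriv F (of_real t)) (at (of_real t))"
      using hol[of j] Suc.prems unfolding F_def
      by (intro holomorphic_derivI[OF _ open_ball]) auto
    hence "((\<lambda>s::real. F (of_real s)) has_vector_derivative deriv F (of_real t)) (at t)"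
      by (rule has_vector_derivative_real_field)
    hence "((\<lambda>s::real. Im (F (of_real s))) has_vector_derivative Im (deriv F (of_real t))) (at t)"
      by (rule bounded_linear.has_vector_derivative[OF bounded_linear_Im])
    moreover have "((\<lambda>s::real. Im (F (of_real s))) has_vector_derivative 0) (at t)"
    proof (rule has_vector_derivative_transform_within_open)
      show "((\<lambda>s::real. 0::real) has_vector_derivative 0) (at t)" by (rule has_vector_derivative_const)
      show "open {0<..<e}" "t \<in> {0<..<e}" using Suc.prems by auto
      show "0 = Im (F (of_real s))" if "s \<in> {0<..<e}" for s
        using Suc.IH[of s] that by (simp add: F_def complex_is_Real_iff)
    qed
    ultimately have "Im (deriv F (of_real t)) = 0"
      by (rule vector_derivative_unique_at)
    thus ?case by (simp add: F_def complex_is_Real_iff)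
  qed (use assms(3) in auto)
  have "isCont ((deriv ^^ j) Q) 0"
    using holomorphic_on_imp_continuous_on[OF hol[of j]] assms(2) by (simp add: continuous_on_eq_continuous_at)
  moreover have "((\<lambda>t::real. complex_of_real t) \<longlongrightarrow> 0) (at_right 0)"
    using tendsto_of_real[OF tendsto_ident_at, of 0 "{0<..}", where 'a = complex] by simp
  ultimately have "((\<lambda>t::real. (deriv ^^ j) Q (of_real t)) \<longlongrightarrow> (deriv ^^ j) Q 0) (at_right 0)"
    by (rule isCont_tendsto_compose)
  moreover have "eventually (\<lambda>t::real. (deriv ^^ j) Q (of_real t) \<in> \<real>) (at_right 0)"
    using eventually_at_right_real[OF assms(2)] by eventually_elim (use * in auto)
  ultimately show ?thesis
    using Lim_in_closed_set[OF closed_complex_Reals, of "\<lambda>t. (deriv ^^ j) Q (of_real t)" "at_right (0::real)"]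
    by simp
qed

text \<open>If \<open>q_j\<close> is the Taylor coefficient of order \<open>j\<close>, the first ray
  makes \<open>q_j\<close> real and the second makes \<open>cis (j pi / n) * q_j\<close> real. For
  \<open>0 < j < n\<close> the sine of \<open>j pi / n\<close> is nonzero, so
  \<open>q_j = 0\<close>. Thus \<open>(Q v - Q 0) / v^n\<close> is a real constant plus a term of
  order \<open>norm v\<close>.\<close>

lemma corner_expansion:
  fixes Q :: "complex \<Rightarrow> complex"
  assumes Q: "Q holomorphic_on ball 0 e" and "e > 0" "n > 0"
    and 1: "\<And>t. 0 < t \<Longrightarrow> t < e \<Longrightarrow> Q (of_real t) \<in> \<real>"
    and 2: "\<And>t. 0 < t \<Longrightarrow> t < e \<Longrightarrow> Q (of_real t * cis (pi / n)) \<in> \<real>"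
    and "\<epsilon> > 0"
  shows "\<exists>d>0. \<forall>v. v \<noteq> 0 \<and> norm v < d \<longrightarrow> \<bar>Im ((Q v - Q 0) / v ^ n)\<bar> < \<epsilon>"
proof -
  define u where "u = cis (pi / n)"
  have real: "(deriv ^^ j) Q 0 \<in> \<real>" for j
    by (rule higher_deriv_Reals[OF Q assms(2)]) (use 1 in auto)
  have "(deriv ^^ j) (\<lambda>v. Q (u * v)) 0 = u ^ j * (deriv ^^ j) Q 0" for j
    by (subst higher_deriv_compose_linear[OF Q open_ball[of 0 e] open_ball])
       (use assms(2) in \<open>auto simp: norm_mult u_def\<close>)
  moreover have "(deriv ^^ j) (\<lambda>v. Q (u * v)) 0 \<in> \<real>" for j
  proof (rule higher_deriv_Reals[OF _ assms(2)])
    show "(\<lambda>v. Q (u * v)) holomorphic_on ball 0 e"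
      by (rule holomorphic_on_compose_gen[OF _ Q, unfolded o_def])
         (auto intro!: holomorphic_intros simp: dist_norm norm_mult u_def)
  qed (use 2 in \<open>auto simp: u_def mult_ac\<close>)
  ultimately have real2: "u ^ j * (deriv ^^ j) Q 0 \<in> \<real>" for j by metis
  have zero: "(deriv ^^ j) Q 0 = 0" if "0 < j" "j < n" for j
  proof (rule ccontr)
    assume "(deriv ^^ j) Q 0 \<noteq> 0"
    hence "u ^ j \<in> \<real>"
      using Reals_divide[OF real2[of j] real[of j]] by simp
    hence "cis (real j * (pi / n)) \<in> \<real>" by (simp only: u_def Complex.DeMoivre)
    hence "sin (real j * (pi / n)) = 0" by (simp add: complex_is_Real_iff)
    moreover have "sin (real j * (pi / n)) > 0"
      using that by (intro sin_gt_zero) (auto simp: field_simps)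
    ultimately show False by simp
  qed
  define B0 where "B0 = cball (0::complex) (e / 2)"
  have B0: "B0 \<subseteq> ball 0 e" "convex B0" using assms(2) by (auto simp: B0_def)
  have "continuous_on B0 ((deriv ^^ Suc n) Q)"
    using holomorphic_on_imp_continuous_on[OF holomorphic_higher_deriv[OF Q open_ball, of "Suc n"]] B0(1)
    by (rule continuous_on_subset)
  hence "compact ((deriv ^^ Suc n) Q ` B0)"
    by (rule compact_continuous_image) (simp add: B0_def)
  then obtain B where B: "\<And>v. v \<in> B0 \<Longrightarrow> norm ((deriv ^^ Suc n) Q v) \<le> B" "B > 0"
    using compact_imp_bounded bounded_pos by (metis (no_types, lifting) image_eqI)
  have bound: "\<bar>Im ((Q v - Q 0) / v ^ n)\<bar> \<le> B * norm v" if v: "v \<in> B0" "v \<noteq> 0" for v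
  proof -
    have "norm (Q v - (\<Sum>i\<le>n. (deriv ^^ i) Q 0 * (v - 0) ^ i / fact i)) \<le> B * norm (v - 0) ^ Suc n / fact n"
    proof (rule complex_Taylor[where f = "\<lambda>i. (deriv ^^ i) Q" and S = B0, OF B0(2), unfolded funpow_0])
      fix i x assume "x \<in> B0" "i \<le> n"
      show "((deriv ^^ i) Q has_field_derivative (deriv ^^ Suc i) Q x) (at x within B0)"
        unfolding funpow.simps o_apply by (rule has_field_derivative_at_within, rule holomorphic_derivI[OF holomorphic_higher_deriv[OF Q open_ball] open_ball])
           (use \<open>x \<in> B0\<close> B0 in auto)
    qed (use v B assms(2) in \<open>auto simp: B0_def\<close>)
    also have "(\<Sum>i\<le>n. (deriv ^^ i) Q 0 * (v - 0) ^ i / fact i) = (\<Sum>i\<in>{0,n}. (deriv ^^ i) Q 0 * (v - 0) ^ i / fact i)"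
      by (rule sum.mono_neutral_right) (use zero in \<open>auto simp: le_less\<close>)
    also have "\<dots> = Q 0 + (deriv ^^ n) Q 0 * v ^ n / fact n" using assms(3) by simp
    finally have "norm (Q v - Q 0 - (deriv ^^ n) Q 0 * v ^ n / fact n) \<le> B * norm v ^ Suc n / fact n"
      by (simp add: algebra_simps)
    also have "\<dots> \<le> B * norm v ^ Suc n / 1"
      using B by (intro divide_left_mono) (auto simp: fact_ge_1)
    finally have le: "norm (Q v - Q 0 - (deriv ^^ n) Q 0 * v ^ n / fact n) \<le> (B * norm v) * norm v ^ n" by (simp add: mult_ac)
    have eq: "norm ((Q v - Q 0) / v ^ n - (deriv ^^ n) Q 0 / fact n) =
         norm (Q v - Q 0 - (deriv ^^ n) Q 0 * v ^ n / fact n) / norm v ^ n"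
      using v by (simp flip: norm_divide norm_power add: field_simps)
    have "norm ((Q v - Q 0) / v ^ n - (deriv ^^ n) Q 0 / fact n) \<le> B * norm v"
      unfolding eq using le v by (subst pos_divide_le_eq) auto
    hence "\<bar>Im ((Q v - Q 0) / v ^ n - (deriv ^^ n) Q 0 / fact n)\<bar> \<le> B * norm v"
      using abs_Im_le_cmod order_trans by blast
    moreover have "Im ((deriv ^^ n) Q 0 / fact n) = 0"
      using Reals_divide[OF real[of n] Reals_of_real[of "fact n"]] by (simp add: complex_is_Real_iff)
    ultimately show ?thesis by simp
  qed
  show ?thesis
  proof (intro exI[of _ "min (e / 2) (\<epsilon> / B)"] conjI allI impI)
    fix v :: complex assume v: "v \<noteq> 0 \<and> norm v < min (e / 2) (\<epsilon> / B)"
    have "\<bar>Im ((Q v - Q 0) / v ^ n)\<bar> \<le> B * norm v" by (rule bound) (use v in \<open>auto simp: B0_def\<close>)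
    also have "\<dots> < \<epsilon>" using v B by (simp add: field_simps)
    finally show "\<bar>Im ((Q v - Q 0) / v ^ n)\<bar> < \<epsilon>" .
  qed (use assms B in auto)
qed

section \<open>The half fundamental domain\<close>

text \<open>Squared distance, because for two real centres the difference is affine in
  \<open>Re \<tau>\<close>; comparisons between the arcs become linear.\<close>

definition sqdist :: "real \<Rightarrow> complex \<Rightarrow> real" where
  "sqdist c \<tau> = (Re \<tau> - c) ^ 2 + (Im \<tau>) ^ 2"

lemma sqdist_altdef: "sqdist c \<tau> = norm (\<tau> - of_real c) ^ 2"
  by (simp add: sqdist_def cmod_power2)

lemma sqdist_less_iff: "sqdist c \<tau> < sqdist c \<tau>' \<longleftrightarrow> norm (\<tau> - of_real c) < norm (\<tau>' - of_real c)"
  unfolding sqdist_altdef by (meson norm_ge_zero power2_less_imp_less power_strict_mono zero_less_numeral)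

lemma sqdist_eq_iff: "sqdist c \<tau> = sqdist c \<tau>' \<longleftrightarrow> norm (\<tau> - of_real c) = norm (\<tau>' - of_real c)"
  unfolding sqdist_altdef by simp

lemma continuous_on_sqdist [continuous_intros]:
  "continuous_on A f \<Longrightarrow> continuous_on A (\<lambda>x. sqdist c (f x))"
  unfolding sqdist_def by (intro continuous_intros)

text \<open>Here \<open>N\<close> stands for the set of zeros of a form \<open>f\<close> and \<open>h\<close> for its logarithmic derivative
  minus the corresponding multiple of \<open>E2p\<close>.\<close>

locale fricke_form =
  fixes p :: nat and h :: "complex \<Rightarrow> complex" and N :: "complex set"
  assumes p: "p \<in> {1, 2, 3, 5, 7}"
    and local_form: "Im \<tau>0 > 0 \<Longrightarrow> \<exists>m e b. 0 \<le> m \<and> 0 < e \<and> b holomorphic_on ball \<tau>0 e \<and>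
        (\<forall>\<tau>\<in>ball \<tau>0 e. Im \<tau> > 0 \<and> (\<tau> \<noteq> \<tau>0 \<longrightarrow> \<tau> \<notin> N \<and> h \<tau> = of_real m / (2 * of_real pi * \<i> * (\<tau> - \<tau>0)) + b \<tau>))"
    and differentiable: "Im \<tau> > 0 \<Longrightarrow> \<tau> \<notin> N \<Longrightarrow> h field_differentiable at \<tau>"
    and zeros: "Im \<tau> > 0 \<Longrightarrow> - 1 / 2 \<le> Re \<tau> \<Longrightarrow> Re \<tau> \<le> 0 \<Longrightarrow> 1 / p < sqdist 0 \<tau> \<Longrightarrow>
        1 / (4 * p) < sqdist (- 1 / 2) \<tau> \<Longrightarrow> \<tau> \<notin> N"
    and N_periodic: "Im \<tau> > 0 \<Longrightarrow> \<tau> + 1 \<in> N \<longleftrightarrow> \<tau> \<in> N"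
    and N_reflect: "Im \<tau> > 0 \<Longrightarrow> - cnj \<tau> \<in> N \<longleftrightarrow> \<tau> \<in> N"
    and periodic: "Im \<tau> > 0 \<Longrightarrow> h (\<tau> + 1) = h \<tau>"
    and reflect: "Im \<tau> > 0 \<Longrightarrow> h (- cnj \<tau>) = cnj (h \<tau>)"
    and fricke: "Im \<tau> > 0 \<Longrightarrow> \<tau> \<notin> N \<Longrightarrow> h (- 1 / (of_nat p * \<tau>)) = of_nat p * \<tau> ^ 2 * h \<tau>"
    and involution: "Im \<tau> > 0 \<Longrightarrow> \<tau> \<notin> N \<Longrightarrow> p \<in> {5, 7} \<Longrightarrow>
        h (- 1 / 2 - 1 / (4 * of_nat p * (\<tau> + 1 / 2))) = 4 * of_nat p * (\<tau> + 1 / 2) ^ 2 * h \<tau>"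
    and cusp: "\<exists>M C. \<forall>\<tau>. Im \<tau> \<ge> 2 \<longrightarrow> norm (h \<tau> - of_real M) \<le> C * exp (- 2 * pi * Im \<tau>)"
begin

definition P :: real where "P = 1 / p"

text \<open>Contains the open vertical sides but not the arcs, where the poles of \<open>h\<close>
  may lie. \<open>P\<close> and \<open>P / 4\<close> are the squared radii of the arcs around
  \<open>0\<close> and \<open>-1/2\<close>.\<close>

definition region :: "complex set" where
  "region = {\<tau>. Im \<tau> > 0 \<and> - 1 / 2 \<le> Re \<tau> \<and> Re \<tau> \<le> 0 \<and> P < sqdist 0 \<tau> \<and> P / 4 < sqdist (- 1 / 2) \<tau>}"

definition \<Omega> :: "complex set" where
  "\<Omega> = {\<tau>. Im \<tau> > 0 \<and> - 1 / 2 < Re \<tau> \<and> Re \<tau> < 0 \<and> P < sqdist 0 \<tau> \<and> P / 4 < sqdist (- 1 / 2) \<tau>}"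

text \<open>Covers the region together with parts of its mirror images in both vertical sides: an
  open set free of poles, in which the sides are interior.\<close>

definition U :: "complex set" where
  "U = {\<tau>. Im \<tau> > 0 \<and> - 1 < Re \<tau> \<and> Re \<tau> < 1 / 2 \<and> P < sqdist 0 \<tau> \<and> P < sqdist (- 1) \<tau> \<and>
     P / 4 < sqdist (- 1 / 2) \<tau> \<and> P / 4 < sqdist (1 / 2) \<tau>}"

lemma P_cases: "P = 1 \<or> P = 1 / 2 \<or> P = 1 / 3 \<or> P = 1 / 5 \<or> P = 1 / 7"
  using p by (auto simp: P_def)

lemma P_bounds: "P > 0" "P \<le> 1" "1 / 7 \<le> P"
  using P_cases by auto

lemma P57: "p \<in> {5, 7} \<Longrightarrow> P = 1 / 5 \<or> P = 1 / 7"
  by (auto simp: P_def)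

lemma P123: "p \<notin> {5, 7} \<Longrightarrow> P \<ge> 1 / 3"
  using p by (auto simp: P_def)

lemma sqdist_half: "sqdist (- 1 / 2) \<tau> = sqdist 0 \<tau> + Re \<tau> + 1 / 4"
  "sqdist (1 / 2) \<tau> = sqdist 0 \<tau> - Re \<tau> + 1 / 4"
  "sqdist (- 1) \<tau> = sqdist 0 \<tau> + 2 * Re \<tau> + 1"
  by (simp_all add: sqdist_def power2_eq_square algebra_simps)

text \<open>The lowest corner occurs for \<open>P = 1/7\<close>, at real part \<open>-5/14\<close>
  and height \<open>sqrt 3 / 14 > 1/10\<close>. To the right of it the circle around
  \<open>0\<close> bounds the height, to the left the circle around \<open>-1/2\<close>.\<close>

lemma Im_lower_bound:
  assumes "Im \<tau> \<ge> 0" "- 1 / 2 \<le> Re \<tau>" "Re \<tau> \<le> 0" "P \<le> sqdist 0 \<tau>" "P / 4 \<le> sqdist (- 1 / 2) \<tau>"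
  shows "Im \<tau> \<ge> 1 / 10"
proof -
  have "(Im \<tau>) ^ 2 \<ge> 1 / 100"
  proof (cases "Re \<tau> \<ge> - 5 / 14")
    case True
    have "(- Re \<tau>) ^ 2 \<le> (5 / 14) ^ 2"
      by (rule power_mono) (use True assms in linarith)+
    hence "(Re \<tau>) ^ 2 \<le> 25 / 196" by (simp add: power_divide)
    moreover have "P \<le> (Re \<tau>) ^ 2 + (Im \<tau>) ^ 2" using assms(4) by (simp add: sqdist_def)
    ultimately show ?thesis using P_bounds by linarith
  next
    case False
    have "(Re \<tau> + 1 / 2) ^ 2 \<le> (1 / 7) ^ 2"
      by (rule power_mono) (use False assms in linarith)+
    hence "(Re \<tau> + 1 / 2) ^ 2 \<le> 1 / 49" by (simp add: power_divide)
    moreover have "P / 4 \<le> (Re \<tau> + 1 / 2) ^ 2 + (Im \<tau>) ^ 2" using assms(5) by (simp add: sqdist_def)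
    ultimately show ?thesis using P_bounds by linarith
  qed
  hence "(1 / 10) ^ 2 \<le> (Im \<tau>) ^ 2" by (simp add: power_divide)
  thus ?thesis using assms(1) by (rule power2_le_imp_le)
qed

lemma region_Im: "\<tau> \<in> region \<Longrightarrow> Im \<tau> \<ge> 1 / 10"
  by (rule Im_lower_bound) (auto simp: region_def)

lemma \<Omega>_subset_region: "\<Omega> \<subseteq> region"
  by (auto simp: \<Omega>_def region_def)

lemma region_subset_U: "region \<subseteq> U"
proof
  fix \<tau> assume "\<tau> \<in> region"
  note \<tau> = this[unfolded region_def mem_Collect_eq]
  have "- 1 < Re \<tau>" "Re \<tau> < 1 / 2" "P < sqdist (- 1) \<tau>" "P / 4 < sqdist (1 / 2) \<tau>"
    using \<tau> P_bounds sqdist_half[of \<tau>] by linarith+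
  thus "\<tau> \<in> U" using \<tau> by (simp only: U_def mem_Collect_eq simp_thms)
qed

lemma region_not_N: "\<tau> \<in> region \<Longrightarrow> \<tau> \<notin> N"
  using zeros[of \<tau>] by (auto simp: region_def P_def)

lemma U_reflect:
  assumes "\<tau> \<in> U"
  obtains \<tau>' where "\<tau>' \<in> region" "Im \<tau>' = Im \<tau>" "\<tau>' \<in> N \<longleftrightarrow> \<tau> \<in> N"
proof (cases "Re \<tau> > 0")
  case True
  have "sqdist 0 (- cnj \<tau>) = sqdist 0 \<tau>" "sqdist (- 1 / 2) (- cnj \<tau>) = sqdist (1 / 2) \<tau>"
    by (simp_all add: sqdist_def power2_eq_square algebra_simps)
  hence "- cnj \<tau> \<in> region" using assms True by (simp add: U_def region_def)
  moreover have "- cnj \<tau> \<in> N \<longleftrightarrow> \<tau> \<in> N" using assms by (intro N_reflect) (auto simp: U_def)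
  ultimately show ?thesis by (intro that[of "- cnj \<tau>"]) simp_all
next
  case False
  show ?thesis
  proof (cases "Re \<tau> < - 1 / 2")
    case True
    have "sqdist 0 (- cnj (\<tau> + 1)) = sqdist (- 1) \<tau>" "sqdist (- 1 / 2) (- cnj (\<tau> + 1)) = sqdist (- 1 / 2) \<tau>"
      by (simp_all add: sqdist_def power2_eq_square algebra_simps)
    hence "- cnj (\<tau> + 1) \<in> region" using assms True by (simp add: U_def region_def)
    moreover have "- cnj (\<tau> + 1) \<in> N \<longleftrightarrow> \<tau> \<in> N"
      using assms N_reflect[of "\<tau> + 1"] N_periodic[of \<tau>] by (auto simp: U_def)
    ultimately show ?thesis by (intro that[of "- cnj (\<tau> + 1)"]) simp_all
  next
    case False
    with \<open>\<not> Re \<tau> > 0\<close> assms have "\<tau> \<in> region" by (simp add: U_def region_def)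
    thus ?thesis by (rule that) (rule refl)+
  qed
qed

lemma U_not_N: "\<tau> \<in> U \<Longrightarrow> \<tau> \<notin> N"
  using U_reflect region_not_N by metis

lemma U_Im: "\<tau> \<in> U \<Longrightarrow> Im \<tau> \<ge> 1 / 10"
  using U_reflect region_Im by metis

lemma region_upper: "- 1 / 2 \<le> Re \<tau> \<Longrightarrow> Re \<tau> \<le> 0 \<Longrightarrow> Im \<tau> > 1 \<Longrightarrow> \<tau> \<in> region"
proof -
  assume *: "- 1 / 2 \<le> Re \<tau>" "Re \<tau> \<le> 0" "Im \<tau> > 1"
  have "(Im \<tau>) ^ 2 > 1 ^ 2" using * by (intro power_strict_mono) auto
  hence "sqdist c \<tau> > 1" for c
    using zero_le_power2[of "Re \<tau> - c"] unfolding sqdist_def by (simp only: power_one)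
  from this[of 0] this[of "- 1 / 2"] show ?thesis
    using * P_bounds by (simp add: region_def)
qed

lemma open_\<Omega>: "open \<Omega>"
  unfolding \<Omega>_def by (intro open_Collect_conj open_Collect_less continuous_intros)

lemma open_U: "open U"
  unfolding U_def by (intro open_Collect_conj open_Collect_less continuous_intros)

text \<open>A star centre between the two sides, so high that segments towards it from height at
  least \<open>1/10\<close> move away from every disc involved.\<close>

definition base :: complex where "base = Complex (- 1 / 4) 20"

text \<open>For height \<open>y <= 19.9\<close> the initial derivative of the squared distance along
  the segment is at least \<open>2 * (y * (20 - y) - 9/8)\<close>, and
  \<open>y * (20 - y) >= 1.99\<close> because \<open>y >= 1/10\<close>; the second-order term is
  nonnegative. For larger \<open>y\<close> the whole segment is far above the discs.\<close>

lemma segment_avoids_disc: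
  assumes \<tau>: "- 1 \<le> Re \<tau>" "Re \<tau> \<le> 1 / 2" "Im \<tau> \<ge> 1 / 10" and c: "- 1 \<le> c" "c \<le> 1 / 2"
    and s: "s \<le> 1" "s < sqdist c \<tau>" and z: "z \<in> closed_segment base \<tau>"
  shows "s < sqdist c z"
proof -
  obtain u where u: "0 \<le> u" "u \<le> 1" "z = (1 - u) *\<^sub>R base + u *\<^sub>R \<tau>"
    using z by (auto simp: closed_segment_def)
  define t where "t = 1 - u"
  define x y where "x = Re \<tau>" and "y = Im \<tau>"
  have t: "0 \<le> t" "t \<le> 1" using u by (auto simp: t_def)
  have "Re z = (1 - u) * (- 1 / 4) + u * x" "Im z = (1 - u) * 20 + u * y"
    unfolding u(3) by (simp_all add: base_def x_def y_def)
  hence z: "Re z = x + t * (- 1 / 4 - x)" "Im z = y + t * (20 - y)"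
    unfolding t_def by (simp_all add: algebra_simps)
  show ?thesis
  proof (cases "y \<le> 199 / 10")
    case True
    have 1: "\<bar>(x - c) * (- 1 / 4 - x)\<bar> \<le> (3 / 2) * (3 / 4)"
      unfolding abs_mult x_def by (rule mult_mono) (use \<tau> c in linarith)+
    have "(y - 1 / 10) * (199 / 10 - y) \<ge> 0"
      using True \<tau> by (intro mult_nonneg_nonneg) (auto simp: y_def)
    moreover have "y * (20 - y) = (y - 1 / 10) * (199 / 10 - y) + 199 / 100" by (simp add: field_simps)
    ultimately have 2: "y * (20 - y) \<ge> 199 / 100" by linarith
    have "sqdist c z = sqdist c \<tau> + 2 * t * ((x - c) * (- 1 / 4 - x) + y * (20 - y)) +
        t ^ 2 * ((- 1 / 4 - x) ^ 2 + (20 - y) ^ 2)"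
    proof -
      have "(x + t * a - c) ^ 2 + (y + t * b) ^ 2 = (x - c) ^ 2 + y ^ 2 + 2 * t * ((x - c) * a + y * b) + t ^ 2 * (a ^ 2 + b ^ 2)"
        for a b by (simp add: power2_eq_square algebra_simps)
      thus ?thesis unfolding sqdist_def z x_def[symmetric] y_def[symmetric] .
    qed
    moreover have "2 * t * ((x - c) * (- 1 / 4 - x) + y * (20 - y)) \<ge> 0"
      using t 1 2 by (intro mult_nonneg_nonneg) auto
    moreover have "t ^ 2 * ((- 1 / 4 - x) ^ 2 + (20 - y) ^ 2) \<ge> 0" by simp
    ultimately show ?thesis using s by linarith
  next
    case False
    have "Im z = (1 - t) * y + t * 20" using z by (simp add: algebra_simps)
    also have "\<dots> \<ge> (1 - t) * (199 / 10) + t * (199 / 10)"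
      using False t by (intro add_mono mult_left_mono) auto
    also have "(1 - t) * (199 / 10) + t * (199 / 10) = 199 / 10" by (simp add: field_simps)
    finally have "Im z \<ge> 2" by simp
    hence "(Im z) ^ 2 \<ge> 2 ^ 2" by (intro power_mono) auto
    hence "(Im z) ^ 2 \<ge> 4" by simp
    thus ?thesis using s zero_le_power2[of "Re z - c"] unfolding sqdist_def by linarith
  qed
qed

lemma base_region: "base \<in> region" "base \<in> \<Omega>" "base \<in> U"
proof -
  show 1: "base \<in> region" by (rule region_upper) (simp_all add: base_def)
  thus "base \<in> \<Omega>" by (simp add: region_def \<Omega>_def base_def)
  show "base \<in> U" using 1 region_subset_U by blast
qed

lemma segment_strip:
  assumes "z \<in> closed_segment base \<tau>" "Im \<tau> > 0" "a \<le> - 1 / 4" "- 1 / 4 \<le> b"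
  shows "Im z > 0" "a < Re \<tau> \<Longrightarrow> a < - 1 / 4 \<Longrightarrow> a < Re z" "Re \<tau> < b \<Longrightarrow> - 1 / 4 < b \<Longrightarrow> Re z < b"
proof -
  have "convex {z. Im z > 0}" "convex {z. Re z > a}" "convex {z. Re z < b}"
    by (auto simp: convex_halfspace_Im_gt convex_halfspace_Re_gt convex_halfspace_Re_lt)
  note * = this[THEN convex_contains_segment[THEN iffD1], rule_format]
  show "Im z > 0" using *(1)[of base \<tau>] assms by (auto simp: base_def)
  show "a < Re z" if "a < Re \<tau>" "a < - 1 / 4" using *(2)[of base \<tau>] assms that by (auto simp: base_def)
  show "Re z < b" if "Re \<tau> < b" "- 1 / 4 < b" using *(3)[of base \<tau>] assms that by (auto simp: base_def)
qed

lemma starlike_U: "starlike U"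
  unfolding starlike_def
proof (intro bexI[of _ base] ballI subsetI)
  fix \<tau> z assume \<tau>: "\<tau> \<in> U" and z: "z \<in> closed_segment base \<tau>"
  have "Im \<tau> \<ge> 1 / 10" by (rule U_Im[OF \<tau>])
  note \<tau>' = \<tau>[unfolded U_def mem_Collect_eq]
  have *: "s < sqdist c z" if "- 1 \<le> c" "c \<le> 1 / 2" "s \<le> 1" "s < sqdist c \<tau>" for c s
    by (rule segment_avoids_disc[OF _ _ \<open>Im \<tau> \<ge> 1 / 10\<close> that z]) (use \<tau>' in linarith)+
  have "P < sqdist 0 z" "P < sqdist (- 1) z" "P / 4 < sqdist (- 1 / 2) z" "P / 4 < sqdist (1 / 2) z"
    by (intro *; use \<tau>' P_bounds in linarith)+
  moreover have "Im z > 0" "- 1 < Re z" "Re z < 1 / 2"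
    by (rule segment_strip[OF z, of "-1" "1/2"]; use \<tau>' in linarith)+
  ultimately show "z \<in> U" by (simp only: U_def mem_Collect_eq simp_thms)
qed (rule base_region)

lemma starlike_\<Omega>: "starlike \<Omega>"
  unfolding starlike_def
proof (intro bexI[of _ base] ballI subsetI)
  fix \<tau> z assume \<tau>: "\<tau> \<in> \<Omega>" and z: "z \<in> closed_segment base \<tau>"
  have "Im \<tau> \<ge> 1 / 10" by (rule region_Im) (use \<tau> \<Omega>_subset_region in auto)
  note \<tau>' = \<tau>[unfolded \<Omega>_def mem_Collect_eq]
  have *: "s < sqdist c z" if "- 1 \<le> c" "c \<le> 1 / 2" "s \<le> 1" "s < sqdist c \<tau>" for c s
    by (rule segment_avoids_disc[OF _ _ \<open>Im \<tau> \<ge> 1 / 10\<close> that z]) (use \<tau>' in linarith)+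
  have "P < sqdist 0 z" "P / 4 < sqdist (- 1 / 2) z"
    by (intro *; use \<tau>' P_bounds in linarith)+
  moreover have "Im z > 0" "- 1 / 2 < Re z" "Re z < 0"
    by (rule segment_strip[OF z, of "- 1 / 2" 0]; use \<tau>' in linarith)+
  ultimately show "z \<in> \<Omega>" by (simp only: \<Omega>_def mem_Collect_eq simp_thms)
qed (rule base_region)

lemma h_holomorphic_U: "h holomorphic_on U"
  unfolding holomorphic_on_def
proof
  fix \<tau> assume \<tau>: "\<tau> \<in> U"
  have "h field_differentiable at \<tau>"
    by (rule differentiable[OF _ U_not_N[OF \<tau>]]) (use \<tau> in \<open>simp add: U_def\<close>)
  thus "h field_differentiable at \<tau> within U" by (rule field_differentiable_at_within)
qed

section \<open>Reality on the sides and arcs\<close>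

lemma real_on_imaginary_axis: "Im \<tau> > 0 \<Longrightarrow> Re \<tau> = 0 \<Longrightarrow> h \<tau> \<in> \<real>"
proof -
  assume *: "Im \<tau> > 0" "Re \<tau> = 0"
  hence "- cnj \<tau> = \<tau>" by (simp add: complex_eq_iff)
  thus ?thesis using reflect[OF *(1)] by (simp add: Reals_cnj_iff)
qed

lemma real_on_left_line: "Im \<tau> > 0 \<Longrightarrow> Re \<tau> = - 1 / 2 \<Longrightarrow> h \<tau> \<in> \<real>"
proof -
  assume *: "Im \<tau> > 0" "Re \<tau> = - 1 / 2"
  hence "- cnj \<tau> = \<tau> + 1" by (simp add: complex_eq_iff)
  thus ?thesis using reflect[OF *(1)] periodic[OF *(1)] by (simp add: Reals_cnj_iff)
qed

text \<open>On this circle \<open>- 1 / (p \<tau>) = - cnj \<tau>\<close>, so the Fricke involution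
  coincides with the reflection and \<open>cnj (h \<tau>) = p \<tau>^2 h \<tau>\<close>.\<close>

lemma real_on_circle1:
  assumes "Im \<tau> > 0" "\<tau> \<notin> N" "sqdist 0 \<tau> = P"
  shows "\<tau> * h \<tau> \<in> \<real>"
proof -
  have p0: "p > 0" using p by auto
  have \<tau>0: "\<tau> \<noteq> 0" using assms by auto
  have "\<tau> * cnj \<tau> = of_real (sqdist 0 \<tau>)" by (simp add: complex_mult_cnj sqdist_def)
  hence tc: "of_nat p * (\<tau> * cnj \<tau>) = 1" using p0 by (simp add: assms(3) P_def)
  hence "inverse (of_nat p * \<tau>) = cnj \<tau>" by (intro inverse_unique) (simp only: mult.assoc)
  hence "- 1 / (of_nat p * \<tau>) = - cnj \<tau>" by (simp only: divide_inverse mult_minus1)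
  hence "cnj (h \<tau>) = of_nat p * \<tau> ^ 2 * h \<tau>"
    using fricke[OF assms(1,2)] reflect[OF assms(1)] by simp
  hence "cnj (\<tau> * h \<tau>) = cnj \<tau> * (of_nat p * \<tau> ^ 2 * h \<tau>)" by (simp only: complex_cnj_mult)
  also have "\<dots> = (of_nat p * (\<tau> * cnj \<tau>)) * (\<tau> * h \<tau>)" by (simp add: power2_eq_square)
  finally show ?thesis by (simp only: tc Reals_cnj_iff mult_1)
qed

text \<open>On this circle the involution coincides with \<open>- cnj (\<tau> + 1)\<close>, the
  reflection in the left side.\<close>

lemma real_on_circle2:
  assumes "Im \<tau> > 0" "\<tau> \<notin> N" "sqdist (- 1 / 2) \<tau> = P / 4" "p \<in> {5, 7}"
  shows "(\<tau> + 1 / 2) * h \<tau> \<in> \<real>"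
proof -
  define \<sigma> where "\<sigma> = \<tau> + 1 / 2"
  have p0: "p > 0" using p by auto
  have \<sigma>0: "\<sigma> \<noteq> 0" using assms by (auto simp: \<sigma>_def complex_eq_iff)
  have "\<sigma> = \<tau> - of_real (- 1 / 2)" by (simp add: \<sigma>_def)
  hence "\<sigma> * cnj \<sigma> = of_real (sqdist (- 1 / 2) \<tau>)"
    using complex_norm_square[of \<sigma>] by (simp only: sqdist_altdef of_real_power)
  hence tc: "4 * of_nat p * (\<sigma> * cnj \<sigma>) = 1" using p0 by (simp only: assms(3)) (simp add: P_def)
  hence "inverse (4 * of_nat p * \<sigma>) = cnj \<sigma>" by (intro inverse_unique) (simp only: mult.assoc)
  hence "1 / (4 * of_nat p * \<sigma>) = cnj \<sigma>" by (simp only: divide_inverse mult_1)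
  hence "- 1 / 2 - 1 / (4 * of_nat p * \<sigma>) = - cnj (\<tau> + 1)" by (simp add: \<sigma>_def)
  hence "h (- cnj (\<tau> + 1)) = 4 * of_nat p * \<sigma> ^ 2 * h \<tau>"
    using involution[OF assms(1,2,4)] by (simp add: \<sigma>_def)
  moreover have "h (- cnj (\<tau> + 1)) = cnj (h (\<tau> + 1))" using assms(1) by (intro reflect) simp
  ultimately have "cnj (h \<tau>) = 4 * of_nat p * \<sigma> ^ 2 * h \<tau>"
    using periodic[OF assms(1)] by simp
  hence "cnj (\<sigma> * h \<tau>) = cnj \<sigma> * (4 * of_nat p * \<sigma> ^ 2 * h \<tau>)" by (simp only: complex_cnj_mult)
  also have "\<dots> = (4 * of_nat p * (\<sigma> * cnj \<sigma>)) * (\<sigma> * h \<tau>)" by (simp add: power2_eq_square)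
  finally show ?thesis by (simp only: tc Reals_cnj_iff mult_1 flip: \<sigma>_def)
qed

text \<open>The local estimate with \<open>Q = X / (\<tau> - c)\<close>, so that
  \<open>Q * (\<tau> - c) * h\<close> is \<open>X * h\<close>.\<close>

lemma circle_boundary:
  fixes X :: "complex \<Rightarrow> complex"
  assumes \<tau>0: "Im \<tau>0 > 0"
    and real: "\<And>\<tau>. Im \<tau> > 0 \<Longrightarrow> \<tau> \<notin> N \<Longrightarrow> sqdist c \<tau> = sqdist c \<tau>0 \<Longrightarrow> (\<tau> - of_real c) * h \<tau> \<in> \<real>"
    and X: "open A" "\<tau>0 \<in> A" "X holomorphic_on A"
    and X_real: "\<And>\<tau>. Im \<tau> > 0 \<Longrightarrow> \<tau> \<in> A \<Longrightarrow> sqdist c \<tau> = sqdist c \<tau>0 \<Longrightarrow> X \<tau> / (\<tau> - of_real c) \<in> \<real>"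
    and X_pos: "Re (X \<tau>0 / (\<tau>0 - of_real c)) \<ge> 0"
    and "\<epsilon> > 0"
  shows "\<exists>d>0. \<forall>\<tau>. dist \<tau> \<tau>0 < d \<and> sqdist c \<tau> > sqdist c \<tau>0 \<longrightarrow> Im (X \<tau> * h \<tau>) < \<epsilon>"
proof -
  obtain m e b where b: "0 \<le> m" "0 < e" "b holomorphic_on ball \<tau>0 e"
    "\<And>\<tau>. \<tau> \<in> ball \<tau>0 e \<Longrightarrow> Im \<tau> > 0"
    "\<And>\<tau>. \<tau> \<in> ball \<tau>0 e \<Longrightarrow> \<tau> \<noteq> \<tau>0 \<Longrightarrow> \<tau> \<notin> N"
    "\<And>\<tau>. \<tau> \<in> ball \<tau>0 e \<Longrightarrow> \<tau> \<noteq> \<tau>0 \<Longrightarrow> h \<tau> = of_real m / (2 * of_real pi * \<i> * (\<tau> - \<tau>0)) + b \<tau>"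
    using local_form[OF \<tau>0] by metis
  obtain e2 where e2: "e2 > 0" "ball \<tau>0 e2 \<subseteq> A" using X by (auto simp: open_contains_ball)
  define e' where "e' = min e e2"
  have e': "e' > 0" "ball \<tau>0 e' \<subseteq> ball \<tau>0 e" "ball \<tau>0 e' \<subseteq> A"
    using b e2 by (auto simp: e'_def)
  have ne: "\<tau> \<noteq> of_real c" if "\<tau> \<in> ball \<tau>0 e'" for \<tau>
  proof -
    have "Im \<tau> > 0" using b(4) that e'(2) by blast
    thus ?thesis by auto
  qed
  have "\<exists>d>0. \<forall>\<tau>. dist \<tau> \<tau>0 < d \<and> norm (\<tau> - of_real c) > norm (\<tau>0 - of_real c) \<longrightarrow>
          - Im (X \<tau> / (\<tau> - of_real c) * (\<tau> - of_real c) * h \<tau>) > - \<epsilon>"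
  proof (rule circle_boundary_behaviour[of m e' \<tau>0 "of_real c" b h "\<lambda>\<tau>. X \<tau> / (\<tau> - of_real c)" \<epsilon>])
    show "\<tau>0 \<noteq> of_real c" using \<tau>0 by auto
    show "b holomorphic_on ball \<tau>0 e'" using b(3) e'(2) by (rule holomorphic_on_subset)
    show "(\<lambda>\<tau>. X \<tau> / (\<tau> - of_real c)) holomorphic_on ball \<tau>0 e'"
      using ne by (intro holomorphic_intros holomorphic_on_subset[OF X(3) e'(3)]) auto
  next
    fix \<tau> assume *: "\<tau> \<in> ball \<tau>0 e'" "\<tau> \<noteq> \<tau>0"
    show "h \<tau> = of_real m / (2 * of_real pi * \<i> * (\<tau> - \<tau>0)) + b \<tau>" by (rule b(6)) (use * e'(2) in blast)+
    show "(\<tau> - of_real c) * h \<tau> \<in> \<real>" if "norm (\<tau> - of_real c) = norm (\<tau>0 - of_real c)"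
    proof (rule real)
      show "Im \<tau> > 0" "\<tau> \<notin> N" using b(4,5)[of \<tau>] * e'(2) by blast+
      show "sqdist c \<tau> = sqdist c \<tau>0" unfolding sqdist_eq_iff by (rule that)
    qed
  next
    fix \<tau> assume *: "\<tau> \<in> ball \<tau>0 e'" "norm (\<tau> - of_real c) = norm (\<tau>0 - of_real c)"
    show "X \<tau> / (\<tau> - of_real c) \<in> \<real>"
      using X_real[of \<tau>] b(4)[of \<tau>] * e'(2,3) unfolding sqdist_eq_iff by blast
  qed fact+
  then obtain d where d: "d > 0" "\<And>\<tau>. dist \<tau> \<tau>0 < d \<Longrightarrow> norm (\<tau> - of_real c) > norm (\<tau>0 - of_real c) \<Longrightarrow>
          - Im (X \<tau> / (\<tau> - of_real c) * (\<tau> - of_real c) * h \<tau>) > - \<epsilon>" by auto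
  show ?thesis
  proof (intro exI[of _ "min d e'"] conjI allI impI)
    fix \<tau> assume *: "dist \<tau> \<tau>0 < min d e' \<and> sqdist c \<tau>0 < sqdist c \<tau>"
    hence "\<tau> \<noteq> of_real c" by (intro ne) (simp add: dist_commute)
    hence "X \<tau> / (\<tau> - of_real c) * (\<tau> - of_real c) * h \<tau> = X \<tau> * h \<tau>" by simp
    moreover have "- Im (X \<tau> / (\<tau> - of_real c) * (\<tau> - of_real c) * h \<tau>) > - \<epsilon>"
      using * by (intro d(2)) (simp_all only: sqdist_less_iff min_less_iff_conj)
    ultimately show "Im (X \<tau> * h \<tau>) < \<epsilon>" by (simp only: neg_less_iff_less)
  qed (use d e' in auto)
qed

end

section \<open>The sign on the vertical sides\<close>

lemma sqdist_near:
  assumes "sqdist c z < t"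
  shows "\<exists>d>0. \<forall>w. dist w z < d \<longrightarrow> sqdist c w < t"
proof -
  have "open {w. sqdist c w < t}" by (intro open_Collect_less continuous_intros)
  thus ?thesis using assms unfolding open_dist by simp
qed

lemma exp_decay:
  fixes K \<epsilon> :: real
  assumes "\<epsilon> > 0"
  shows "\<exists>Y\<ge>2. \<forall>y\<ge>Y. K * (y ^ k * exp (- 2 * pi * y)) < \<epsilon>"
proof -
  have "((\<lambda>y::real. \<bar>K\<bar> * (y ^ k / exp y)) \<longlongrightarrow> \<bar>K\<bar> * 0) at_top"
    by (intro tendsto_intros tendsto_power_div_exp_0)
  hence "eventually (\<lambda>y. \<bar>K\<bar> * (y ^ k / exp y) < \<epsilon>) at_top"
    by (rule order_tendstoD) (use assms in simp)
  then obtain Y where Y: "\<And>y. y \<ge> Y \<Longrightarrow> \<bar>K\<bar> * (y ^ k / exp y) < \<epsilon>"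
    by (auto simp: eventually_at_top_linorder)
  show ?thesis
  proof (intro exI[of _ "max Y 2"] conjI allI impI)
    fix y assume y: "y \<ge> max Y 2"
    have "exp (- 2 * pi * y) \<le> exp (- y)"
      using y pi_gt3 mult_right_mono[of 1 "2 * pi" y] by simp
    hence "y ^ k * exp (- 2 * pi * y) \<le> y ^ k * exp (- y)"
      using y by (intro mult_left_mono) auto
    also have "\<dots> = y ^ k / exp y" by (simp add: exp_minus divide_inverse)
    finally have "\<bar>K\<bar> * (y ^ k * exp (- 2 * pi * y)) \<le> \<bar>K\<bar> * (y ^ k / exp y)"
      by (intro mult_left_mono) auto
    moreover have "K * (y ^ k * exp (- 2 * pi * y)) \<le> \<bar>K\<bar> * (y ^ k * exp (- 2 * pi * y))"
      using y by (intro mult_right_mono) auto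
    ultimately show "K * (y ^ k * exp (- 2 * pi * y)) < \<epsilon>" using Y[of y] y by linarith
  qed auto
qed

context fricke_form
begin

text \<open>The corner has real part \<open>- (1/4 + 3/4 P)\<close>, at distance
  \<open>1/4 - 3/4 P\<close> from the left side. The inequalities say that its height is positive,
  with slack \<open>1/100\<close>; therefore circles with squared radii enlarged by at most
  \<open>1/100\<close> still meet in the upper half-plane.\<close>

lemma P57_ineqs:
  assumes "p \<in> {5, 7}"
  shows "(26 / 100 + 3 / 4 * P) ^ 2 < P" "(26 / 100 - 3 / 4 * P) ^ 2 < P / 4"
proof -
  have "(26 / 100 + 3 / 4 * P) ^ 2 < P \<and> (26 / 100 - 3 / 4 * P) ^ 2 < P / 4"
    using P57[OF assms]
  proof
    assume *: "P = 1 / 5"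
    show ?thesis unfolding * by (simp add: power2_eq_square)
  next
    assume *: "P = 1 / 7"
    show ?thesis unfolding * by (simp add: power2_eq_square)
  qed
  thus "(26 / 100 + 3 / 4 * P) ^ 2 < P" "(26 / 100 - 3 / 4 * P) ^ 2 < P / 4" by auto
qed

text \<open>Points of the region with \<open>sqdist 0 \<tau> < P + 1\<close> have height between
  \<open>1/10\<close> and \<open>2\<close>, so the estimate at single points of the arc becomes
  uniform on a compact rectangle.\<close>

lemma Im_h_near_circle1:
  assumes "\<epsilon> > 0"
  shows "\<exists>\<delta>>0. \<forall>\<tau>\<in>region. sqdist 0 \<tau> < P + \<delta> \<longrightarrow> Im (\<tau> * h \<tau>) < \<epsilon>"
proof -
  define C where "C = cbox (Complex (- 1 / 2) (1 / 10)) (Complex 0 2)"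
  have C: "\<tau> \<in> C \<longleftrightarrow> - 1 / 2 \<le> Re \<tau> \<and> Re \<tau> \<le> 0 \<and> 1 / 10 \<le> Im \<tau> \<and> Im \<tau> \<le> 2" for \<tau>
    unfolding C_def in_cbox_complex_iff by auto
  have "\<exists>\<delta>>0. \<forall>w\<in>C. P < sqdist 0 w \<and> sqdist 0 w < P + \<delta> \<longrightarrow> Im (w * h w) < \<epsilon>"
  proof (rule compact_uniform_near)
    show "compact C" by (simp add: C_def)
    show "continuous_on C (sqdist 0)" by (intro continuous_intros)
    fix z assume z: "z \<in> C" "sqdist 0 z = P"
    have "Im z > 0" using z C by auto
    have "\<exists>d>0. \<forall>\<tau>. dist \<tau> z < d \<and> sqdist 0 \<tau> > sqdist 0 z \<longrightarrow> Im (\<tau> * h \<tau>) < \<epsilon>"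
    proof (rule circle_boundary[OF \<open>Im z > 0\<close>, where A = UNIV])
      show "(\<tau> - of_real 0) * h \<tau> \<in> \<real>" if "Im \<tau> > 0" "\<tau> \<notin> N" "sqdist 0 \<tau> = sqdist 0 z" for \<tau>
        using real_on_circle1[OF that(1,2)] that(3) z by simp
      show "(\<lambda>\<tau>. \<tau>) holomorphic_on UNIV" by simp
    qed (use assms in auto)
    thus "\<exists>d>0. \<forall>w. dist w z < d \<and> P < sqdist 0 w \<longrightarrow> Im (w * h w) < \<epsilon>" using z by simp
  qed
  then obtain \<delta> where \<delta>: "\<delta> > 0" "\<And>w. w \<in> C \<Longrightarrow> P < sqdist 0 w \<Longrightarrow> sqdist 0 w < P + \<delta> \<Longrightarrow> Im (w * h w) < \<epsilon>"
    by blast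
  show ?thesis
  proof (intro exI[of _ "min \<delta> 1"] conjI ballI impI)
    fix \<tau> assume \<tau>: "\<tau> \<in> region" "sqdist 0 \<tau> < P + min \<delta> 1"
    have "(Im \<tau>) ^ 2 \<le> sqdist 0 \<tau>" by (simp add: sqdist_def)
    hence "(Im \<tau>) ^ 2 \<le> 2 ^ 2" using \<tau> P_bounds by simp
    hence "Im \<tau> \<le> 2" by (rule power2_le_imp_le) simp
    moreover note region_Im[OF \<tau>(1)]
    ultimately have "\<tau> \<in> C" using \<tau>(1) by (simp add: C region_def)
    thus "Im (\<tau> * h \<tau>) < \<epsilon>"
      by (rule \<delta>(2)) (use \<tau> in \<open>auto simp: region_def\<close>)
  qed (use \<delta> in auto)
qed

lemma Im_h_near_circle2:
  assumes "\<epsilon> > 0" "p \<in> {5, 7}"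
  shows "\<exists>\<delta>>0. \<forall>\<tau>\<in>region. sqdist (- 1 / 2) \<tau> < P / 4 + \<delta> \<longrightarrow> Im ((\<tau> + 1 / 2) * h \<tau>) < \<epsilon>"
proof -
  define C where "C = cbox (Complex (- 1 / 2) (1 / 10)) (Complex 0 2)"
  have C: "\<tau> \<in> C \<longleftrightarrow> - 1 / 2 \<le> Re \<tau> \<and> Re \<tau> \<le> 0 \<and> 1 / 10 \<le> Im \<tau> \<and> Im \<tau> \<le> 2" for \<tau>
    unfolding C_def in_cbox_complex_iff by auto
  have "\<exists>\<delta>>0. \<forall>w\<in>C. P / 4 < sqdist (- 1 / 2) w \<and> sqdist (- 1 / 2) w < P / 4 + \<delta> \<longrightarrow> Im ((w + 1 / 2) * h w) < \<epsilon>"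
  proof (rule compact_uniform_near)
    show "compact C" by (simp add: C_def)
    show "continuous_on C (sqdist (- 1 / 2))" by (intro continuous_intros)
    fix z assume z: "z \<in> C" "sqdist (- 1 / 2) z = P / 4"
    have "Im z > 0" using z C by auto
    have "\<exists>d>0. \<forall>\<tau>. dist \<tau> z < d \<and> sqdist (- 1 / 2) \<tau> > sqdist (- 1 / 2) z \<longrightarrow> Im ((\<tau> + 1 / 2) * h \<tau>) < \<epsilon>"
    proof (rule circle_boundary[OF \<open>Im z > 0\<close>, where A = UNIV and X = "\<lambda>\<tau>. \<tau> + 1 / 2"])
      show "(\<tau> - of_real (- 1 / 2)) * h \<tau> \<in> \<real>" if "Im \<tau> > 0" "\<tau> \<notin> N" "sqdist (- 1 / 2) \<tau> = sqdist (- 1 / 2) z" for \<tau>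
        using real_on_circle2[OF that(1,2) _ assms(2)] that(3) z by simp
      show "(\<lambda>\<tau>. \<tau> + 1 / 2) holomorphic_on UNIV" by (intro holomorphic_intros)
      show "(\<tau> + 1 / 2) / (\<tau> - of_real (- 1 / 2)) \<in> \<real>" for \<tau> :: complex by simp
      show "0 \<le> Re ((z + 1 / 2) / (z - of_real (- 1 / 2)))" by simp
    qed (use assms in auto)
    thus "\<exists>d>0. \<forall>w. dist w z < d \<and> P / 4 < sqdist (- 1 / 2) w \<longrightarrow> Im ((w + 1 / 2) * h w) < \<epsilon>" by (simp only: z(2))
  qed
  then obtain \<delta> where \<delta>: "\<delta> > 0" "\<And>w. w \<in> C \<Longrightarrow> P / 4 < sqdist (- 1 / 2) w \<Longrightarrow> sqdist (- 1 / 2) w < P / 4 + \<delta> \<Longrightarrow> Im ((w + 1 / 2) * h w) < \<epsilon>"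
    by blast
  show ?thesis
  proof (intro exI[of _ "min \<delta> 1"] conjI ballI impI)
    fix \<tau> assume \<tau>: "\<tau> \<in> region" "sqdist (- 1 / 2) \<tau> < P / 4 + min \<delta> 1"
    have "(Im \<tau>) ^ 2 \<le> sqdist (- 1 / 2) \<tau>" by (simp add: sqdist_def)
    hence "(Im \<tau>) ^ 2 \<le> 2 ^ 2" using \<tau> P_bounds by simp
    hence "Im \<tau> \<le> 2" by (rule power2_le_imp_le) simp
    moreover note region_Im[OF \<tau>(1)]
    ultimately have "\<tau> \<in> C" using \<tau>(1) by (simp add: C region_def)
    thus "Im ((\<tau> + 1 / 2) * h \<tau>) < \<epsilon>"
      by (rule \<delta>(2)) (use \<tau> in \<open>auto simp: region_def\<close>)
  qed (use \<delta> in auto)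
qed

text \<open>The arc around \<open>-1/2\<close> occurs at levels 5 and 7 only: otherwise
  \<open>P >= 1/3\<close>, and off the arc around \<open>0\<close> one has
  \<open>sqdist (- 1 / 2) z > P - 1/4 >= P / 4\<close>.\<close>

lemma frontier_\<Omega>:
  assumes "z \<in> frontier \<Omega>"
  shows "Im z \<ge> 1 / 10" "- 1 / 2 \<le> Re z" "Re z \<le> 0" "P \<le> sqdist 0 z" "P / 4 \<le> sqdist (- 1 / 2) z"
    and "sqdist 0 z = P \<or> (p \<in> {5, 7} \<and> sqdist (- 1 / 2) z = P / 4) \<or> (z \<in> region \<and> (Re z = - 1 / 2 \<or> Re z = 0))"
proof -
  define K where "K = {z. 1 / 10 \<le> Im z \<and> - 1 / 2 \<le> Re z \<and> Re z \<le> 0 \<and> P \<le> sqdist 0 z \<and> P / 4 \<le> sqdist (- 1 / 2) z}"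
  have "closed K" unfolding K_def by (intro closed_Collect_conj closed_Collect_le continuous_intros)
  moreover have "\<Omega> \<subseteq> K"
    using \<Omega>_subset_region region_Im by (auto simp: K_def \<Omega>_def)
  ultimately have "closure \<Omega> \<subseteq> K" by (rule closure_minimal[rotated])
  hence "z \<in> K" using assms by (auto simp: frontier_def)
  thus *: "Im z \<ge> 1 / 10" "- 1 / 2 \<le> Re z" "Re z \<le> 0" "P \<le> sqdist 0 z" "P / 4 \<le> sqdist (- 1 / 2) z"
    by (auto simp: K_def)
  have "z \<notin> \<Omega>" using assms open_\<Omega> by (simp add: frontier_def interior_open)
  show "sqdist 0 z = P \<or> (p \<in> {5, 7} \<and> sqdist (- 1 / 2) z = P / 4) \<or> (z \<in> region \<and> (Re z = - 1 / 2 \<or> Re z = 0))"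
  proof (rule ccontr)
    assume c: "\<not> ?thesis"
    have 1: "P < sqdist 0 z" using c * by linarith
    have 2: "P / 4 < sqdist (- 1 / 2) z"
    proof (cases "p \<in> {5, 7}")
      case True
      thus ?thesis using c * by linarith
    next
      case False
      thus ?thesis using P123[OF False] 1 * sqdist_half[of z] by linarith
    qed
    hence "z \<in> region" using 1 * by (simp add: region_def)
    hence "Re z \<noteq> - 1 / 2" "Re z \<noteq> 0" using c by blast+
    hence "z \<in> \<Omega>" using 1 2 * by (simp add: \<Omega>_def)
    thus False using \<open>z \<notin> \<Omega>\<close> by blast
  qed
qed

lemma region_ball:
  assumes "z \<in> region"
  obtains d where "d > 0" "\<And>w. dist w z < d \<Longrightarrow> - 1 / 2 < Re w \<Longrightarrow> Re w < 0 \<Longrightarrow> w \<in> \<Omega>"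
    "\<And>w. dist w z < d \<Longrightarrow> - 1 / 2 \<le> Re w \<Longrightarrow> Re w \<le> 0 \<Longrightarrow> w \<in> region"
proof -
  define A where "A = {\<tau>. Im \<tau> > 0 \<and> P < sqdist 0 \<tau> \<and> P / 4 < sqdist (- 1 / 2) \<tau>}"
  have "open A" unfolding A_def by (intro open_Collect_conj open_Collect_less continuous_intros)
  moreover have "z \<in> A" using assms by (simp add: A_def region_def)
  ultimately obtain d where "d > 0" "\<And>w. dist w z < d \<Longrightarrow> w \<in> A" unfolding open_dist by blast
  thus ?thesis by (intro that[of d]) (auto simp: A_def \<Omega>_def region_def)
qed

end

section \<open>The real part of the primitive on sides and arcs\<close>

locale fricke_primitive = fricke_form +
  fixes H :: "complex \<Rightarrow> complex"
  assumes H: "\<And>\<tau>. \<tau> \<in> U \<Longrightarrow> (H has_field_derivative h \<tau>) (at \<tau>)"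
begin

lemma H_region: "\<tau> \<in> region \<Longrightarrow> (H has_field_derivative h \<tau>) (at \<tau>)"
  using H region_subset_U by blast

text \<open>From the right end \<open>A\<close> to the left end \<open>B\<close> the argument
  increases within \<open>(0, pi)\<close>, so the accumulated error is at most
  \<open>\<epsilon> * pi\<close>.\<close>

lemma arc_mono:
  assumes AB: "Im A > 0" "Im B > 0" "sqdist c A = s" "sqdist c B = s" "Re B \<le> Re A"
    and pts: "\<And>\<tau>. Im \<tau> > 0 \<Longrightarrow> sqdist c \<tau> = s \<Longrightarrow> Re B \<le> Re \<tau> \<Longrightarrow> Re \<tau> \<le> Re A \<Longrightarrow>
        \<tau> \<in> region \<and> Im ((\<tau> - of_real c) * h \<tau>) \<le> \<epsilon>"
    and "\<epsilon> \<ge> 0"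
  shows "Re (H A) \<le> Re (H B) + \<epsilon> * pi"
proof -
  define \<rho> where "\<rho> = sqrt s"
  have \<rho>: "norm (A - of_real c) = \<rho>" "norm (B - of_real c) = \<rho>"
    using AB by (auto simp: \<rho>_def sqdist_altdef)
  have "A \<noteq> of_real c" using AB by auto
  hence \<rho>0: "\<rho> > 0" using \<rho>(1) by (metis right_minus_eq zero_less_norm_iff)
  have s: "s = \<rho> ^ 2" using \<rho>(1) AB(3) by (simp add: sqdist_altdef)
  define \<theta>1 \<theta>2 where "\<theta>1 = Arg (A - of_real c)" and "\<theta>2 = Arg (B - of_real c)"
  have \<theta>: "0 < \<theta>1" "\<theta>1 < pi" "0 < \<theta>2" "\<theta>2 < pi"
    using AB Arg_lt_pi[of "A - of_real c"] Arg_lt_pi[of "B - of_real c"] by (auto simp: \<theta>1_def \<theta>2_def)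
  have A: "A = of_real c + of_real \<rho> * cis \<theta>1" and B: "B = of_real c + of_real \<rho> * cis \<theta>2"
    using rcis_cmod_Arg[of "A - of_real c"] rcis_cmod_Arg[of "B - of_real c"] \<rho>
    by (simp_all add: rcis_def \<theta>1_def \<theta>2_def algebra_simps)
  have "\<rho> * cos \<theta>2 \<le> \<rho> * cos \<theta>1" using AB(5) by (simp add: A B)
  hence "cos \<theta>2 \<le> cos \<theta>1" using \<rho>0 by simp
  hence le: "\<theta>1 \<le> \<theta>2" using \<theta> by (subst (asm) cos_mono_le_eq) auto
  have pt: "of_real c + of_real \<rho> * cis t \<in> region \<and> Im (of_real \<rho> * cis t * h (of_real c + of_real \<rho> * cis t)) \<le> \<epsilon>"
    if t: "\<theta>1 \<le> t" "t \<le> \<theta>2" for t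
  proof -
    define \<tau> where "\<tau> = of_real c + of_real \<rho> * cis t"
    have "sin t > 0" using t \<theta> by (intro sin_gt_zero) auto
    hence "Im \<tau> > 0" using \<rho>0 by (simp add: \<tau>_def)
    moreover have "sqdist c \<tau> = s" using \<rho>0 by (simp add: \<tau>_def sqdist_altdef s norm_mult)
    moreover have "cos \<theta>2 \<le> cos t" "cos t \<le> cos \<theta>1" using t \<theta> by (auto intro!: cos_monotone_0_pi_le)
    hence "Re B \<le> Re \<tau>" "Re \<tau> \<le> Re A" using \<rho>0 by (auto simp: A B \<tau>_def)
    ultimately have "\<tau> \<in> region \<and> Im ((\<tau> - of_real c) * h \<tau>) \<le> \<epsilon>" by (rule pts)
    moreover have "\<tau> - of_real c = of_real \<rho> * cis t" by (simp add: \<tau>_def)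
    ultimately show ?thesis by (simp only: \<tau>_def)
  qed
  have "Re (H (of_real c + of_real \<rho> * cis \<theta>1)) \<le> Re (H (of_real c + of_real \<rho> * cis \<theta>2)) + \<epsilon> * (\<theta>2 - \<theta>1)"
  proof (rule Re_primitive_mono_circle[OF le])
    fix t assume t: "\<theta>1 \<le> t" "t \<le> \<theta>2"
    show "(H has_field_derivative h (of_real c + of_real \<rho> * cis t)) (at (of_real c + of_real \<rho> * cis t))"
      using pt[OF t] H_region by blast
    show "- \<epsilon> \<le> - Im (of_real \<rho> * cis t * h (of_real c + of_real \<rho> * cis t))"
      using pt[OF t] by (simp only: neg_le_iff_le)
  qed
  also have "\<epsilon> * (\<theta>2 - \<theta>1) \<le> \<epsilon> * pi" using \<theta> assms(7) by (intro mult_left_mono) auto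
  finally show ?thesis by (simp add: A B)
qed

text \<open>The vertical derivative of \<open>Re H\<close> is \<open>Re (\<i> * h)\<close>, which is
  0 where \<open>h\<close> is real.\<close>

lemma vertical_const:
  assumes "\<tau> \<in> region" "\<tau>' \<in> region" "Re \<tau> = Re \<tau>'" "Re \<tau> = - 1 / 2 \<or> Re \<tau> = 0"
  shows "Re (H \<tau>) = Re (H \<tau>')"
  using assms
proof (induction "Im \<tau>" "Im \<tau>'" arbitrary: \<tau> \<tau>' rule: linorder_wlog)
  case (le \<tau> \<tau>')
  define x where "x = Re \<tau>"
  define f where "f = (\<lambda>y. Re (H (of_real x + \<i> * of_real y)))"
  have f: "(f has_real_derivative 0) (at y)" if y: "Im \<tau> \<le> y" for y
  proof -
    define z where "z = of_real x + \<i> * of_real y"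
    have Im: "Im \<tau> > 0" using le by (simp add: region_def)
    have "(Im \<tau>) ^ 2 \<le> (Im z) ^ 2" using y Im by (intro power_mono) (auto simp: z_def)
    hence "sqdist c \<tau> \<le> sqdist c z" for c by (simp add: sqdist_def z_def x_def)
    from this[of 0] this[of "- 1 / 2"] have "z \<in> region"
      using le y Im by (auto simp: region_def z_def x_def)
    hence D: "(H has_field_derivative h z) (at z)" by (rule H_region)
    have "((\<lambda>w. H (of_real x + \<i> * w)) has_field_derivative h z * \<i>) (at (of_real y))"
      using D unfolding z_def
      by (rule DERIV_chain2[where f = H and g = "\<lambda>w. of_real x + \<i> * w"])
         (auto intro!: derivative_eq_intros)
    hence "((\<lambda>y. H (of_real x + \<i> * of_real y)) has_vector_derivative h z * \<i>) (at y)"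
      by (rule has_vector_derivative_real_field)
    hence "(f has_vector_derivative Re (h z * \<i>)) (at y)"
      unfolding f_def by (rule bounded_linear.has_vector_derivative[OF bounded_linear_Re])
    moreover have "h z \<in> \<real>"
      using real_on_left_line[of z] real_on_imaginary_axis[of z] le(5) y Im by (auto simp: z_def x_def)
    hence "Re (h z * \<i>) = 0" by (simp add: complex_is_Real_iff)
    ultimately show ?thesis by (simp add: has_real_derivative_iff_has_vector_derivative)
  qed
  have "f (Im \<tau>) = f (Im \<tau>')"
  proof (rule antisym)
    show "f (Im \<tau>) \<le> f (Im \<tau>')"
      by (rule DERIV_nonneg_imp_nondecreasing) (use f le in auto)
    show "f (Im \<tau>') \<le> f (Im \<tau>)"
      by (rule DERIV_nonpos_imp_nonincreasing) (use f le in auto)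
  qed
  moreover have "\<tau> = of_real x + \<i> * of_real (Im \<tau>)" "\<tau>' = of_real x + \<i> * of_real (Im \<tau>')"
    using le by (simp_all add: x_def complex_eq_iff)
  ultimately show ?case by (simp add: f_def)
next
  case (sym \<tau> \<tau>')
  thus ?case by metis
qed

definition VL :: real where "VL = Re (H (Complex (- 1 / 2) 20))"
definition VR :: real where "VR = Re (H (Complex 0 20))"

lemma Re_H_left: "\<tau> \<in> region \<Longrightarrow> Re \<tau> = - 1 / 2 \<Longrightarrow> Re (H \<tau>) = VL"
  unfolding VL_def by (rule vertical_const) (auto intro!: region_upper)

lemma Re_H_right: "\<tau> \<in> region \<Longrightarrow> Re \<tau> = 0 \<Longrightarrow> Re (H \<tau>) = VR"
  unfolding VR_def by (rule vertical_const) (auto intro!: region_upper)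

text \<open>Follow the concentric arc leftwards to the line \<open>Re \<tau> = -1/2\<close>. On it
  \<open>sqdist 0 = s - Re - 1/4\<close> grows to the left, so the arc does not leave the
  region.\<close>

lemma Re_H_le_near_circle2:
  assumes "\<epsilon> > 0" "p \<in> {5, 7}"
  shows "\<exists>\<delta>>0. \<forall>\<tau>\<in>region. sqdist (- 1 / 2) \<tau> < P / 4 + \<delta> \<longrightarrow> Re (H \<tau>) \<le> VL + \<epsilon>"
proof -
  obtain \<delta> where \<delta>: "\<delta> > 0" "\<And>\<tau>. \<tau> \<in> region \<Longrightarrow> sqdist (- 1 / 2) \<tau> < P / 4 + \<delta> \<Longrightarrow> Im ((\<tau> + 1 / 2) * h \<tau>) < \<epsilon> / pi"
    using Im_h_near_circle2[of "\<epsilon> / pi"] assms by auto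
  show ?thesis
  proof (intro exI[of _ \<delta>] conjI ballI impI)
    fix \<tau> assume \<tau>: "\<tau> \<in> region" "sqdist (- 1 / 2) \<tau> < P / 4 + \<delta>"
    note \<tau>' = \<tau>(1)[unfolded region_def mem_Collect_eq]
    define s where "s = sqdist (- 1 / 2) \<tau>"
    have s: "s > 0" using \<tau>' P_bounds unfolding s_def by linarith
    define B where "B = Complex (- 1 / 2) (sqrt s)"
    have B: "Im B > 0" "Re B = - 1 / 2" "sqdist (- 1 / 2) B = s" using s by (auto simp: B_def sqdist_def)
    have reg: "\<sigma> \<in> region" if "Im \<sigma> > 0" "sqdist (- 1 / 2) \<sigma> = s" "- 1 / 2 \<le> Re \<sigma>" "Re \<sigma> \<le> Re \<tau>" for \<sigma>
      using that \<tau>' sqdist_half[of \<sigma>] sqdist_half[of \<tau>] unfolding region_def mem_Collect_eq s_def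
      by linarith
    have "Re (H \<tau>) \<le> Re (H B) + \<epsilon> / pi * pi"
    proof (rule arc_mono[where c = "- 1 / 2" and s = s])
      fix \<sigma> assume \<sigma>: "Im \<sigma> > 0" "sqdist (- 1 / 2) \<sigma> = s" "Re B \<le> Re \<sigma>" "Re \<sigma> \<le> Re \<tau>"
      have "\<sigma> \<in> region" by (rule reg) (use \<sigma> B in auto)
      moreover have "Im ((\<sigma> + 1 / 2) * h \<sigma>) < \<epsilon> / pi"
        by (rule \<delta>(2)[OF \<open>\<sigma> \<in> region\<close>]) (use \<tau> \<sigma> in \<open>simp only: s_def\<close>)
      ultimately show "\<sigma> \<in> region \<and> Im ((\<sigma> - of_real (- 1 / 2)) * h \<sigma>) \<le> \<epsilon> / pi" by simp
    qed (use \<tau>' B assms in \<open>auto simp: s_def\<close>)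
    also have "B \<in> region" by (rule reg) (use B \<tau>' in auto)
    hence "Re (H B) = VL" by (rule Re_H_left) (rule B(2))
    finally show "Re (H \<tau>) \<le> VL + \<epsilon>" by simp
  qed (rule \<delta>(1))
qed

text \<open>At levels 1, 2, 3 the concentric arc runs leftwards to the left side. At levels 5 and 7
  it would enter the disc around \<open>-1/2\<close>, so it is followed only until the estimate near
  that disc takes over; hence two halves of \<open>\<epsilon>\<close>.\<close>

lemma Re_H_le_near_circle1:
  assumes "\<epsilon> > 0"
  shows "\<exists>\<delta>>0. \<forall>\<tau>\<in>region. sqdist 0 \<tau> < P + \<delta> \<longrightarrow> Re (H \<tau>) \<le> VL + \<epsilon>"
proof (cases "p \<in> {5, 7}")
  case False
  obtain \<delta> where \<delta>: "\<delta> > 0" "\<And>\<tau>. \<tau> \<in> region \<Longrightarrow> sqdist 0 \<tau> < P + \<delta> \<Longrightarrow> Im (\<tau> * h \<tau>) < \<epsilon> / pi"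
    using Im_h_near_circle1[of "\<epsilon> / pi"] assms by auto
  show ?thesis
  proof (intro exI[of _ \<delta>] conjI ballI impI)
    fix \<tau> assume \<tau>: "\<tau> \<in> region" "sqdist 0 \<tau> < P + \<delta>"
    note \<tau>' = \<tau>(1)[unfolded region_def mem_Collect_eq]
    define s where "s = sqdist 0 \<tau>"
    have s: "s > 1 / 4" "s > P" using \<tau>' P123[OF False] unfolding s_def by linarith+
    define B where "B = Complex (- 1 / 2) (sqrt (s - 1 / 4))"
    have B: "Im B > 0" "Re B = - 1 / 2" "sqdist 0 B = s" using s by (auto simp: B_def sqdist_def power_divide)
    have reg: "\<sigma> \<in> region" if "Im \<sigma> > 0" "sqdist 0 \<sigma> = s" "- 1 / 2 \<le> Re \<sigma>" "Re \<sigma> \<le> Re \<tau>" for \<sigma>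
      using that \<tau>' sqdist_half[of \<sigma>] s P123[OF False] unfolding region_def mem_Collect_eq
      by linarith
    have "Re (H \<tau>) \<le> Re (H B) + \<epsilon> / pi * pi"
    proof (rule arc_mono[where c = 0 and s = s])
      fix \<sigma> assume \<sigma>: "Im \<sigma> > 0" "sqdist 0 \<sigma> = s" "Re B \<le> Re \<sigma>" "Re \<sigma> \<le> Re \<tau>"
      have "\<sigma> \<in> region" by (rule reg) (use \<sigma> B in auto)
      moreover have "Im (\<sigma> * h \<sigma>) < \<epsilon> / pi"
        by (rule \<delta>(2)[OF \<open>\<sigma> \<in> region\<close>]) (use \<tau> \<sigma> in \<open>simp only: s_def\<close>)
      ultimately show "\<sigma> \<in> region \<and> Im ((\<sigma> - of_real 0) * h \<sigma>) \<le> \<epsilon> / pi" by simp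
    qed (use \<tau>' B assms in \<open>auto simp: s_def\<close>)
    also have "B \<in> region" by (rule reg) (use B \<tau>' in auto)
    hence "Re (H B) = VL" by (rule Re_H_left) (rule B(2))
    finally show "Re (H \<tau>) \<le> VL + \<epsilon>" by simp
  qed (rule \<delta>(1))
next
  case True
  obtain \<delta>1 where \<delta>1: "\<delta>1 > 0" "\<And>\<tau>. \<tau> \<in> region \<Longrightarrow> sqdist 0 \<tau> < P + \<delta>1 \<Longrightarrow> Im (\<tau> * h \<tau>) < \<epsilon> / 2 / pi"
    using Im_h_near_circle1[of "\<epsilon> / 2 / pi"] assms by auto
  obtain \<delta>2 where \<delta>2: "\<delta>2 > 0" "\<And>\<tau>. \<tau> \<in> region \<Longrightarrow> sqdist (- 1 / 2) \<tau> < P / 4 + \<delta>2 \<Longrightarrow> Re (H \<tau>) \<le> VL + \<epsilon> / 2"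
    using Re_H_le_near_circle2[of "\<epsilon> / 2"] assms True by auto
  show ?thesis
  proof (intro exI[of _ "min \<delta>1 (1 / 100)"] conjI ballI impI)
    fix \<tau> assume \<tau>: "\<tau> \<in> region" "sqdist 0 \<tau> < P + min \<delta>1 (1 / 100)"
    note \<tau>' = \<tau>(1)[unfolded region_def mem_Collect_eq]
    show "Re (H \<tau>) \<le> VL + \<epsilon>"
    proof (cases "sqdist (- 1 / 2) \<tau> < P / 4 + \<delta>2")
      case True
      thus ?thesis using \<delta>2(2)[OF \<tau>(1)] assms by simp
    next
      case far: False
      define s where "s = sqdist 0 \<tau>"
      have s: "s > P" "s < P + \<delta>1" "s < P + 1 / 100" using \<tau> \<tau>' unfolding s_def by linarith+
      define \<eta> where "\<eta> = min (\<delta>2 / 2) (1 / 100)"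
      have \<eta>: "\<eta> > 0" "\<eta> < \<delta>2" "\<eta> \<le> 1 / 100" using \<delta>2(1) by (auto simp: \<eta>_def)
      \<comment> \<open>The abscissa on the circle \<open>sqdist 0 = s\<close> at which
        \<open>sqdist (- 1 / 2)\<close> equals \<open>P / 4 + \<eta>\<close>.\<close>
      define x where "x = P / 4 + \<eta> - s - 1 / 4"
      have x: "x < Re \<tau>" "- 1 / 2 \<le> x"
        using far sqdist_half[of \<tau>] \<eta> s P57[OF True] by (auto simp: x_def s_def)
      have "x ^ 2 < s"
      proof -
        have "\<bar>x\<bar> \<le> 26 / 100 + 3 / 4 * P" using s \<eta> P_bounds unfolding x_def by linarith
        hence "\<bar>x\<bar> ^ 2 \<le> (26 / 100 + 3 / 4 * P) ^ 2" by (rule power_mono) simp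
        also have "\<dots> < P" by (rule P57_ineqs(1)[OF True])
        finally show ?thesis using s by simp
      qed
      define B where "B = Complex x (sqrt (s - x ^ 2))"
      have B: "Im B > 0" "Re B = x" "sqdist 0 B = s" using \<open>x ^ 2 < s\<close> by (auto simp: B_def sqdist_def)
      have reg: "\<sigma> \<in> region" if "Im \<sigma> > 0" "sqdist 0 \<sigma> = s" "x \<le> Re \<sigma>" "Re \<sigma> \<le> Re \<tau>" for \<sigma>
        using that \<tau>' sqdist_half[of \<sigma>] s x \<eta> unfolding region_def mem_Collect_eq x_def by linarith
      have "Re (H \<tau>) \<le> Re (H B) + \<epsilon> / 2 / pi * pi"
      proof (rule arc_mono[where c = 0 and s = s])
        fix \<sigma> assume \<sigma>: "Im \<sigma> > 0" "sqdist 0 \<sigma> = s" "Re B \<le> Re \<sigma>" "Re \<sigma> \<le> Re \<tau>"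
        have "\<sigma> \<in> region" by (rule reg) (use \<sigma> B in auto)
        moreover have "Im (\<sigma> * h \<sigma>) < \<epsilon> / 2 / pi"
          by (rule \<delta>1(2)[OF \<open>\<sigma> \<in> region\<close>]) (use s \<sigma> in linarith)
        ultimately show "\<sigma> \<in> region \<and> Im ((\<sigma> - of_real 0) * h \<sigma>) \<le> \<epsilon> / 2 / pi" by simp
      qed (use \<tau>' B assms x in \<open>auto simp: s_def\<close>)
      also have "B \<in> region" by (rule reg) (use B x in auto)
      hence "Re (H B) \<le> VL + \<epsilon> / 2"
        by (rule \<delta>2(2)) (use sqdist_half[of B] B \<eta> in \<open>simp add: x_def\<close>)
      finally show "Re (H \<tau>) \<le> VL + \<epsilon>" by simp
    qed
  qed (use \<delta>1(1) in simp)
qed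

text \<open>Follow the concentric arc rightwards to the imaginary axis; there
  \<open>sqdist (- 1 / 2) = s + Re + 1/4\<close> grows, so the arc stays in the region.\<close>

lemma Re_H_ge_near_circle1:
  assumes "\<epsilon> > 0"
  shows "\<exists>\<delta>>0. \<forall>\<tau>\<in>region. sqdist 0 \<tau> < P + \<delta> \<longrightarrow> VR \<le> Re (H \<tau>) + \<epsilon>"
proof -
  obtain \<delta> where \<delta>: "\<delta> > 0" "\<And>\<tau>. \<tau> \<in> region \<Longrightarrow> sqdist 0 \<tau> < P + \<delta> \<Longrightarrow> Im (\<tau> * h \<tau>) < \<epsilon> / pi"
    using Im_h_near_circle1[of "\<epsilon> / pi"] assms by auto
  show ?thesis
  proof (intro exI[of _ \<delta>] conjI ballI impI)
    fix \<tau> assume \<tau>: "\<tau> \<in> region" "sqdist 0 \<tau> < P + \<delta>"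
    note \<tau>' = \<tau>(1)[unfolded region_def mem_Collect_eq]
    define s where "s = sqdist 0 \<tau>"
    have s: "s > 0" "s > P" using \<tau>' P_bounds unfolding s_def by linarith+
    define A where "A = Complex 0 (sqrt s)"
    have A: "Im A > 0" "Re A = 0" "sqdist 0 A = s" using s by (auto simp: A_def sqdist_def)
    have reg: "\<sigma> \<in> region" if "Im \<sigma> > 0" "sqdist 0 \<sigma> = s" "Re \<tau> \<le> Re \<sigma>" "Re \<sigma> \<le> 0" for \<sigma>
      using that \<tau>' sqdist_half[of \<sigma>] sqdist_half[of \<tau>] s unfolding region_def mem_Collect_eq s_def
      by linarith
    have "Re (H A) \<le> Re (H \<tau>) + \<epsilon> / pi * pi"
    proof (rule arc_mono[where c = 0 and s = s])
      fix \<sigma> assume \<sigma>: "Im \<sigma> > 0" "sqdist 0 \<sigma> = s" "Re \<tau> \<le> Re \<sigma>" "Re \<sigma> \<le> Re A"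
      have "\<sigma> \<in> region" by (rule reg) (use \<sigma> A in auto)
      moreover have "Im (\<sigma> * h \<sigma>) < \<epsilon> / pi"
        by (rule \<delta>(2)[OF \<open>\<sigma> \<in> region\<close>]) (use \<tau> \<sigma> in \<open>simp only: s_def\<close>)
      ultimately show "\<sigma> \<in> region \<and> Im ((\<sigma> - of_real 0) * h \<sigma>) \<le> \<epsilon> / pi" by simp
    qed (use \<tau>' A assms in \<open>auto simp: s_def\<close>)
    moreover have "A \<in> region" by (rule reg) (use A \<tau>' in auto)
    hence "Re (H A) = VR" by (rule Re_H_right) (rule A(2))
    ultimately show "VR \<le> Re (H \<tau>) + \<epsilon>" by simp
  qed (rule \<delta>(1))
qed

text \<open>Going right, the arc around \<open>-1/2\<close> is left just before it meets the disc
  around \<open>0\<close>, where the preceding estimate applies.\<close>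

lemma Re_H_ge_near_circle2:
  assumes "\<epsilon> > 0" "p \<in> {5, 7}"
  shows "\<exists>\<delta>>0. \<forall>\<tau>\<in>region. sqdist (- 1 / 2) \<tau> < P / 4 + \<delta> \<longrightarrow> VR \<le> Re (H \<tau>) + \<epsilon>"
proof -
  obtain \<delta>2 where \<delta>2: "\<delta>2 > 0" "\<And>\<tau>. \<tau> \<in> region \<Longrightarrow> sqdist (- 1 / 2) \<tau> < P / 4 + \<delta>2 \<Longrightarrow> Im ((\<tau> + 1 / 2) * h \<tau>) < \<epsilon> / 2 / pi"
    using Im_h_near_circle2[of "\<epsilon> / 2 / pi"] assms by auto
  obtain \<delta>1 where \<delta>1: "\<delta>1 > 0" "\<And>\<tau>. \<tau> \<in> region \<Longrightarrow> sqdist 0 \<tau> < P + \<delta>1 \<Longrightarrow> VR \<le> Re (H \<tau>) + \<epsilon> / 2"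
    using Re_H_ge_near_circle1[of "\<epsilon> / 2"] assms by auto
  show ?thesis
  proof (intro exI[of _ "min \<delta>2 (1 / 100)"] conjI ballI impI)
    fix \<tau> assume \<tau>: "\<tau> \<in> region" "sqdist (- 1 / 2) \<tau> < P / 4 + min \<delta>2 (1 / 100)"
    note \<tau>' = \<tau>(1)[unfolded region_def mem_Collect_eq]
    show "VR \<le> Re (H \<tau>) + \<epsilon>"
    proof (cases "sqdist 0 \<tau> < P + \<delta>1")
      case True
      thus ?thesis using \<delta>1(2)[OF \<tau>(1)] assms by simp
    next
      case far: False
      define s where "s = sqdist (- 1 / 2) \<tau>"
      have s: "s > P / 4" "s < P / 4 + \<delta>2" "s < P / 4 + 1 / 100" using \<tau> \<tau>' unfolding s_def by linarith+
      define \<eta> where "\<eta> = min (\<delta>1 / 2) (1 / 100)"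
      have \<eta>: "\<eta> > 0" "\<eta> < \<delta>1" "\<eta> \<le> 1 / 100" using \<delta>1(1) by (auto simp: \<eta>_def)
      \<comment> \<open>The abscissa on the circle \<open>sqdist (- 1 / 2) = s\<close> at which
        \<open>sqdist 0\<close> equals \<open>P + \<eta>\<close>.\<close>
      define x where "x = s - 1 / 4 - (P + \<eta>)"
      have x: "Re \<tau> < x" "x \<le> 0"
        using far sqdist_half[of \<tau>] \<eta> s P_bounds by (auto simp: x_def s_def)
      have "(x + 1 / 2) ^ 2 < s"
      proof -
        have "\<bar>x + 1 / 2\<bar> \<le> 26 / 100 - 3 / 4 * P" using s \<eta> P57[OF assms(2)] unfolding x_def by linarith
        hence "\<bar>x + 1 / 2\<bar> ^ 2 \<le> (26 / 100 - 3 / 4 * P) ^ 2" by (rule power_mono) simp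
        also have "\<dots> < P / 4" by (rule P57_ineqs(2)[OF assms(2)])
        finally show ?thesis using s by simp
      qed
      define A where "A = Complex x (sqrt (s - (x + 1 / 2) ^ 2))"
      have A: "Im A > 0" "Re A = x" "sqdist (- 1 / 2) A = s" using \<open>(x + 1 / 2) ^ 2 < s\<close> by (auto simp: A_def sqdist_def)
      have reg: "\<sigma> \<in> region" if "Im \<sigma> > 0" "sqdist (- 1 / 2) \<sigma> = s" "Re \<tau> \<le> Re \<sigma>" "Re \<sigma> \<le> x" for \<sigma>
        using that \<tau>' sqdist_half[of \<sigma>] s x \<eta> unfolding region_def mem_Collect_eq x_def by linarith
      have "Re (H A) \<le> Re (H \<tau>) + \<epsilon> / 2 / pi * pi"
      proof (rule arc_mono[where c = "- 1 / 2" and s = s])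
        fix \<sigma> assume \<sigma>: "Im \<sigma> > 0" "sqdist (- 1 / 2) \<sigma> = s" "Re \<tau> \<le> Re \<sigma>" "Re \<sigma> \<le> Re A"
        have "\<sigma> \<in> region" by (rule reg) (use \<sigma> A in auto)
        moreover have "Im ((\<sigma> + 1 / 2) * h \<sigma>) < \<epsilon> / 2 / pi"
          by (rule \<delta>2(2)[OF \<open>\<sigma> \<in> region\<close>]) (use s \<sigma> in linarith)
        ultimately show "\<sigma> \<in> region \<and> Im ((\<sigma> - of_real (- 1 / 2)) * h \<sigma>) \<le> \<epsilon> / 2 / pi" by simp
      qed (use \<tau>' A assms x in \<open>auto simp: s_def\<close>)
      moreover have "A \<in> region" by (rule reg) (use A x in auto)
      hence "VR \<le> Re (H A) + \<epsilon> / 2"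
        by (rule \<delta>1(2)) (use sqdist_half[of A] A \<eta> in \<open>simp add: x_def\<close>)
      ultimately show "VR \<le> Re (H \<tau>) + \<epsilon>" by simp
    qed
  qed (use \<delta>2(1) in simp)
qed

text \<open>The lower end of the right side comes arbitrarily close to the arc around
  \<open>0\<close>, where \<open>Re H\<close> is at most \<open>VL + \<epsilon>\<close>.\<close>

lemma VR_le_VL: "VR \<le> VL"
proof (rule field_le_epsilon)
  fix \<epsilon> :: real assume "\<epsilon> > 0"
  then obtain \<delta> where \<delta>: "\<delta> > 0" "\<And>\<tau>. \<tau> \<in> region \<Longrightarrow> sqdist 0 \<tau> < P + \<delta> \<Longrightarrow> Re (H \<tau>) \<le> VL + \<epsilon>"
    using Re_H_le_near_circle1 by blast
  define A where "A = Complex 0 (sqrt (P + \<delta> / 2))"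
  have "sqdist 0 A = P + \<delta> / 2" "Re A = 0" "Im A > 0" using \<delta> P_bounds by (auto simp: A_def sqdist_def)
  moreover from this have "A \<in> region" using \<delta> P_bounds sqdist_half[of A] by (auto simp: region_def)
  ultimately show "VR \<le> VL + \<epsilon>" using \<delta>(2)[of A] \<delta>(1) Re_H_right[of A] by simp
qed

text \<open>High up \<open>h\<close> is nearly the real constant \<open>M\<close>, so
  \<open>Re H\<close> is nearly affine with slope \<open>M\<close> across the strip of width
  \<open>1/2\<close>. Comparing the sides gives \<open>VR - VL = M / 2\<close>, and so
  \<open>M <= 0\<close>.\<close>

lemma H_at_infinity:
  obtains M C where "M \<le> 0" "C \<ge> 0" "VR = VL + M / 2"
    "\<And>\<tau>. Im \<tau> \<ge> 2 \<Longrightarrow> norm (h \<tau> - of_real M) \<le> C * exp (- 2 * pi * Im \<tau>)"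
    "\<And>\<tau>. Im \<tau> \<ge> 2 \<Longrightarrow> - 1 / 2 \<le> Re \<tau> \<Longrightarrow> Re \<tau> \<le> 0 \<Longrightarrow>
       \<bar>Re (H \<tau>) - VL - M * (Re \<tau> + 1 / 2)\<bar> \<le> C * exp (- 2 * pi * Im \<tau>)"
proof -
  obtain M C where MC: "\<And>\<tau>. Im \<tau> \<ge> 2 \<Longrightarrow> norm (h \<tau> - of_real M) \<le> C * exp (- 2 * pi * Im \<tau>)"
    using cusp by blast
  have "0 \<le> C * exp (- 2 * pi * Im (2 * \<i>))"
    by (rule order_trans[OF norm_ge_zero MC]) simp
  hence C: "C \<ge> 0" by (simp add: zero_le_mult_iff)
  have bound: "\<bar>Re (H \<tau>) - VL - M * (Re \<tau> + 1 / 2)\<bar> \<le> C * exp (- 2 * pi * Im \<tau>)"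
    if \<tau>: "Im \<tau> \<ge> 2" "- 1 / 2 \<le> Re \<tau>" "Re \<tau> \<le> 0" for \<tau>
  proof -
    define S where "S = cbox (Complex (- 1 / 2) (Im \<tau>)) (Complex 0 (Im \<tau>))"
    have S: "z \<in> S \<longleftrightarrow> - 1 / 2 \<le> Re z \<and> Re z \<le> 0 \<and> Im z = Im \<tau>" for z
      unfolding S_def in_cbox_complex_iff by auto
    define \<tau>L where "\<tau>L = Complex (- 1 / 2) (Im \<tau>)"
    have reg: "z \<in> region" if "z \<in> S" for z
      by (rule region_upper) (use that \<tau> S in auto)
    have "norm ((H \<tau> - of_real M * \<tau>) - (H \<tau>L - of_real M * \<tau>L)) \<le> C * exp (- 2 * pi * Im \<tau>) * norm (\<tau> - \<tau>L)"
    proof (rule field_differentiable_bound)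
      show "convex S" by (simp add: S_def)
      fix z assume z: "z \<in> S"
      have "(H has_field_derivative h z) (at z within S)"
        using H_region[OF reg[OF z]] by (rule has_field_derivative_at_within)
      thus "((\<lambda>\<tau>. H \<tau> - of_real M * \<tau>) has_field_derivative h z - of_real M) (at z within S)"
        by (auto intro!: derivative_eq_intros)
      show "norm (h z - of_real M) \<le> C * exp (- 2 * pi * Im \<tau>)"
        using MC[of z] z \<tau> S by auto
    qed (use \<tau> S in \<open>auto simp: \<tau>L_def\<close>)
    also have "norm (\<tau> - \<tau>L) = \<bar>Re \<tau> + 1 / 2\<bar>"
      by (subst cmod_eq_Re) (simp_all add: \<tau>L_def)
    also have "C * exp (- 2 * pi * Im \<tau>) * \<bar>Re \<tau> + 1 / 2\<bar> \<le> C * exp (- 2 * pi * Im \<tau>) * 1"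
      using \<tau> C by (intro mult_left_mono) auto
    finally have "norm ((H \<tau> - of_real M * \<tau>) - (H \<tau>L - of_real M * \<tau>L)) \<le> C * exp (- 2 * pi * Im \<tau>)" by simp
    hence "\<bar>Re ((H \<tau> - of_real M * \<tau>) - (H \<tau>L - of_real M * \<tau>L))\<bar> \<le> C * exp (- 2 * pi * Im \<tau>)"
      using abs_Re_le_cmod order_trans by blast
    moreover have "Re (H \<tau>L) = VL" by (rule Re_H_left) (use reg[of \<tau>L] \<tau> S in \<open>auto simp: \<tau>L_def\<close>)
    ultimately show ?thesis by (simp add: \<tau>L_def algebra_simps)
  qed
  have "\<bar>VR - VL - M / 2\<bar> \<le> 0"
  proof (rule field_le_epsilon)
    fix \<epsilon> :: real assume "\<epsilon> > 0"
    then obtain Y where Y: "Y \<ge> 2" "\<And>y. y \<ge> Y \<Longrightarrow> C * (y ^ 0 * exp (- 2 * pi * y)) < \<epsilon>"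
      using exp_decay[of \<epsilon> C 0] by blast
    define \<tau> where "\<tau> = Complex 0 Y"
    have "\<tau> \<in> region" by (rule region_upper) (use Y in \<open>auto simp: \<tau>_def\<close>)
    hence "Re (H \<tau>) = VR" by (rule Re_H_right) (simp add: \<tau>_def)
    thus "\<bar>VR - VL - M / 2\<bar> \<le> 0 + \<epsilon>"
      using bound[of \<tau>] Y(1) Y(2)[of Y] by (simp add: \<tau>_def)
  qed
  hence "VR = VL + M / 2" by simp
  moreover from this VR_le_VL have "M \<le> 0" by simp
  ultimately show ?thesis using MC C bound by (intro that) auto
qed

text \<open>The maximum principle is applied to \<open>\<i> * (H - VL)\<close> and
  \<open>\<i> * (VR - H)\<close>, whose imaginary parts are the quantities to be bounded.\<close>

lemma Re_H_bounds:
  assumes "\<tau> \<in> \<Omega>"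
  shows "Re (H \<tau>) \<le> VL" "VR \<le> Re (H \<tau>)"
proof -
  obtain M C where MC: "M \<le> 0" "C \<ge> 0" "VR = VL + M / 2"
    "\<And>\<tau>. Im \<tau> \<ge> 2 \<Longrightarrow> - 1 / 2 \<le> Re \<tau> \<Longrightarrow> Re \<tau> \<le> 0 \<Longrightarrow>
       \<bar>Re (H \<tau>) - VL - M * (Re \<tau> + 1 / 2)\<bar> \<le> C * exp (- 2 * pi * Im \<tau>)"
    using H_at_infinity by metis
  have hol: "H holomorphic_on \<Omega>"
    using H open_\<Omega> \<Omega>_subset_region region_subset_U
    by (auto simp: holomorphic_on_open field_differentiable_def intro!: exI)
  have far: "\<exists>B. \<forall>w\<in>\<Omega>. norm w > B \<longrightarrow> Re (H w) - VL < \<epsilon> \<and> VR - Re (H w) < \<epsilon>" if "\<epsilon> > 0" for \<epsilon>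
  proof -
    obtain Y where Y: "Y \<ge> 2" "\<And>y. y \<ge> Y \<Longrightarrow> C * (y ^ 0 * exp (- 2 * pi * y)) < \<epsilon>"
      using exp_decay[OF \<open>\<epsilon> > 0\<close>, of C 0] by blast
    show ?thesis
    proof (intro exI[of _ "Y + 1"] ballI impI)
      fix w assume w: "w \<in> \<Omega>" "norm w > Y + 1"
      have w': "- 1 / 2 < Re w" "Re w < 0" "Im w > 0" using w by (auto simp: \<Omega>_def)
      have "norm w \<le> \<bar>Re w\<bar> + \<bar>Im w\<bar>" by (rule cmod_le)
      hence "Im w \<ge> Y" using w w' by linarith
      hence "\<bar>Re (H w) - VL - M * (Re w + 1 / 2)\<bar> < \<epsilon>"
        using MC(4)[of w] Y(1) Y(2)[of "Im w"] w' by simp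
      \<comment> \<open>These are the limiting values of \<open>Re H - VL\<close> and
        \<open>VR - Re H\<close> high up, using \<open>VR = VL + M / 2\<close>.\<close>
      moreover have "M * (Re w + 1 / 2) \<le> 0" "M * (- Re w) \<le> 0"
        by (rule mult_nonpos_nonneg; use MC(1) w' in linarith)+
      ultimately show "Re (H w) - VL < \<epsilon> \<and> VR - Re (H w) < \<epsilon>"
        using MC(3) by (auto simp: algebra_simps abs_less_iff)
    qed
  qed
  have near: "\<exists>d>0. \<forall>w\<in>\<Omega>. dist w z < d \<longrightarrow> Re (H w) - VL < \<epsilon> \<and> VR - Re (H w) < \<epsilon>"
    if z: "z \<in> frontier \<Omega>" and \<epsilon>: "\<epsilon> > 0" for z \<epsilon>
  proof -
    consider "sqdist 0 z = P" | "p \<in> {5, 7}" "sqdist (- 1 / 2) z = P / 4" |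
      "z \<in> region" "Re z = - 1 / 2 \<or> Re z = 0"
      using frontier_\<Omega>(6)[OF z] by blast
    thus ?thesis
    proof cases
    case 1
    obtain \<delta>1 where \<delta>1: "\<delta>1 > 0" "\<And>\<tau>. \<tau> \<in> region \<Longrightarrow> sqdist 0 \<tau> < P + \<delta>1 \<Longrightarrow> Re (H \<tau>) \<le> VL + \<epsilon> / 2"
      using Re_H_le_near_circle1[of "\<epsilon> / 2"] \<epsilon> by auto
    obtain \<delta>2 where \<delta>2: "\<delta>2 > 0" "\<And>\<tau>. \<tau> \<in> region \<Longrightarrow> sqdist 0 \<tau> < P + \<delta>2 \<Longrightarrow> VR \<le> Re (H \<tau>) + \<epsilon> / 2"
      using Re_H_ge_near_circle1[of "\<epsilon> / 2"] \<epsilon> by auto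
    obtain d where d: "d > 0" "\<And>w. dist w z < d \<Longrightarrow> sqdist 0 w < P + min \<delta>1 \<delta>2"
      using sqdist_near[of 0 z "P + min \<delta>1 \<delta>2"] 1 \<delta>1(1) \<delta>2(1) by auto
    show ?thesis
    proof (intro exI[of _ d] conjI ballI impI d(1))
      fix w assume w: "w \<in> \<Omega>" "dist w z < d"
      have "w \<in> region" using w \<Omega>_subset_region by blast
      note this \<delta>1(2)[OF this] \<delta>2(2)[OF this] d(2)[OF w(2)]
      thus "Re (H w) - VL < \<epsilon>" "VR - Re (H w) < \<epsilon>"
        using \<epsilon> by linarith+
    qed
  next
    case * : 2
    obtain \<delta>1 where \<delta>1: "\<delta>1 > 0" "\<And>\<tau>. \<tau> \<in> region \<Longrightarrow> sqdist (- 1 / 2) \<tau> < P / 4 + \<delta>1 \<Longrightarrow> Re (H \<tau>) \<le> VL + \<epsilon> / 2"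
      using Re_H_le_near_circle2[of "\<epsilon> / 2"] \<epsilon> * by auto
    obtain \<delta>2 where \<delta>2: "\<delta>2 > 0" "\<And>\<tau>. \<tau> \<in> region \<Longrightarrow> sqdist (- 1 / 2) \<tau> < P / 4 + \<delta>2 \<Longrightarrow> VR \<le> Re (H \<tau>) + \<epsilon> / 2"
      using Re_H_ge_near_circle2[of "\<epsilon> / 2"] \<epsilon> * by auto
    obtain d where d: "d > 0" "\<And>w. dist w z < d \<Longrightarrow> sqdist (- 1 / 2) w < P / 4 + min \<delta>1 \<delta>2"
      using sqdist_near[of "- 1 / 2" z "P / 4 + min \<delta>1 \<delta>2"] *(2) \<delta>1(1) \<delta>2(1) by fastforce
    show ?thesis
    proof (intro exI[of _ d] conjI ballI impI d(1))
      fix w assume w: "w \<in> \<Omega>" "dist w z < d"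
      have "w \<in> region" using w \<Omega>_subset_region by blast
      note this \<delta>1(2)[OF this] \<delta>2(2)[OF this] d(2)[OF w(2)]
      thus "Re (H w) - VL < \<epsilon>" "VR - Re (H w) < \<epsilon>"
        using \<epsilon> by linarith+
    qed
  next
    case * : 3
    have "isCont H z" using H_region[OF *(1)] by (rule DERIV_isCont)
    then obtain d where d: "d > 0" "\<And>w. dist w z < d \<Longrightarrow> dist (H w) (H z) < \<epsilon>"
      using \<epsilon> unfolding continuous_at_eps_delta by blast
    have Hz: "VR \<le> Re (H z)" "Re (H z) \<le> VL"
      using Re_H_left[OF *(1)] Re_H_right[OF *(1)] *(2) VR_le_VL by auto
    show ?thesis
    proof (intro exI[of _ d] conjI ballI impI d(1))
      fix w assume w: "w \<in> \<Omega>" "dist w z < d"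
      have "\<bar>Re (H w - H z)\<bar> < \<epsilon>"
        using d(2)[OF w(2)] abs_Re_le_cmod[of "H w - H z"] by (simp only: dist_norm)
      thus "Re (H w) - VL < \<epsilon>" "VR - Re (H w) < \<epsilon>" using Hz by auto
    qed
    qed
  qed
  have "Im (\<i> * (H \<tau> - of_real VL)) \<le> 0"
  proof (rule Im_maximum_principle[OF open_\<Omega> _ _ _ assms])
    show "(\<lambda>\<tau>. \<i> * (H \<tau> - of_real VL)) holomorphic_on \<Omega>" using hol by (intro holomorphic_intros)
    show "\<exists>d>0. \<forall>w\<in>\<Omega>. dist w z < d \<longrightarrow> Im (\<i> * (H w - of_real VL)) < \<epsilon>"
      if "z \<in> frontier \<Omega>" "\<epsilon> > 0" for z \<epsilon> using near[OF that] by auto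
    show "\<exists>B. \<forall>w\<in>\<Omega>. norm w > B \<longrightarrow> Im (\<i> * (H w - of_real VL)) < \<epsilon>"
      if "\<epsilon> > 0" for \<epsilon> using far[OF that] by auto
  qed
  thus "Re (H \<tau>) \<le> VL" by simp
  have "Im (\<i> * (of_real VR - H \<tau>)) \<le> 0"
  proof (rule Im_maximum_principle[OF open_\<Omega> _ _ _ assms])
    show "(\<lambda>\<tau>. \<i> * (of_real VR - H \<tau>)) holomorphic_on \<Omega>" using hol by (intro holomorphic_intros)
    show "\<exists>d>0. \<forall>w\<in>\<Omega>. dist w z < d \<longrightarrow> Im (\<i> * (of_real VR - H w)) < \<epsilon>"
      if "z \<in> frontier \<Omega>" "\<epsilon> > 0" for z \<epsilon> using near[OF that] by auto
    show "\<exists>B. \<forall>w\<in>\<Omega>. norm w > B \<longrightarrow> Im (\<i> * (of_real VR - H w)) < \<epsilon>"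
      if "\<epsilon> > 0" for \<epsilon> using far[OF that] by auto
  qed
  thus "VR \<le> Re (H \<tau>)" by simp
qed

lemma side_derivative:
  assumes "z \<in> region"
  shows "((\<lambda>t. Re (H (z + of_real t))) has_real_derivative Re (h z)) (at 0)"
proof -
  have "((\<lambda>t. H (z + t)) has_field_derivative h z * 1) (at (of_real 0))"
    by (rule DERIV_chain2[where f = H and g = "\<lambda>t. z + t"])
       (use H_region[OF assms] in \<open>auto intro!: derivative_eq_intros\<close>)
  hence "((\<lambda>t. H (z + of_real t)) has_vector_derivative h z * 1) (at 0)"
    by (rule has_vector_derivative_real_field)
  hence "((\<lambda>t. Re (H (z + of_real t))) has_vector_derivative Re (h z * 1)) (at 0)"
    by (rule bounded_linear.has_vector_derivative[OF bounded_linear_Re])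
  thus ?thesis by (simp add: has_real_derivative_iff_has_vector_derivative)
qed

text \<open>\<open>Re (h z)\<close> is the horizontal derivative of \<open>Re H\<close>. If it were
  positive, \<open>Re H\<close> would exceed \<open>VL\<close> just right of the left side, or fall
  below \<open>VR\<close> just left of the right side.\<close>

lemma h_side_nonpos:
  assumes z: "z \<in> region" "Re z = - 1 / 2 \<or> Re z = 0"
  shows "Re (h z) \<le> 0"
proof (rule ccontr)
  assume "\<not> Re (h z) \<le> 0"
  hence pos: "Re (h z) > 0" by simp
  obtain d where d: "d > 0" "\<And>w. dist w z < d \<Longrightarrow> - 1 / 2 < Re w \<Longrightarrow> Re w < 0 \<Longrightarrow> w \<in> \<Omega>"
    "\<And>w. dist w z < d \<Longrightarrow> - 1 / 2 \<le> Re w \<Longrightarrow> Re w \<le> 0 \<Longrightarrow> w \<in> region"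
    by (rule region_ball[OF z(1)], rule that)
  from z(2) show False
  proof
    assume "Re z = - 1 / 2"
    obtain d' where d': "d' > 0" "\<And>t. t > 0 \<Longrightarrow> t < d' \<Longrightarrow> Re (H (z + of_real 0)) < Re (H (z + of_real (0 + t)))"
      using DERIV_pos_inc_right[OF side_derivative[OF z(1)] pos] by blast
    define t where "t = min (min d d') (1 / 2) / 2"
    have t: "0 < t" "t < d" "t < d'" "t < 1 / 2" using d(1) d'(1) by (auto simp: t_def)
    have "z + of_real t \<in> \<Omega>"
      by (rule d(2)) (use t \<open>Re z = - 1 / 2\<close> in \<open>auto simp: dist_norm\<close>)
    thus False using Re_H_bounds(1)[of "z + of_real t"] d'(2)[of t] t Re_H_left[OF z(1) \<open>Re z = - 1 / 2\<close>] by simp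
  next
    assume "Re z = 0"
    obtain d' where d': "d' > 0" "\<And>t. t > 0 \<Longrightarrow> t < d' \<Longrightarrow> Re (H (z + of_real (0 - t))) < Re (H (z + of_real 0))"
      using DERIV_pos_inc_left[OF side_derivative[OF z(1)] pos] by blast
    define t where "t = min (min d d') (1 / 2) / 2"
    have t: "0 < t" "t < d" "t < d'" "t < 1 / 2" using d(1) d'(1) by (auto simp: t_def)
    have "z - of_real t \<in> \<Omega>"
      by (rule d(2)) (use t \<open>Re z = 0\<close> in \<open>auto simp: dist_norm\<close>)
    thus False using Re_H_bounds(2)[of "z - of_real t"] d'(2)[of t] t Re_H_right[OF z(1) \<open>Re z = 0\<close>] by simp
  qed
qed

end

lemma (in fricke_form) obtain_primitive:
  obtains H where "fricke_primitive p h N H"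
proof -
  have "\<exists>H. \<forall>\<tau>\<in>U. (H has_field_derivative h \<tau>) (at \<tau>)"
    by (rule holomorphic_starlike_primitive[of _ _ "{}"])
       (use h_holomorphic_U starlike_U open_U in
         \<open>auto simp: holomorphic_on_imp_continuous_on holomorphic_on_imp_differentiable_at\<close>)
  then obtain H where "\<And>\<tau>. \<tau> \<in> U \<Longrightarrow> (H has_field_derivative h \<tau>) (at \<tau>)" by blast
  hence "fricke_primitive p h N H" by unfold_locales
  thus ?thesis by (rule that)
qed

lemma (in fricke_form) h_side:
  assumes "z \<in> region" "Re z = - 1 / 2 \<or> Re z = 0"
  shows "Re (h z) \<le> 0" "h z = of_real (Re (h z))"
proof -
  obtain H where "fricke_primitive p h N H" by (rule obtain_primitive)
  then interpret fricke_primitive p h N H .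
  show "Re (h z) \<le> 0" by (rule h_side_nonpos[OF assms])
  show "h z = of_real (Re (h z))"
    using real_on_left_line[of z] real_on_imaginary_axis[of z] assms by (auto simp: region_def)
qed

lemma (in fricke_form) cusp_nonpos:
  obtains M C where "M \<le> 0" "C \<ge> 0" "\<And>\<tau>. Im \<tau> \<ge> 2 \<Longrightarrow> norm (h \<tau> - of_real M) \<le> C * exp (- 2 * pi * Im \<tau>)"
proof -
  obtain H where "fricke_primitive p h N H" by (rule obtain_primitive)
  then interpret fricke_primitive p h N H .
  show ?thesis using H_at_infinity that by metis
qed

context fricke_form
begin

section \<open>Absence of zeros in the half domain\<close>

text \<open>Keeping \<open>X\<close> abstract lets all levels share the argument.
  \<open>\<zeta>\<close> is the one singularity permitted to \<open>X\<close>; the pole estimate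
  does not apply at it, so \<open>corner\<close> supplies the boundary value there.\<close>

lemma h_nonzero_criterion:
  fixes X :: "complex \<Rightarrow> complex"
  assumes X: "X holomorphic_on {\<tau>. Im \<tau> > 0} - {\<zeta>}" and \<zeta>: "\<zeta> \<notin> region"
    and real1: "\<And>\<tau>. Im \<tau> > 0 \<Longrightarrow> \<tau> \<noteq> \<zeta> \<Longrightarrow> sqdist 0 \<tau> = P \<Longrightarrow> X \<tau> / \<tau> \<in> \<real>"
    and pos1: "\<And>\<tau>. Im \<tau> > 0 \<Longrightarrow> \<tau> \<noteq> \<zeta> \<Longrightarrow> sqdist 0 \<tau> = P \<Longrightarrow> P / 4 \<le> sqdist (- 1 / 2) \<tau> \<Longrightarrow> Re (X \<tau> / \<tau>) \<ge> 0"
    and real2: "\<And>\<tau>. p \<in> {5, 7} \<Longrightarrow> Im \<tau> > 0 \<Longrightarrow> \<tau> \<noteq> \<zeta> \<Longrightarrow> sqdist (- 1 / 2) \<tau> = P / 4 \<Longrightarrow> X \<tau> / (\<tau> + 1 / 2) \<in> \<real>"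
    and pos2: "\<And>\<tau>. p \<in> {5, 7} \<Longrightarrow> Im \<tau> > 0 \<Longrightarrow> \<tau> \<noteq> \<zeta> \<Longrightarrow> sqdist (- 1 / 2) \<tau> = P / 4 \<Longrightarrow> P \<le> sqdist 0 \<tau> \<Longrightarrow>
       Re (X \<tau> / (\<tau> + 1 / 2)) \<ge> 0"
    and corner: "\<And>\<epsilon>. \<zeta> \<in> frontier \<Omega> \<Longrightarrow> \<epsilon> > 0 \<Longrightarrow> \<exists>d>0. \<forall>w\<in>\<Omega>. dist w \<zeta> < d \<longrightarrow> Im (X w * h w) < \<epsilon>"
    and sides: "\<And>z. z \<in> region \<Longrightarrow> Re z = - 1 / 2 \<or> Re z = 0 \<Longrightarrow> Im (X z) > 0"
    and X_nz: "\<And>\<tau>. \<tau> \<in> \<Omega> \<Longrightarrow> X \<tau> \<noteq> 0"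
    and inf: "\<exists>Y K. \<forall>\<tau>. Im \<tau> \<ge> Y \<longrightarrow> - 1 / 2 \<le> Re \<tau> \<longrightarrow> Re \<tau> \<le> 0 \<longrightarrow>
        Im (X \<tau>) \<ge> 0 \<and> norm (X \<tau>) \<le> K * (Im \<tau>) ^ 2"
    and nonzero: "\<exists>\<tau>\<in>\<Omega>. h \<tau> \<noteq> 0"
    and "\<tau> \<in> region"
  shows "h \<tau> \<noteq> 0"
proof -
  define A where "A = {\<tau>. Im \<tau> > 0} - {\<zeta>}"
  have A: "open A" unfolding A_def by (intro open_Diff open_halfspace_Im_gt) auto
  have region_A: "region \<subseteq> A" using \<zeta> by (auto simp: A_def region_def)
  have hol_U: "(\<lambda>\<tau>. X \<tau> * h \<tau>) holomorphic_on A \<inter> U"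
    using X h_holomorphic_U unfolding A_def
    by (intro holomorphic_intros) (auto elim: holomorphic_on_subset)
  have hol: "(\<lambda>\<tau>. X \<tau> * h \<tau>) holomorphic_on \<Omega>"
    by (rule holomorphic_on_subset[OF hol_U]) (use region_A \<Omega>_subset_region region_subset_U in blast)
  have Xh_side: "Im (X z * h z) \<le> 0" if "z \<in> region" "Re z = - 1 / 2 \<or> Re z = 0" for z
  proof -
    have "Im (X z * h z) = Im (X z) * Re (h z)" by (subst h_side(2)[OF that]) simp
    also have "\<dots> \<le> 0" using sides[OF that] h_side(1)[OF that] by (intro mult_nonneg_nonpos) auto
    finally show ?thesis .
  qed
  have le: "Im (X w * h w) \<le> 0" if "w \<in> \<Omega>" for w
  proof (rule Im_maximum_principle[OF open_\<Omega> hol _ _ that])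
    fix \<epsilon> :: real assume \<epsilon>: "\<epsilon> > 0"
    obtain Y K where YK: "\<And>\<tau>. Im \<tau> \<ge> Y \<Longrightarrow> - 1 / 2 \<le> Re \<tau> \<Longrightarrow> Re \<tau> \<le> 0 \<Longrightarrow>
        Im (X \<tau>) \<ge> 0 \<and> norm (X \<tau>) \<le> K * (Im \<tau>) ^ 2" using inf by blast
    obtain M C where MC: "M \<le> 0" "C \<ge> 0"
      "\<And>\<tau>. Im \<tau> \<ge> 2 \<Longrightarrow> norm (h \<tau> - of_real M) \<le> C * exp (- 2 * pi * Im \<tau>)"
      using cusp_nonpos by blast
    obtain Y' where Y': "Y' \<ge> 2" "\<And>y. y \<ge> Y' \<Longrightarrow> K * C * (y ^ 2 * exp (- 2 * pi * y)) < \<epsilon>"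
      using exp_decay[OF \<epsilon>, of "K * C" 2] by blast
    show "\<exists>B. \<forall>w\<in>\<Omega>. B < norm w \<longrightarrow> Im (X w * h w) < \<epsilon>"
    proof (intro exI[of _ "max Y Y' + 1"] ballI impI)
      fix w assume w: "w \<in> \<Omega>" "norm w > max Y Y' + 1"
      have w': "- 1 / 2 < Re w" "Re w < 0" "Im w > 0" using w by (auto simp: \<Omega>_def)
      have "norm w \<le> \<bar>Re w\<bar> + \<bar>Im w\<bar>" by (rule cmod_le)
      hence Imw: "Im w \<ge> Y" "Im w \<ge> Y'" using w w' by linarith+
      have Xw: "Im (X w) \<ge> 0" "norm (X w) \<le> K * (Im w) ^ 2" using YK[of w] Imw w' by auto
      have hw: "norm (h w - of_real M) \<le> C * exp (- 2 * pi * Im w)" using MC(3)[of w] Imw Y'(1) by auto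
      \<comment> \<open>The main part \<open>M * X\<close> has nonpositive imaginary part since
        \<open>M <= 0\<close>; the rest is a quadratic growth times an exponential decay.\<close>
      have "X w * h w = of_real M * X w + X w * (h w - of_real M)" by (simp add: algebra_simps)
      hence "Im (X w * h w) = M * Im (X w) + Im (X w * (h w - of_real M))" by simp
      also have "\<dots> \<le> 0 + norm (X w * (h w - of_real M))"
        using Xw MC(1) abs_Im_le_cmod[of "X w * (h w - of_real M)"] by (intro add_mono mult_nonpos_nonneg) auto
      also have "\<dots> \<le> (K * (Im w) ^ 2) * (C * exp (- 2 * pi * Im w))"
        unfolding norm_mult add_0 by (rule mult_mono) (use Xw hw norm_ge_zero[of "X w"] in \<open>linarith | simp\<close>)+
      also have "\<dots> = K * C * ((Im w) ^ 2 * exp (- 2 * pi * Im w))" by simp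
      also have "\<dots> < \<epsilon>" by (rule Y'(2)[OF Imw(2)])
      finally show "Im (X w * h w) < \<epsilon>" .
    qed
  next
    fix z and \<epsilon> :: real assume z: "z \<in> frontier \<Omega>" and \<epsilon>: "\<epsilon> > 0"
    note fr = frontier_\<Omega>[OF z]
    have Imz: "Im z > 0" using fr(1) by linarith
    show "\<exists>d>0. \<forall>w\<in>\<Omega>. dist w z < d \<longrightarrow> Im (X w * h w) < \<epsilon>"
    proof (cases "z = \<zeta>")
      case True
      thus ?thesis using corner z \<epsilon> by blast
    next
      case False
      hence zA: "z \<in> A" using Imz by (simp add: A_def)
      consider "sqdist 0 z = P" | "p \<in> {5, 7}" "sqdist (- 1 / 2) z = P / 4" |
        "z \<in> region" "Re z = - 1 / 2 \<or> Re z = 0"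
        using fr(6) by blast
      thus ?thesis
      proof cases
        case 1
        have "\<exists>d>0. \<forall>\<tau>. dist \<tau> z < d \<and> sqdist 0 \<tau> > sqdist 0 z \<longrightarrow> Im (X \<tau> * h \<tau>) < \<epsilon>"
        proof (rule circle_boundary[OF Imz _ A zA])
          show "X holomorphic_on A" using X by (simp add: A_def)
          show "(\<tau> - of_real 0) * h \<tau> \<in> \<real>" if "Im \<tau> > 0" "\<tau> \<notin> N" "sqdist 0 \<tau> = sqdist 0 z" for \<tau>
            using real_on_circle1[OF that(1,2)] that(3) 1 by simp
          show "X \<tau> / (\<tau> - of_real 0) \<in> \<real>" if "Im \<tau> > 0" "\<tau> \<in> A" "sqdist 0 \<tau> = sqdist 0 z" for \<tau>
            using real1[of \<tau>] that 1 by (simp add: A_def)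
          show "Re (X z / (z - of_real 0)) \<ge> 0"
            using pos1[OF Imz False 1 fr(5)] by simp
        qed (rule \<epsilon>)
        then obtain d where "d > 0" "\<And>\<tau>. dist \<tau> z < d \<Longrightarrow> sqdist 0 \<tau> > P \<Longrightarrow> Im (X \<tau> * h \<tau>) < \<epsilon>"
          unfolding 1 by blast
        thus ?thesis by (intro exI[of _ d]) (auto simp: \<Omega>_def)
      next
        case 2
        have "\<exists>d>0. \<forall>\<tau>. dist \<tau> z < d \<and> sqdist (- 1 / 2) \<tau> > sqdist (- 1 / 2) z \<longrightarrow> Im (X \<tau> * h \<tau>) < \<epsilon>"
        proof (rule circle_boundary[OF Imz _ A zA])
          show "X holomorphic_on A" using X by (simp add: A_def)
          show "(\<tau> - of_real (- 1 / 2)) * h \<tau> \<in> \<real>" if "Im \<tau> > 0" "\<tau> \<notin> N" "sqdist (- 1 / 2) \<tau> = sqdist (- 1 / 2) z" for \<tau>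
            using real_on_circle2[OF that(1,2) _ 2(1)] that(3) 2 by simp
          show "X \<tau> / (\<tau> - of_real (- 1 / 2)) \<in> \<real>" if "Im \<tau> > 0" "\<tau> \<in> A" "sqdist (- 1 / 2) \<tau> = sqdist (- 1 / 2) z" for \<tau>
            using real2[OF 2(1), of \<tau>] that 2(2) by (simp add: A_def)
          show "Re (X z / (z - of_real (- 1 / 2))) \<ge> 0"
            using pos2[OF 2(1) Imz False 2(2) fr(4)] by simp
        qed (rule \<epsilon>)
        then obtain d where "d > 0" "\<And>\<tau>. dist \<tau> z < d \<Longrightarrow> sqdist (- 1 / 2) \<tau> > P / 4 \<Longrightarrow> Im (X \<tau> * h \<tau>) < \<epsilon>"
          unfolding 2(2) by blast
        thus ?thesis by (intro exI[of _ d]) (simp only: \<Omega>_def mem_Collect_eq, blast)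
      next
        case 3
        have "z \<in> A \<inter> U" using 3(1) region_A region_subset_U by blast
        hence "isCont (\<lambda>\<tau>. X \<tau> * h \<tau>) z"
          using holomorphic_on_imp_continuous_on[OF hol_U] A open_U
          by (simp add: continuous_on_eq_continuous_at open_Int)
        then obtain d where d: "d > 0" "\<And>w. dist w z < d \<Longrightarrow> dist (X w * h w) (X z * h z) < \<epsilon>"
          using \<epsilon> unfolding continuous_at_eps_delta by blast
        show ?thesis
        proof (intro exI[of _ d] conjI ballI impI d(1))
          fix w assume w: "dist w z < d"
          have "\<bar>Im (X w * h w - X z * h z)\<bar> < \<epsilon>"
            using d(2)[OF w] abs_Im_le_cmod[of "X w * h w - X z * h z"] by (simp only: dist_norm)
          moreover note Xh_side[OF 3]
          ultimately show "Im (X w * h w) < \<epsilon>" by (simp del: times_complex.sel)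
        qed
      qed
    qed
  qed
  have conn: "connected \<Omega>" by (rule starlike_imp_connected[OF starlike_\<Omega>])
  \<comment> \<open>A real constant product must be excluded before the open mapping theorem can
    sharpen \<open><= 0\<close> to \<open>< 0\<close>. By continuity \<open>c\<close> would be
    \<open>X z\<close> times a nonzero real number on the imaginary axis, where
    \<open>Im (X z) > 0\<close>.\<close>
  have const_Im: "Im c \<noteq> 0" if c: "\<And>w. w \<in> \<Omega> \<Longrightarrow> X w * h w = c" for c
  proof -
    obtain w0 where "w0 \<in> \<Omega>" "h w0 \<noteq> 0" using nonzero by blast
    hence "c \<noteq> 0" using c[of w0] X_nz[of w0] by auto
    have lim: "X z * h z = c" if z: "z \<in> region" "Re z = 0" for z
    proof -
      have "z \<in> A \<inter> U" using z(1) region_A region_subset_U by blast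
      hence "isCont (\<lambda>\<tau>. X \<tau> * h \<tau>) z"
        using holomorphic_on_imp_continuous_on[OF hol_U] A open_U
        by (simp add: continuous_on_eq_continuous_at open_Int)
      moreover have "((\<lambda>t. z - of_real t) \<longlongrightarrow> z - of_real 0) (at_right (0::real))"
        by (intro tendsto_intros)
      hence "((\<lambda>t. z - of_real t) \<longlongrightarrow> z) (at_right (0::real))" by simp
      ultimately have "((\<lambda>t. X (z - of_real t) * h (z - of_real t)) \<longlongrightarrow> X z * h z) (at_right (0::real))"
        by (rule isCont_tendsto_compose)
      moreover have "eventually (\<lambda>t. X (z - of_real t) * h (z - of_real t) = c) (at_right (0::real))"
      proof -
        obtain d where d: "d > 0" "\<And>w. dist w z < d \<Longrightarrow> - 1 / 2 < Re w \<Longrightarrow> Re w < 0 \<Longrightarrow> w \<in> \<Omega>"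
          "\<And>w. dist w z < d \<Longrightarrow> - 1 / 2 \<le> Re w \<Longrightarrow> Re w \<le> 0 \<Longrightarrow> w \<in> region"
          by (rule region_ball[OF z(1)], rule that)
        have "eventually (\<lambda>t. t \<in> {0<..<min d (1/2)}) (at_right (0::real))"
          by (rule eventually_at_right_real) (use d(1) in auto)
        thus ?thesis
        proof eventually_elim
          case (elim t)
          show ?case by (rule c, rule d(2)) (use elim z in \<open>auto simp: dist_norm\<close>)
        qed
      qed
      hence "((\<lambda>t. X (z - of_real t) * h (z - of_real t)) \<longlongrightarrow> c) (at_right (0::real))"
        by (rule tendsto_eventually)
      ultimately show ?thesis by (rule tendsto_unique[rotated]) simp
    qed
    define z where "z = Complex 0 2"
    have z: "z \<in> region" "Re z = 0" by (auto simp: z_def intro!: region_upper)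
    have Xz: "X z * of_real (Re (h z)) = c" using lim[OF z] h_side(2)[OF z(1)] z(2) by metis
    have "Re (h z) \<noteq> 0" using Xz \<open>c \<noteq> 0\<close> by auto
    moreover have "Im (X z) > 0" using sides z by blast
    ultimately have "Im (X z * of_real (Re (h z))) \<noteq> 0" by simp
    thus "Im c \<noteq> 0" unfolding Xz .
  qed
  have less: "Im (X w * h w) < 0" if w: "w \<in> \<Omega>" for w
  proof (rule ccontr)
    assume "\<not> Im (X w * h w) < 0"
    hence 0: "Im (X w * h w) = 0" using le[OF w] by linarith
    have nonconst: "\<not> (\<lambda>\<tau>. X \<tau> * h \<tau>) constant_on \<Omega>"
      using const_Im[of "X w * h w"] 0 w unfolding constant_on_def by metis
    have "open ((\<lambda>\<tau>. X \<tau> * h \<tau>) ` \<Omega>)"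
      by (rule open_mapping_thm[OF hol open_\<Omega> conn open_\<Omega> subset_refl nonconst])
    moreover have "X w * h w \<in> (\<lambda>\<tau>. X \<tau> * h \<tau>) ` \<Omega>" using w by blast
    ultimately obtain e where e: "e > 0" "ball (X w * h w) e \<subseteq> (\<lambda>\<tau>. X \<tau> * h \<tau>) ` \<Omega>"
      unfolding open_contains_ball by blast
    have "X w * h w + \<i> * of_real (e / 2) \<in> ball (X w * h w) e"
      using e(1) by (simp add: dist_norm norm_mult)
    then obtain w' where "w' \<in> \<Omega>" "X w * h w + \<i> * of_real (e / 2) = X w' * h w'" using e(2) by blast
    hence "Im (X w * h w + \<i> * of_real (e / 2)) \<le> 0" using le by metis
    thus False using 0 e(1) by (simp del: times_complex.sel)
  qed
  show "h \<tau> \<noteq> 0"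
  proof
    assume h0: "h \<tau> = 0"
    have \<tau>_side: "Re \<tau> = - 1 / 2 \<or> Re \<tau> = 0"
    proof (rule ccontr)
      assume "\<not> ?thesis"
      hence "\<tau> \<in> \<Omega>" using \<open>\<tau> \<in> region\<close> by (auto simp: region_def \<Omega>_def)
      thus False using less[of \<tau>] h0 by simp
    qed
    obtain d where d: "d > 0" "\<And>w. dist w \<tau> < d \<Longrightarrow> - 1 / 2 < Re w \<Longrightarrow> Re w < 0 \<Longrightarrow> w \<in> \<Omega>"
      "\<And>w. dist w \<tau> < d \<Longrightarrow> - 1 / 2 \<le> Re w \<Longrightarrow> Re w \<le> 0 \<Longrightarrow> w \<in> region"
      by (rule region_ball[OF \<open>\<tau> \<in> region\<close>], rule that)
    have \<tau>AU: "\<tau> \<in> A \<inter> U" using \<open>\<tau> \<in> region\<close> region_A region_subset_U by blast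
    define D where "D = deriv h \<tau>"
    have D: "(h has_field_derivative D) (at \<tau>)"
      unfolding D_def using h_holomorphic_U open_U \<tau>AU by (intro holomorphic_derivI) auto
    have "((\<lambda>t. h (\<tau> + \<i> * t)) has_field_derivative D * \<i>) (at (of_real 0))"
      by (rule DERIV_chain2[where f = h and g = "\<lambda>t. \<tau> + \<i> * t"])
         (use D in \<open>auto intro!: derivative_eq_intros\<close>)
    hence D': "((\<lambda>t. h (\<tau> + \<i> * of_real t)) has_vector_derivative D * \<i>) (at 0)"
      by (rule has_vector_derivative_real_field)
    have line: "Re (h (\<tau> + \<i> * of_real t)) \<le> 0" "Im (h (\<tau> + \<i> * of_real t)) = 0" if "\<bar>t\<bar> < d" for t
    proof -
      define z where "z = \<tau> + \<i> * of_real t"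
      have "z \<in> region" using \<tau>_side that by (intro d(3)) (auto simp: z_def dist_norm norm_mult)
      moreover have "Re z = - 1 / 2 \<or> Re z = 0" using \<tau>_side by (simp add: z_def)
      ultimately have "Re (h z) \<le> 0" "h z = of_real (Re (h z))" using h_side by blast+
      thus "Re (h (\<tau> + \<i> * of_real t)) \<le> 0" "Im (h (\<tau> + \<i> * of_real t)) = 0"
        unfolding z_def by (metis Im_complex_of_real)+
    qed
    \<comment> \<open>Along the side \<open>h\<close> is real and nonpositive, and it is 0 at
      \<open>\<tau>\<close>: an extremum, so the derivative vanishes.\<close>
    have "Re (D * \<i>) = 0"
    proof (rule DERIV_local_max)
      show "((\<lambda>t. Re (h (\<tau> + \<i> * of_real t))) has_real_derivative Re (D * \<i>)) (at 0)"
        unfolding has_real_derivative_iff_has_vector_derivative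
        by (rule bounded_linear.has_vector_derivative[OF bounded_linear_Re D'])
      show "\<forall>y. \<bar>0 - y\<bar> < d \<longrightarrow> Re (h (\<tau> + \<i> * of_real y)) \<le> Re (h (\<tau> + \<i> * of_real 0))"
        using line(1) h0 by simp
    qed (rule d(1))
    moreover have "Im (D * \<i>) = 0"
    proof (rule DERIV_local_max)
      show "((\<lambda>t. Im (h (\<tau> + \<i> * of_real t))) has_real_derivative Im (D * \<i>)) (at 0)"
        unfolding has_real_derivative_iff_has_vector_derivative
        by (rule bounded_linear.has_vector_derivative[OF bounded_linear_Im D'])
      show "\<forall>y. \<bar>0 - y\<bar> < d \<longrightarrow> Im (h (\<tau> + \<i> * of_real y)) \<le> Im (h (\<tau> + \<i> * of_real 0))"
        using line(2) d(1) h0 by simp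
    qed (rule d(1))
    ultimately have "D = 0" by (simp add: complex_eq_iff)
    obtain e where e: "e > 0" "ball \<tau> e \<subseteq> A \<inter> U"
      using \<tau>AU A open_U open_contains_ball[of "A \<inter> U"] by (metis open_Int)
    define e' where "e' = min (min e d) (1 / 2)"
    have e': "e' > 0" "e' \<le> e" "e' \<le> d" "e' \<le> 1 / 2" using e(1) d(1) by (auto simp: e'_def)
    \<comment> \<open>Points from the side into \<open>\<Omega>\<close>. The radius at most
      \<open>1/2\<close> keeps the half-disc from crossing the opposite side.\<close>
    define \<sigma> :: real where "\<sigma> = (if Re \<tau> = 0 then - 1 else 1)"
    show False
    proof (rule half_disc_double_zero)
      show "(\<lambda>\<tau>. X \<tau> * h \<tau>) holomorphic_on ball \<tau> e'"
        by (rule holomorphic_on_subset[OF hol_U]) (use e e' in auto)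
      show "e' > 0" "X \<tau> * h \<tau> = 0" "\<bar>\<sigma>\<bar> = 1" using e' h0 by (auto simp: \<sigma>_def)
      have "(X has_field_derivative deriv X \<tau>) (at \<tau>)"
        using X A \<tau>AU unfolding A_def[symmetric] by (intro holomorphic_derivI) auto
      from DERIV_mult[OF this D] have "((\<lambda>\<tau>. X \<tau> * h \<tau>) has_field_derivative 0) (at \<tau>)"
        by (simp add: h0 \<open>D = 0\<close>)
      thus "deriv (\<lambda>\<tau>. X \<tau> * h \<tau>) \<tau> = 0" by (rule DERIV_imp_deriv)
      fix w assume w: "w \<in> ball \<tau> e'" "\<sigma> * (Re w - Re \<tau>) > 0"
      have "\<bar>Re w - Re \<tau>\<bar> < 1 / 2" using abs_Re_le_cmod[of "w - \<tau>"] w(1) e'(4) by (simp add: dist_norm norm_minus_commute)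
      hence "- 1 / 2 < Re w" "Re w < 0" using w(2) \<tau>_side by (auto simp: \<sigma>_def split: if_splits)
      hence "w \<in> \<Omega>" using w(1) e' by (intro d(2)) (auto simp: dist_commute)
      thus "Im (X w * h w) < 0" by (rule less)
    qed
  qed
qed

text \<open>Only the arc around \<open>0\<close> is present, on which \<open>X / \<tau> = 1\<close>.
  The point \<open>\<zeta> = 0\<close> is a dummy below the frontier, whose heights are at least
  \<open>1/10\<close>.\<close>

lemma h_nonzero_small_level:
  assumes "p \<notin> {5, 7}" "\<exists>\<tau>\<in>\<Omega>. h \<tau> \<noteq> 0" "\<tau> \<in> region"
  shows "h \<tau> \<noteq> 0"
proof (rule h_nonzero_criterion[where X = "\<lambda>\<tau>. \<tau>" and \<zeta> = 0])
  show "0 \<notin> region" by (simp add: region_def)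
  show "\<exists>d>0. \<forall>w\<in>\<Omega>. dist w 0 < d \<longrightarrow> Im (w * h w) < \<epsilon>" if "0 \<in> frontier \<Omega>" "\<epsilon> > 0" for \<epsilon>
    using frontier_\<Omega>(1)[OF that(1)] by simp
  show "Im z > 0" if "z \<in> region" "Re z = - 1 / 2 \<or> Re z = 0" for z
    using that(1) by (simp add: region_def)
  show "\<tau> \<noteq> 0" if "\<tau> \<in> \<Omega>" for \<tau> using that by (auto simp: \<Omega>_def)
  show "\<exists>Y K. \<forall>\<tau>. Im \<tau> \<ge> Y \<longrightarrow> - 1 / 2 \<le> Re \<tau> \<longrightarrow> Re \<tau> \<le> 0 \<longrightarrow>
        Im \<tau> \<ge> 0 \<and> norm \<tau> \<le> K * (Im \<tau>) ^ 2"
  proof (rule exI[of _ 2], rule exI[of _ 1], intro allI impI)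
    fix \<tau> :: complex assume *: "2 \<le> Im \<tau>" "- 1 / 2 \<le> Re \<tau>" "Re \<tau> \<le> 0"
    have "norm \<tau> \<le> \<bar>Re \<tau>\<bar> + \<bar>Im \<tau>\<bar>" by (rule cmod_le)
    also have "\<dots> \<le> 2 * Im \<tau>" using * by simp
    also have "\<dots> \<le> Im \<tau> * Im \<tau>" using * by (intro mult_right_mono) auto
    finally show "Im \<tau> \<ge> 0 \<and> norm \<tau> \<le> 1 * (Im \<tau>) ^ 2" using * by (simp add: power2_eq_square)
  qed
qed (use assms in auto)

end

section \<open>The elliptic point at levels 5 and 7\<close>

text \<open>For \<open>\<sigma>\<close> and \<open>\<omega>\<close> on one circle around 0. The
  second identity says that the Cayley transform centred at \<open>\<omega>\<close> maps this circle
  into the real line spanned by \<open>\<omega>\<close>.\<close>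

lemma geodesic_identities:
  assumes "\<sigma> * cnj \<sigma> = \<omega> * cnj \<omega>"
  shows "(\<sigma> - \<omega>) * (\<sigma> - cnj \<omega>) = of_real (2 * (Re \<sigma> - Re \<omega>)) * \<sigma>"
    and "(\<sigma> - \<omega>) / (\<sigma> - cnj \<omega>) = of_real (- (2 * (Re \<sigma> - Re \<omega>)) / norm (\<sigma> - cnj \<omega>) ^ 2) * \<omega>"
proof -
  have s: "\<sigma> + cnj \<sigma> = of_real (2 * Re \<sigma>)" "\<omega> + cnj \<omega> = of_real (2 * Re \<omega>)"
    by (simp_all add: complex_eq_iff)
  have "(\<sigma> - \<omega>) * (\<sigma> - cnj \<omega>) = \<sigma> * \<sigma> - (\<omega> + cnj \<omega>) * \<sigma> + \<omega> * cnj \<omega>" by (simp add: algebra_simps)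
  also have "\<dots> = ((\<sigma> + cnj \<sigma>) - (\<omega> + cnj \<omega>)) * \<sigma>" unfolding assms[symmetric] by (simp add: algebra_simps)
  finally show "(\<sigma> - \<omega>) * (\<sigma> - cnj \<omega>) = of_real (2 * (Re \<sigma> - Re \<omega>)) * \<sigma>"
    unfolding s by (simp add: algebra_simps)
  have "(\<sigma> - \<omega>) * cnj (\<sigma> - cnj \<omega>) = \<sigma> * cnj \<sigma> - (\<sigma> + cnj \<sigma>) * \<omega> + \<omega> * \<omega>" by (simp add: algebra_simps)
  also have "\<dots> = ((\<omega> + cnj \<omega>) - (\<sigma> + cnj \<sigma>)) * \<omega>" unfolding assms by (simp add: algebra_simps)
  finally have "(\<sigma> - \<omega>) * cnj (\<sigma> - cnj \<omega>) = of_real (- (2 * (Re \<sigma> - Re \<omega>))) * \<omega>"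
    unfolding s by (simp add: algebra_simps)
  moreover have "a / b = a * cnj b / b / cnj b" for a b by (cases "b = 0") auto
  hence "(\<sigma> - \<omega>) / (\<sigma> - cnj \<omega>) = (\<sigma> - \<omega>) * cnj (\<sigma> - cnj \<omega>) / (\<sigma> - cnj \<omega>) / cnj (\<sigma> - cnj \<omega>)" .
  moreover have "of_real (norm (\<sigma> - cnj \<omega>) ^ 2) = (\<sigma> - cnj \<omega>) * cnj (\<sigma> - cnj \<omega>)"
    by (rule complex_norm_square)
  ultimately show "(\<sigma> - \<omega>) / (\<sigma> - cnj \<omega>) = of_real (- (2 * (Re \<sigma> - Re \<omega>)) / norm (\<sigma> - cnj \<omega>) ^ 2) * \<omega>"
    by (simp only: of_real_divide divide_divide_eq_left) simp
qed

text \<open>For \<open>\<omega>\<close> in the upper half-plane, the rotated Cayley transform has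
  positive imaginary part inside the circle through \<open>\<omega>\<close> and negative
  outside.\<close>

lemma Im_quotient_geodesic:
  assumes "\<omega> \<noteq> 0"
  shows "Im ((\<sigma> - \<omega>) / ((\<sigma> - cnj \<omega>) * \<omega>)) =
           Im \<omega> * (1 - norm \<sigma> ^ 2 / norm \<omega> ^ 2) / norm (\<sigma> - cnj \<omega>) ^ 2"
proof -
  define D where "D = norm (\<sigma> - cnj \<omega>) ^ 2"
  have D: "of_real D = (\<sigma> - cnj \<omega>) * cnj (\<sigma> - cnj \<omega>)"
    unfolding D_def by (rule complex_norm_square)
  have "a / (b * c) = a * cnj b / c / (b * cnj b)" for a b c by (cases "b = 0") auto
  hence "(\<sigma> - \<omega>) / ((\<sigma> - cnj \<omega>) * \<omega>) = (\<sigma> - \<omega>) * cnj (\<sigma> - cnj \<omega>) / \<omega> / of_real D"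
    unfolding D .
  also have "(\<sigma> - \<omega>) * cnj (\<sigma> - cnj \<omega>) / \<omega> = \<sigma> * cnj \<sigma> / \<omega> - (\<sigma> + cnj \<sigma>) + \<omega>"
    using assms by (simp add: field_simps)
  also have "\<sigma> * cnj \<sigma> / \<omega> = of_real (norm \<sigma> ^ 2) * cnj \<omega> / of_real (norm \<omega> ^ 2)"
    unfolding complex_norm_square using assms by (simp add: field_simps)
  finally have "(\<sigma> - \<omega>) / ((\<sigma> - cnj \<omega>) * \<omega>) =
      (of_real (norm \<sigma> ^ 2 / norm \<omega> ^ 2) * cnj \<omega> - (\<sigma> + cnj \<sigma>) + \<omega>) / of_real D" by simp
  hence "Im ((\<sigma> - \<omega>) / ((\<sigma> - cnj \<omega>) * \<omega>)) =
      Im (of_real (norm \<sigma> ^ 2 / norm \<omega> ^ 2) * cnj \<omega> - (\<sigma> + cnj \<sigma>) + \<omega>) / D"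
    by (simp only: Im_divide_of_real)
  also have "Im (of_real (norm \<sigma> ^ 2 / norm \<omega> ^ 2) * cnj \<omega> - (\<sigma> + cnj \<sigma>) + \<omega>) =
      Im \<omega> * (1 - norm \<sigma> ^ 2 / norm \<omega> ^ 2)" by (simp add: algebra_simps)
  finally show ?thesis by (simp add: D_def)
qed

text \<open>At level 5 and 7 the arcs meet in an elliptic point \<open>\<zeta>\<close> at the angle \<open>\<pi>/n\<close>; the function
  \<open>v\<close> maps them to the rays of argument \<open>0\<close> and \<open>\<pi>/n\<close>. The weight \<open>-2\<close> factor \<open>X\<close> is a multiple of
  \<open>1 / (v^n)'\<close> and hence normal to both arcs.\<close>

locale fricke_corner = fricke_form +
  fixes \<zeta> :: complex and n :: nat
  assumes p57: "p \<in> {5, 7}"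
    and \<zeta>_Im: "Im \<zeta> > 0" and n_pos: "n > 0"
    and \<zeta>_norm: "\<zeta> * cnj \<zeta> = of_real P" and \<omega>_norm: "(\<zeta> + 1 / 2) * cnj (\<zeta> + 1 / 2) = of_real (P / 4)"
    and angle: "\<zeta> * cis (pi / n) = - 2 * (\<zeta> + 1 / 2)"
    and sector: "\<And>v. Im v > 0 \<Longrightarrow> Im (v * cnj (cis (pi / n))) < 0 \<Longrightarrow> Im (v ^ n) > 0"
    and direction: "Im ((- \<zeta>) ^ n) < 0"
    and sides_pos: "\<And>\<tau>. Im \<tau> > 0 \<Longrightarrow> Re \<tau> = - 1 / 2 \<or> Re \<tau> = 0 \<Longrightarrow>
        Im ((- \<zeta>) ^ n * (\<tau> - cnj \<zeta>) ^ (n + 1) * cnj (\<tau> - \<zeta>) ^ (n - 1)) > 0"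
begin

text \<open>The Cayley transform centred at \<open>\<zeta>\<close>, rotated by
  \<open>- 1 / \<zeta>\<close> so that the arc around \<open>0\<close> to the right of
  \<open>\<zeta>\<close> falls on the positive real axis.\<close>

definition v where "v \<tau> = - (\<tau> - \<zeta>) / (\<zeta> * (\<tau> - cnj \<zeta>))"
text \<open>Equal to \<open>2 * \<i> * n * Im \<zeta> / (v^n)'\<close>, with a pole of order
  \<open>n - 1\<close> at \<open>\<zeta>\<close>.\<close>

definition X where "X \<tau> = (\<tau> - \<zeta>) * (\<tau> - cnj \<zeta>) / v \<tau> ^ n"

lemma \<zeta>_nz: "\<zeta> \<noteq> 0" "\<zeta> + 1 / 2 \<noteq> 0"
  using \<zeta>_Im by (auto simp: complex_eq_iff)

lemma cnj_nz: "Im \<tau> > 0 \<Longrightarrow> \<tau> - cnj \<zeta> \<noteq> 0"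
  using \<zeta>_Im by (auto simp: complex_eq_iff)

lemma sqdist_complex:
  "of_real (sqdist 0 \<tau>) = \<tau> * cnj \<tau>"
  "of_real (sqdist (- 1 / 2) \<tau>) = (\<tau> + 1 / 2) * cnj (\<tau> + 1 / 2)"
  by (auto simp: complex_eq_iff sqdist_def power2_eq_square algebra_simps)

lemma \<zeta>_sqdist: "sqdist 0 \<zeta> = P" "sqdist (- 1 / 2) \<zeta> = P / 4"
proof -
  have "complex_of_real (sqdist 0 \<zeta>) = of_real P" unfolding sqdist_complex(1) by (rule \<zeta>_norm)
  thus "sqdist 0 \<zeta> = P" by (simp only: of_real_eq_iff)
  have "complex_of_real (sqdist (- 1 / 2) \<zeta>) = of_real (P / 4)" unfolding sqdist_complex(2) by (rule \<omega>_norm)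
  thus "sqdist (- 1 / 2) \<zeta> = P / 4" by (simp only: of_real_eq_iff)
qed

lemma Re_\<zeta>: "Re \<zeta> = - 1 / 4 - 3 / 4 * P"
  using \<zeta>_sqdist sqdist_half(1)[of \<zeta>] by simp

lemma v_nz: "Im \<tau> > 0 \<Longrightarrow> \<tau> \<noteq> \<zeta> \<Longrightarrow> v \<tau> \<noteq> 0"
  using cnj_nz[of \<tau>] \<zeta>_nz by (simp add: v_def)

lemma v_altdef: "v \<tau> = - ((\<tau> - \<zeta>) / (\<tau> - cnj \<zeta>)) / \<zeta>" "v \<tau> = - ((\<tau> - \<zeta>) / ((\<tau> - cnj \<zeta>) * \<zeta>))"
proof -
  have "- a / (z * c) = - (a / c) / z \<and> - a / (z * c) = - (a / (c * z))" for a c z :: complex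
    by (simp add: mult.commute)
  thus "v \<tau> = - ((\<tau> - \<zeta>) / (\<tau> - cnj \<zeta>)) / \<zeta>" "v \<tau> = - ((\<tau> - \<zeta>) / ((\<tau> - cnj \<zeta>) * \<zeta>))"
    unfolding v_def by blast+
qed

lemma v_circle1:
  assumes "sqdist 0 \<tau> = P"
  shows "v \<tau> = of_real (2 * (Re \<tau> - Re \<zeta>) / norm (\<tau> - cnj \<zeta>) ^ 2)"
    "(\<tau> - \<zeta>) * (\<tau> - cnj \<zeta>) = of_real (2 * (Re \<tau> - Re \<zeta>)) * \<tau>"
proof -
  have *: "\<tau> * cnj \<tau> = \<zeta> * cnj \<zeta>" using sqdist_complex(1)[of \<tau>] assms \<zeta>_norm by simp
  have "v \<tau> = - ((\<tau> - \<zeta>) / (\<tau> - cnj \<zeta>)) / \<zeta>" by (rule v_altdef(1))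
  also have "\<dots> = of_real (2 * (Re \<tau> - Re \<zeta>) / norm (\<tau> - cnj \<zeta>) ^ 2)"
  proof -
    have key: "- (of_real (- A / D) * z) / z = of_real (A / D)" if "z \<noteq> 0" for A D :: real and z :: complex
      using that by simp
    show ?thesis unfolding geodesic_identities(2)[OF *] by (rule key[OF \<zeta>_nz(1)])
  qed
  finally show "v \<tau> = of_real (2 * (Re \<tau> - Re \<zeta>) / norm (\<tau> - cnj \<zeta>) ^ 2)" .
  show "(\<tau> - \<zeta>) * (\<tau> - cnj \<zeta>) = of_real (2 * (Re \<tau> - Re \<zeta>)) * \<tau>"
    by (rule geodesic_identities(1)[OF *])
qed

lemma v_circle2:
  assumes "sqdist (- 1 / 2) \<tau> = P / 4"
  shows "v \<tau> = of_real ((Re \<zeta> - Re \<tau>) / norm (\<tau> - cnj \<zeta>) ^ 2) * cis (pi / n)"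
    "(\<tau> - \<zeta>) * (\<tau> - cnj \<zeta>) = of_real (2 * (Re \<tau> - Re \<zeta>)) * (\<tau> + 1 / 2)"
proof -
  define \<omega> \<sigma> where "\<omega> = \<zeta> + 1 / 2" and "\<sigma> = \<tau> + 1 / 2"
  have *: "\<sigma> * cnj \<sigma> = \<omega> * cnj \<omega>"
  proof -
    have "\<sigma> * cnj \<sigma> = of_real (P / 4)" unfolding \<sigma>_def sqdist_complex(2)[symmetric] assms ..
    moreover have "\<omega> * cnj \<omega> = of_real (P / 4)" unfolding \<omega>_def by (rule \<omega>_norm)
    ultimately show ?thesis by (simp only:)
  qed
  have d: "\<tau> - \<zeta> = \<sigma> - \<omega>" "\<tau> - cnj \<zeta> = \<sigma> - cnj \<omega>" "Re \<tau> - Re \<zeta> = Re \<sigma> - Re \<omega>" "Re \<zeta> - Re \<tau> = - (Re \<sigma> - Re \<omega>)"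
    by (simp_all add: \<omega>_def \<sigma>_def)
  have "\<omega> = - (\<zeta> * cis (pi / n)) / 2" unfolding angle by (simp add: \<omega>_def)
  hence \<omega>: "\<omega> / \<zeta> = - cis (pi / n) / 2" using \<zeta>_nz by simp
  have "v \<tau> = - ((\<sigma> - \<omega>) / (\<sigma> - cnj \<omega>)) / \<zeta>" unfolding v_altdef(1) d ..
  also have "\<dots> = of_real (2 * (Re \<sigma> - Re \<omega>) / norm (\<sigma> - cnj \<omega>) ^ 2) * (\<omega> / \<zeta>)"
  proof -
    have "- (of_real (- A / D) * w) / z = of_real (A / D) * (w / z)" for A D :: real and w z :: complex
      by simp
    thus ?thesis unfolding geodesic_identities(2)[OF *] .
  qed
  also have "\<dots> = of_real (- (Re \<sigma> - Re \<omega>) / norm (\<sigma> - cnj \<omega>) ^ 2) * cis (pi / n)"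
  proof -
    have "of_real (2 * A / D) * (- c / 2) = of_real (- A / D) * c" for A D :: real and c :: complex
      by simp
    thus ?thesis unfolding \<omega> .
  qed
  finally show "v \<tau> = of_real ((Re \<zeta> - Re \<tau>) / norm (\<tau> - cnj \<zeta>) ^ 2) * cis (pi / n)"
    unfolding d .
  show "(\<tau> - \<zeta>) * (\<tau> - cnj \<zeta>) = of_real (2 * (Re \<tau> - Re \<zeta>)) * (\<tau> + 1 / 2)"
    unfolding d geodesic_identities(1)[OF *] by (simp add: \<sigma>_def)
qed

lemma cis_n: "cis (pi / n) ^ n = - 1"
  using n_pos by (simp add: Complex.DeMoivre)

lemma X_circle1:
  assumes "Im \<tau> > 0" "sqdist 0 \<tau> = P"
  shows "X \<tau> / \<tau> = of_real (2 * (Re \<tau> - Re \<zeta>) / (2 * (Re \<tau> - Re \<zeta>) / norm (\<tau> - cnj \<zeta>) ^ 2) ^ n)"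
proof -
  have "\<tau> \<noteq> 0" using assms by auto
  thus ?thesis unfolding X_def v_circle1[OF assms(2)] by simp
qed

text \<open>The factor \<open>cis (pi / n) ^ n = - 1\<close> makes up for
  \<open>Re \<tau> - Re \<zeta>\<close> being negative on the arc left of the corner.\<close>

lemma X_circle2:
  assumes "Im \<tau> > 0" "sqdist (- 1 / 2) \<tau> = P / 4"
  shows "X \<tau> / (\<tau> + 1 / 2) = of_real (2 * (Re \<zeta> - Re \<tau>) / ((Re \<zeta> - Re \<tau>) / norm (\<tau> - cnj \<zeta>) ^ 2) ^ n)"
proof -
  have nz: "\<tau> + 1 / 2 \<noteq> 0" using assms by (auto simp: complex_eq_iff)
  have key: "of_real (- A) * s / (of_real B ^ n * - 1) / s = of_real (A / B ^ n)" if "s \<noteq> 0" for A B :: real and s :: complex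
    using that by simp
  have eq: "2 * (Re \<tau> - Re \<zeta>) = - (2 * (Re \<zeta> - Re \<tau>))" by simp
  show ?thesis unfolding X_def v_circle2[OF assms(2)] power_mult_distrib cis_n eq
    by (rule key[OF nz])
qed

text \<open>Lying outside one of the circles is a half-plane condition on \<open>v\<close>. Together
  they give a sector of opening \<open>pi / n\<close>, which the n-th power takes into the upper
  half-plane.\<close>

lemma sector_\<Omega>:
  assumes "\<tau> \<in> \<Omega>"
  shows "Im (v \<tau> ^ n) > 0"
proof (rule sector)
  have \<tau>: "Im \<tau> > 0" "P < sqdist 0 \<tau>" "P / 4 < sqdist (- 1 / 2) \<tau>" using assms by (auto simp: \<Omega>_def)
  have D: "norm (\<tau> - cnj \<zeta>) ^ 2 > 0" using cnj_nz[OF \<tau>(1)] by simp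
  have n1: "norm \<zeta> ^ 2 = P" "norm (\<zeta> + 1 / 2) ^ 2 = P / 4"
    using \<zeta>_sqdist by (simp_all add: sqdist_altdef)
  have n2: "norm \<tau> ^ 2 > P" "norm (\<tau> + 1 / 2) ^ 2 > P / 4"
    using \<tau> by (simp_all add: sqdist_altdef)
  have "Im (v \<tau>) = - Im ((\<tau> - \<zeta>) / ((\<tau> - cnj \<zeta>) * \<zeta>))" unfolding v_altdef(2) by (rule uminus_complex.sel)
  also have "\<dots> = Im \<zeta> * (norm \<tau> ^ 2 / P - 1) / norm (\<tau> - cnj \<zeta>) ^ 2"
  proof -
    have "- (a * (1 - x) / d) = a * (x - 1) / d" for a x d :: real
      by (cases "d = 0") (auto simp: field_simps)
    thus ?thesis unfolding Im_quotient_geodesic[OF \<zeta>_nz(1)] n1 .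
  qed
  also have "\<dots> > 0" using n2 P_bounds \<zeta>_Im D by (intro divide_pos_pos mult_pos_pos) (auto simp: field_simps)
  finally show "Im (v \<tau>) > 0" .
  define \<omega> \<sigma> where "\<omega> = \<zeta> + 1 / 2" and "\<sigma> = \<tau> + 1 / 2"
  have \<omega>: "\<omega> \<noteq> 0" "Im \<omega> > 0" using \<zeta>_nz \<zeta>_Im by (auto simp: \<omega>_def)
  have d: "\<tau> - \<zeta> = \<sigma> - \<omega>" "\<tau> - cnj \<zeta> = \<sigma> - cnj \<omega>"
    by (simp_all add: \<omega>_def \<sigma>_def)
  have "cis (pi / n) * cnj (cis (pi / n)) = 1" by (simp add: cis_cnj cis_mult)
  hence "\<zeta> = (\<zeta> * cis (pi / n)) * cnj (cis (pi / n))" by (simp add: mult.assoc)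
  hence "\<zeta> = - 2 * \<omega> * cnj (cis (pi / n))" unfolding angle \<omega>_def .
  moreover have "cnj (cis (pi / n)) \<noteq> 0" by simp
  moreover have "- a / ((- 2 * w * c) * b) * c = a / (b * w) / of_real 2" if "c \<noteq> 0" for a b c w :: complex
    using that by (cases "w = 0"; cases "b = 0") auto
  ultimately have "v \<tau> * cnj (cis (pi / n)) = (\<sigma> - \<omega>) / ((\<sigma> - cnj \<omega>) * \<omega>) / of_real 2"
    unfolding v_def d by metis
  hence "Im (v \<tau> * cnj (cis (pi / n))) = Im ((\<sigma> - \<omega>) / ((\<sigma> - cnj \<omega>) * \<omega>)) / 2"
    by (simp only: Im_divide_of_real)
  also have "\<dots> = - (Im \<omega> * (norm \<sigma> ^ 2 / (P / 4) - 1) / norm (\<sigma> - cnj \<omega>) ^ 2) / 2"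
  proof -
    have "a * (1 - x) / d = - (a * (x - 1) / d)" for a x d :: real
      by (cases "d = 0") (auto simp: field_simps)
    thus ?thesis unfolding Im_quotient_geodesic[OF \<omega>(1)] n1(2)[folded \<omega>_def] by simp
  qed
  also have "\<dots> < 0"
  proof -
    have "Im \<omega> * (norm \<sigma> ^ 2 / (P / 4) - 1) / norm (\<sigma> - cnj \<omega>) ^ 2 > 0"
      using n2(2)[folded \<sigma>_def] P_bounds \<omega> D[unfolded d]
      by (intro divide_pos_pos mult_pos_pos) (auto simp: field_simps)
    moreover have "- E / 2 < 0" if "E > 0" for E :: real using that by simp
    ultimately show ?thesis by blast
  qed
  finally show "Im (v \<tau> * cnj (cis (pi / n))) < 0" .
qed

text \<open>With a positive real denominator, the sign of \<open>Im X\<close> on the sides becomes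
  that of the polynomial in \<open>sides_pos\<close>.\<close>

lemma X_altdef:
  assumes "Im \<tau> > 0" "\<tau> \<noteq> \<zeta>"
  shows "X \<tau> = (- \<zeta>) ^ n * (\<tau> - cnj \<zeta>) ^ (n + 1) * cnj (\<tau> - \<zeta>) ^ (n - 1) / of_real ((norm (\<tau> - \<zeta>) ^ 2) ^ (n - 1))"
proof -
  obtain k where k: "n = Suc k" using n_pos by (cases n) auto
  define a b where "a = \<tau> - \<zeta>" and "b = \<tau> - cnj \<zeta>"
  have ab: "a \<noteq> 0" "b \<noteq> 0" using assms cnj_nz by (auto simp: a_def b_def)
  have v: "v \<tau> = a / (- \<zeta> * b)" using \<zeta>_nz ab by (simp add: v_def a_def b_def field_simps)
  have "a * b / (a / c) ^ n = a * b * c ^ n / a ^ n" for c by (simp add: power_divide)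
  hence "X \<tau> = a * b * (- \<zeta> * b) ^ n / a ^ n"
    unfolding X_def v a_def[symmetric] b_def[symmetric] .
  also have "\<dots> = (- \<zeta>) ^ n * b ^ (n + 1) / a ^ k"
  proof -
    have "a * b * (z * b) ^ n / a ^ n = z ^ n * b ^ (n + 1) / a ^ k" for z
      using ab by (simp add: k power_mult_distrib)
    thus ?thesis by blast
  qed
  also have "\<dots> = (- \<zeta>) ^ n * b ^ (n + 1) * cnj a ^ k / (a * cnj a) ^ k"
  proof -
    have key: "x / a ^ k = x * c ^ k / (a * c) ^ k" if "c \<noteq> 0" for x c
      using that ab by (simp add: power_mult_distrib)
    show ?thesis by (rule key) (use ab in simp)
  qed
  also have "a * cnj a = of_real (norm a ^ 2)" by (simp only: complex_norm_square)
  finally show ?thesis by (simp add: a_def b_def k)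
qed

lemma X_sides:
  assumes "z \<in> region" "Re z = - 1 / 2 \<or> Re z = 0"
  shows "Im (X z) > 0"
proof -
  have z: "Im z > 0" using assms by (simp add: region_def)
  have "z \<noteq> \<zeta>" using \<zeta>_sqdist assms(1) by (auto simp: region_def)
  hence "(norm (z - \<zeta>) ^ 2) ^ (n - 1) > 0" by simp
  moreover have "Im (X z) = Im ((- \<zeta>) ^ n * (z - cnj \<zeta>) ^ (n + 1) * cnj (z - \<zeta>) ^ (n - 1)) / (norm (z - \<zeta>) ^ 2) ^ (n - 1)"
    unfolding X_altdef[OF z \<open>z \<noteq> \<zeta>\<close>] by (rule Im_divide_of_real)
  ultimately show ?thesis using sides_pos[OF z assms(2)] by (simp only: divide_pos_pos)
qed

text \<open>\<open>X / (Im \<tau>)^2\<close> tends to \<open>- ((- \<zeta>) ^ n)\<close> as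
  \<open>Im \<tau>\<close> grows within the strip, the limit filter being \<open>F\<close>;
  \<open>direction\<close> makes its imaginary part positive.\<close>

lemma X_infinity:
  "\<exists>Y K. \<forall>\<tau>. Im \<tau> \<ge> Y \<longrightarrow> - 1 / 2 \<le> Re \<tau> \<longrightarrow> Re \<tau> \<le> 0 \<longrightarrow>
        Im (X \<tau>) \<ge> 0 \<and> norm (X \<tau>) \<le> K * (Im \<tau>) ^ 2"
proof -
  define F where "F = inf (filtercomap Im at_top) (principal {\<tau>. - 1 / 2 \<le> Re \<tau> \<and> Re \<tau> \<le> 0})"
  have Im: "filterlim Im at_top F"
    unfolding F_def by (rule filterlim_mono[OF filterlim_filtercomap order_refl inf_le1])
  have strip: "eventually (\<lambda>\<tau>. - 1 / 2 \<le> Re \<tau> \<and> Re \<tau> \<le> 0) F"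
    unfolding F_def by (rule filter_leD[OF inf_le2]) (simp add: eventually_principal)
  have pos: "eventually (\<lambda>\<tau>. Im \<tau> > 0) F" using Im by (simp add: filterlim_at_top_dense)
  have lim: "((\<lambda>\<tau>. (\<tau> - c) / of_real (Im \<tau>)) \<longlongrightarrow> \<i>) F" for c
  proof -
    have "((\<lambda>\<tau>. (1 + norm c) / Im \<tau>) \<longlongrightarrow> 0) F"
      by (rule tendsto_divide_0[OF tendsto_const filterlim_at_top_imp_at_infinity[OF Im]])
    moreover have "eventually (\<lambda>\<tau>. norm ((of_real (Re \<tau>) - c) / of_real (Im \<tau>)) \<le> (1 + norm c) / Im \<tau>) F"
      using strip pos
    proof eventually_elim
      case (elim \<tau>)
      have "norm (of_real (Re \<tau>) - c) \<le> 1 + norm c"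
        using norm_triangle_ineq4[of "of_real (Re \<tau>)" c] elim by simp
      thus ?case using elim by (simp add: norm_divide divide_right_mono)
    qed
    ultimately have "((\<lambda>\<tau>. (of_real (Re \<tau>) - c) / of_real (Im \<tau>)) \<longlongrightarrow> 0) F"
      by (rule Lim_null_comparison[rotated])
    hence "((\<lambda>\<tau>. \<i> + (of_real (Re \<tau>) - c) / of_real (Im \<tau>)) \<longlongrightarrow> \<i> + 0) F"
      by (intro tendsto_intros)
    moreover have "eventually (\<lambda>\<tau>. \<i> + (of_real (Re \<tau>) - c) / of_real (Im \<tau>) = (\<tau> - c) / of_real (Im \<tau>)) F"
      using pos
    proof eventually_elim
      case (elim \<tau>)
      have eq: "\<tau> - c = \<i> * of_real (Im \<tau>) + (of_real (Re \<tau>) - c)" by (simp add: complex_eq_iff)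
      show ?case unfolding eq add_divide_distrib using elim by simp
    qed
    ultimately show ?thesis by (simp add: Lim_transform_eventually)
  qed
  define L where "L = \<i> * \<i> / (- \<i> / (\<zeta> * \<i>)) ^ n"
  have L: "L = - ((- \<zeta>) ^ n)"
    using \<zeta>_nz by (simp add: L_def power_divide field_simps flip: power_mult_distrib)
  have "((\<lambda>\<tau>. ((\<tau> - \<zeta>) / of_real (Im \<tau>)) * ((\<tau> - cnj \<zeta>) / of_real (Im \<tau>)) /
          (- ((\<tau> - \<zeta>) / of_real (Im \<tau>)) / (\<zeta> * ((\<tau> - cnj \<zeta>) / of_real (Im \<tau>)))) ^ n) \<longlongrightarrow> L) F"
    unfolding L_def using \<zeta>_nz by (intro tendsto_intros lim) auto
  moreover have "eventually (\<lambda>\<tau>. ((\<tau> - \<zeta>) / of_real (Im \<tau>)) * ((\<tau> - cnj \<zeta>) / of_real (Im \<tau>)) /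
          (- ((\<tau> - \<zeta>) / of_real (Im \<tau>)) / (\<zeta> * ((\<tau> - cnj \<zeta>) / of_real (Im \<tau>)))) ^ n = X \<tau> / of_real ((Im \<tau>) ^ 2)) F"
    using pos
  proof eventually_elim
    case (elim \<tau>)
    hence "- ((\<tau> - \<zeta>) / of_real (Im \<tau>)) / (\<zeta> * ((\<tau> - cnj \<zeta>) / of_real (Im \<tau>))) = v \<tau>"
      using cnj_nz[of \<tau>] \<zeta>_nz by (simp add: v_def)
    thus ?case by (simp only: X_def) (simp add: power2_eq_square)
  qed
  ultimately have X: "((\<lambda>\<tau>. X \<tau> / of_real ((Im \<tau>) ^ 2)) \<longlongrightarrow> L) F"
    by (rule Lim_transform_eventually)
  have "Im L > 0" using direction by (simp add: L)
  hence 1: "eventually (\<lambda>\<tau>. Im (X \<tau> / of_real ((Im \<tau>) ^ 2)) > 0) F"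
    by (rule order_tendstoD(1)[OF tendsto_Im[OF X]])
  have 2: "eventually (\<lambda>\<tau>. norm (X \<tau> / of_real ((Im \<tau>) ^ 2)) < norm L + 1) F"
    by (rule order_tendstoD(2)[OF tendsto_norm[OF X]]) simp
  have "eventually (\<lambda>\<tau>. Im (X \<tau>) \<ge> 0 \<and> norm (X \<tau>) \<le> (norm L + 1) * (Im \<tau>) ^ 2) F"
    using 1 2 pos
  proof eventually_elim
    case (elim \<tau>)
    hence "norm (X \<tau>) / (Im \<tau>) ^ 2 < norm L + 1" by (simp add: norm_divide norm_power)
    moreover have "Im (X \<tau>) / (Im \<tau>) ^ 2 > 0" using elim by (simp only: Im_divide_of_real)
    ultimately show ?case using elim by (simp add: zero_less_divide_iff divide_less_eq)
  qed
  then obtain Y where "\<And>\<tau>. Im \<tau> \<ge> Y \<Longrightarrow> - 1 / 2 \<le> Re \<tau> \<and> Re \<tau> \<le> 0 \<Longrightarrow>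
      Im (X \<tau>) \<ge> 0 \<and> norm (X \<tau>) \<le> (norm L + 1) * (Im \<tau>) ^ 2"
    unfolding F_def eventually_inf_principal eventually_filtercomap eventually_at_top_linorder by auto
  thus ?thesis by blast
qed

lemma \<zeta>_not_\<Omega>: "\<zeta> \<notin> region" "\<zeta> \<notin> \<Omega>"
  using \<zeta>_sqdist by (auto simp: region_def \<Omega>_def)

section \<open>The corner in the coordinate \<open>v\<close>\<close>

text \<open>The inverse Moebius map of \<open>v\<close>.\<close>

definition T where "T w = \<zeta> * (1 + cnj \<zeta> * w) / (1 + \<zeta> * w)"

lemma T_v: "Im \<tau> > 0 \<Longrightarrow> T (v \<tau>) = \<tau>"
proof -
  assume \<tau>: "Im \<tau> > 0"
  define b where "b = \<tau> - cnj \<zeta>"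
  have b: "b \<noteq> 0" using cnj_nz[OF \<tau>] by (simp add: b_def)
  have d: "\<zeta> - cnj \<zeta> \<noteq> 0" using \<zeta>_Im by (auto simp: complex_eq_iff)
  have gen: "1 + z * (- (b - d) / (z * b)) = d / b" "z * (1 + k * (- (b - d) / (z * b))) = (b + k) * d / b"
    if "z \<noteq> 0" "z = d + k" for z d k
  proof -
    show "1 + z * (- (b - d) / (z * b)) = d / b" using b that(1) by (simp add: field_simps)
    have "z * (1 + k * (- (b - d) / (z * b))) = z - k * (b - d) / b" using b that(1) by (simp add: field_simps)
    also have "\<dots> = (b + k) * d / b" unfolding that(2) using b by (simp add: field_simps)
    finally show "z * (1 + k * (- (b - d) / (z * b))) = (b + k) * d / b" .
  qed
  have v: "v \<tau> = - (b - (\<zeta> - cnj \<zeta>)) / (\<zeta> * b)" unfolding v_def b_def by simp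
  have 1: "1 + \<zeta> * v \<tau> = (\<zeta> - cnj \<zeta>) / b"
    unfolding v by (rule gen(1)[of _ _ "cnj \<zeta>", OF \<zeta>_nz(1)]) simp
  have "\<zeta> * (1 + cnj \<zeta> * v \<tau>) = (b + cnj \<zeta>) * (\<zeta> - cnj \<zeta>) / b"
    unfolding v by (rule gen(2)[OF \<zeta>_nz(1)]) simp
  hence 2: "\<zeta> * (1 + cnj \<zeta> * v \<tau>) = \<tau> * (\<zeta> - cnj \<zeta>) / b" by (simp add: b_def)
  show ?thesis unfolding T_def 1 2 using b d by simp
qed

text \<open>For real \<open>t\<close> the factors \<open>1 + cnj \<zeta> * t\<close> and
  \<open>1 + \<zeta> * t\<close> are conjugate, so they cancel in the modulus.\<close>

lemma T_circle1:
  assumes "1 + \<zeta> * of_real t \<noteq> 0"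
  shows "sqdist 0 (T (of_real t)) = P"
proof -
  have "cnj (1 + \<zeta> * of_real t) \<noteq> 0" using assms by (simp only: complex_cnj_zero_iff not_False_eq_True)
  hence nz: "1 + cnj \<zeta> * of_real t \<noteq> 0" by simp
  have "complex_of_real (sqdist 0 (T (of_real t))) = \<zeta> * cnj \<zeta>"
    unfolding sqdist_complex(1) T_def using assms nz by simp
  thus ?thesis by (simp only: \<zeta>_norm of_real_eq_iff)
qed

text \<open>By \<open>angle\<close>, on this ray \<open>T + 1/2\<close> is
  \<open>\<omega> = \<zeta> + 1/2\<close> times a quotient of conjugate numbers.\<close>

lemma T_circle2:
  assumes "1 + \<zeta> * (of_real t * cis (pi / n)) \<noteq> 0"
  shows "sqdist (- 1 / 2) (T (of_real t * cis (pi / n))) = P / 4"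
proof -
  define \<omega> where "\<omega> = \<zeta> + 1 / 2"
  define c where "c = cis (pi / n)"
  have c: "\<zeta> * c = - 2 * \<omega>" unfolding c_def \<omega>_def by (rule angle)
  have "\<zeta> * (of_real t * c) = \<zeta> * c * of_real t" by (simp only: mult_ac)
  hence z: "\<zeta> * (of_real t * c) = - 2 * \<omega> * of_real t" by (simp only: c)
  have nz1: "1 - 2 * \<omega> * of_real t \<noteq> 0" using assms unfolding c_def[symmetric] z by simp
  hence "cnj (1 - 2 * \<omega> * of_real t) \<noteq> 0" by (simp only: complex_cnj_zero_iff not_False_eq_True)
  hence nz2: "1 - 2 * cnj \<omega> * of_real t \<noteq> 0" by simp
  have "T (of_real t * c) + 1 / 2 = (\<zeta> + cnj \<zeta> * (\<zeta> * c) * of_real t) / (1 - 2 * \<omega> * of_real t) + 1 / 2"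
    unfolding T_def z by (simp add: algebra_simps)
  also have "\<dots> = \<omega> * (1 - 2 * cnj \<omega> * of_real t) / (1 - 2 * \<omega> * of_real t)"
    unfolding c using nz1 by (simp add: field_simps) (simp add: \<omega>_def algebra_simps)
  finally have "complex_of_real (sqdist (- 1 / 2) (T (of_real t * c))) = \<omega> * cnj \<omega>"
    unfolding sqdist_complex(2) using nz1 nz2 by simp
  also have "\<dots> = of_real (P / 4)" unfolding \<omega>_def by (rule \<omega>_norm)
  finally show ?thesis unfolding of_real_eq_iff c_def .
qed

text \<open>\<open>Q = (\<tau> - \<zeta>) (\<tau> - cnj \<zeta>) h\<close> is holomorphic in
  \<open>v\<close>, as the simple pole cancels, it is real on both rays, and
  \<open>X h = Q / v^n\<close>. Its value \<open>Q 0 = Im \<zeta> * m / pi\<close> is nonnegative,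
  so \<open>Q 0 / v^n\<close> has nonpositive imaginary part in the sector; the remainder is small
  by \<open>corner_expansion\<close>.\<close>

lemma corner_boundary:
  assumes "\<epsilon> > 0"
  shows "\<exists>d>0. \<forall>w\<in>\<Omega>. dist w \<zeta> < d \<longrightarrow> Im (X w * h w) < \<epsilon>"
proof -
  obtain m e b where m: "0 \<le> m" "0 < e" "b holomorphic_on ball \<zeta> e"
    "\<And>\<tau>. \<tau> \<in> ball \<zeta> e \<Longrightarrow> Im \<tau> > 0"
    "\<And>\<tau>. \<tau> \<in> ball \<zeta> e \<Longrightarrow> \<tau> \<noteq> \<zeta> \<Longrightarrow> \<tau> \<notin> N"
    "\<And>\<tau>. \<tau> \<in> ball \<zeta> e \<Longrightarrow> \<tau> \<noteq> \<zeta> \<Longrightarrow> h \<tau> = of_real m / (2 * of_real pi * \<i> * (\<tau> - \<zeta>)) + b \<tau>"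
    using local_form[OF \<zeta>_Im] by metis
  have T0: "T 0 = \<zeta>" by (simp add: T_def)
  have "isCont T 0" unfolding T_def by (intro continuous_intros) auto
  then obtain d0 where d0: "d0 > 0" "\<And>w. dist w 0 < d0 \<Longrightarrow> dist (T w) \<zeta> < e"
    using m(2) T0 unfolding continuous_at_eps_delta by metis
  \<comment> \<open>The bound \<open>1/2\<close> keeps \<open>1 + \<zeta> * w\<close> away from 0,
    since \<open>norm \<zeta> <= 1\<close>.\<close>
  define e1 where "e1 = min d0 (1 / 2)"
  have e1: "e1 > 0" using d0(1) by (simp add: e1_def)
  have norm\<zeta>: "norm \<zeta> \<le> 1"
  proof -
    have "norm \<zeta> ^ 2 \<le> 1 ^ 2" using \<zeta>_sqdist(1) P_bounds by (simp add: sqdist_altdef)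
    thus ?thesis by (rule power2_le_imp_le) simp
  qed
  have den: "1 + \<zeta> * w \<noteq> 0" if "w \<in> ball 0 e1" for w
  proof
    assume "1 + \<zeta> * w = 0"
    hence "\<zeta> * w = - 1" by (simp add: eq_neg_iff_add_eq_0 add.commute)
    hence "norm \<zeta> * norm w = 1" by (metis norm_minus_cancel norm_mult norm_one)
    moreover have "norm \<zeta> * norm w \<le> 1 * (1 / 2)"
      using that norm\<zeta> by (intro mult_mono) (auto simp: e1_def)
    ultimately show False by simp
  qed
  have T_ball: "T w \<in> ball \<zeta> e" if "w \<in> ball 0 e1" for w
    using d0(2)[of w] that by (simp add: e1_def dist_commute)
  have T_ne: "T w \<noteq> \<zeta>" if "w \<in> ball 0 e1" "w \<noteq> 0" for w
  proof
    assume "T w = \<zeta>"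
    hence "\<zeta> * (1 + cnj \<zeta> * w) = \<zeta> * (1 + \<zeta> * w)" using den[OF that(1)] by (simp add: T_def field_simps)
    hence "cnj \<zeta> = \<zeta>" using \<zeta>_nz(1) that(2) by simp
    thus False using \<zeta>_Im by (simp add: complex_eq_iff)
  qed
  define Q where "Q = (\<lambda>w. (T w - cnj \<zeta>) * (of_real m / (2 * of_real pi * \<i>) + (T w - \<zeta>) * b (T w)))"
  have T_hol: "T holomorphic_on ball 0 e1"
    unfolding T_def using den by (intro holomorphic_intros) auto
  have "(\<lambda>w. b (T w)) holomorphic_on ball 0 e1"
  proof -
    have "T ` ball 0 e1 \<subseteq> ball \<zeta> e" using T_ball by blast
    from holomorphic_on_compose_gen[OF T_hol m(3) this] show ?thesis by (simp only: o_def)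
  qed
  hence Q_hol: "Q holomorphic_on ball 0 e1"
    unfolding Q_def by (intro holomorphic_intros T_hol) auto
  have Q: "Q w = (T w - \<zeta>) * (T w - cnj \<zeta>) * h (T w)" if "w \<in> ball 0 e1" "w \<noteq> 0" for w
  proof -
    have "(T w - \<zeta>) * h (T w) = of_real m / (2 * of_real pi * \<i>) + (T w - \<zeta>) * b (T w)"
      using m(6)[OF T_ball[OF that(1)] T_ne[OF that]] T_ne[OF that] by (simp add: field_simps)
    thus ?thesis unfolding Q_def by (metis mult.assoc mult.commute)
  qed
  have TN: "Im (T w) > 0" "T w \<notin> N" if "w \<in> ball 0 e1" "w \<noteq> 0" for w
    using m(4,5) T_ball[OF that(1)] T_ne[OF that] by blast+
  have real1: "Q (of_real t) \<in> \<real>" if t: "0 < t" "t < e1" for t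
  proof -
    have w: "of_real t \<in> ball (0::complex) e1" "of_real t \<noteq> (0::complex)" using t by auto
    have c: "sqdist 0 (T (of_real t)) = P" by (rule T_circle1[OF den[OF w(1)]])
    have "Q (of_real t) = of_real (2 * (Re (T (of_real t)) - Re \<zeta>)) * (T (of_real t) * h (T (of_real t)))"
      unfolding Q[OF w] v_circle1(2)[OF c] by (rule mult.assoc)
    also have "\<dots> \<in> \<real>" by (intro Reals_mult Reals_of_real real_on_circle1 TN w c)
    finally show ?thesis .
  qed
  have real2: "Q (of_real t * cis (pi / n)) \<in> \<real>" if t: "0 < t" "t < e1" for t
  proof -
    define w where "w = of_real t * cis (pi / n)"
    have w: "w \<in> ball (0::complex) e1" "w \<noteq> 0" using t by (auto simp: norm_mult w_def)
    have c: "sqdist (- 1 / 2) (T w) = P / 4"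
      unfolding w_def by (rule T_circle2) (use den[OF w(1)] in \<open>simp only: w_def not_False_eq_True\<close>)
    have "Q w = of_real (2 * (Re (T w) - Re \<zeta>)) * ((T w + 1 / 2) * h (T w))"
      unfolding Q[OF w] v_circle2(2)[OF c] by (rule mult.assoc)
    also have "\<dots> \<in> \<real>" by (intro Reals_mult[OF Reals_of_real] real_on_circle2 TN w c p57)
    finally show ?thesis unfolding w_def .
  qed
  obtain d2 where d2: "d2 > 0" "\<And>w. w \<noteq> 0 \<Longrightarrow> norm w < d2 \<Longrightarrow> \<bar>Im ((Q w - Q 0) / w ^ n)\<bar> < \<epsilon>"
    using corner_expansion[OF Q_hol e1 n_pos real1 real2 assms] by blast
  have "isCont v \<zeta>" unfolding v_def using \<zeta>_nz(1) cnj_nz[OF \<zeta>_Im] by (intro continuous_intros) auto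
  moreover have "v \<zeta> = 0" by (simp add: v_def)
  ultimately obtain d where d: "d > 0" "\<And>w. dist w \<zeta> < d \<Longrightarrow> dist (v w) 0 < min d2 e1"
    using d2(1) e1 unfolding continuous_at_eps_delta by (metis min_less_iff_conj)
  have "\<zeta> - cnj \<zeta> = of_real (2 * Im \<zeta>) * \<i>" by (simp add: complex_eq_iff)
  hence Q0: "Q 0 = of_real (Im \<zeta> * m / pi)" by (simp add: Q_def T0)
  show ?thesis
  proof (intro exI[of _ d] conjI ballI impI d(1))
    fix w assume w: "w \<in> \<Omega>" "dist w \<zeta> < d"
    have Im: "Im w > 0" "w \<noteq> \<zeta>" using w \<zeta>_not_\<Omega> by (auto simp: \<Omega>_def)
    have vw: "v w \<noteq> 0" "norm (v w) < d2" "v w \<in> ball 0 e1"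
      using v_nz[OF Im] d(2)[OF w(2)] by auto
    have "X w * h w = Q (v w) / v w ^ n"
      unfolding Q[OF vw(3,1)] T_v[OF Im(1)] X_def by simp
    also have "\<dots> = Q 0 / v w ^ n + (Q (v w) - Q 0) / v w ^ n" by (simp add: diff_divide_distrib)
    finally have "Im (X w * h w) = Im (Q 0 / v w ^ n) + Im ((Q (v w) - Q 0) / v w ^ n)"
      by (simp only: plus_complex.sel)
    moreover have "Im (Q 0 / v w ^ n) \<le> 0"
    proof -
      define z where "z = v w ^ n"
      have "Im z > 0" unfolding z_def by (rule sector_\<Omega>[OF w(1)])
      moreover have "Im (of_real q / z) = - (q * Im z) / ((Re z) ^ 2 + (Im z) ^ 2)" for q
        by (simp add: Im_divide)
      ultimately have *: "Im (of_real q / z) \<le> 0" if "q \<ge> 0" for q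
        using that by (simp add: divide_nonpos_nonneg)
      show ?thesis
        unfolding Q0 z_def[symmetric] by (rule *) (use m(1) \<zeta>_Im in simp)
    qed
    moreover have "Im ((Q (v w) - Q 0) / v w ^ n) < \<epsilon>" using d2(2)[OF vw(1,2)] by linarith
    ultimately show "Im (X w * h w) < \<epsilon>" by linarith
  qed
qed

lemma h_nonzero_corner:
  assumes "\<exists>\<tau>\<in>\<Omega>. h \<tau> \<noteq> 0" "\<tau> \<in> region"
  shows "h \<tau> \<noteq> 0"
proof (rule h_nonzero_criterion[where X = X and \<zeta> = \<zeta>])
  show "X holomorphic_on {\<tau>. 0 < Im \<tau>} - {\<zeta>}"
    unfolding X_def v_def using \<zeta>_nz(1) cnj_nz by (intro holomorphic_intros) auto
  show "X \<tau> / \<tau> \<in> \<real>" if "Im \<tau> > 0" "\<tau> \<noteq> \<zeta>" "sqdist 0 \<tau> = P" for \<tau>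
    unfolding X_circle1[OF that(1,3)] by (rule Reals_of_real)
  show "X \<tau> / (\<tau> + 1 / 2) \<in> \<real>" if "p \<in> {5, 7}" "Im \<tau> > 0" "\<tau> \<noteq> \<zeta>" "sqdist (- 1 / 2) \<tau> = P / 4" for \<tau>
    unfolding X_circle2[OF that(2,4)] by (rule Reals_of_real)
  show "Re (X \<tau> / \<tau>) \<ge> 0" if "Im \<tau> > 0" "\<tau> \<noteq> \<zeta>" "sqdist 0 \<tau> = P" "P / 4 \<le> sqdist (- 1 / 2) \<tau>" for \<tau>
  proof -
    have "Re \<tau> \<ge> Re \<zeta>" using that Re_\<zeta> sqdist_half(1)[of \<tau>] by simp
    thus ?thesis unfolding X_circle1[OF that(1,3)] Re_complex_of_real
      by (intro divide_nonneg_nonneg zero_le_power mult_nonneg_nonneg) auto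
  qed
  show "Re (X \<tau> / (\<tau> + 1 / 2)) \<ge> 0"
    if "p \<in> {5, 7}" "Im \<tau> > 0" "\<tau> \<noteq> \<zeta>" "sqdist (- 1 / 2) \<tau> = P / 4" "P \<le> sqdist 0 \<tau>" for \<tau>
  proof -
    have "Re \<tau> \<le> Re \<zeta>" using that Re_\<zeta> sqdist_half(1)[of \<tau>] by simp
    thus ?thesis unfolding X_circle2[OF that(2,4)] Re_complex_of_real
      by (intro divide_nonneg_nonneg zero_le_power mult_nonneg_nonneg) auto
  qed
  show "X \<tau> \<noteq> 0" if "\<tau> \<in> \<Omega>" for \<tau>
  proof -
    have "Im \<tau> > 0" "\<tau> \<noteq> \<zeta>" using that \<zeta>_not_\<Omega> by (auto simp: \<Omega>_def)
    thus ?thesis using v_nz[of \<tau>] cnj_nz[of \<tau>] by (simp add: X_def)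
  qed
qed (use assms \<zeta>_not_\<Omega> corner_boundary X_sides X_infinity in blast)+

end

section \<open>The corner data at levels 5 and 7\<close>

lemma (in fricke_form) h_nonzero:
  assumes "\<exists>\<tau>\<in>\<Omega>. h \<tau> \<noteq> 0" "\<tau> \<in> region"
  shows "h \<tau> \<noteq> 0"
proof -
  consider "p \<notin> {5, 7}" | "p = 5" | "p = 7" by blast
  thus ?thesis
  proof cases
    case 1
    thus ?thesis by (rule h_nonzero_small_level[OF _ assms])
  next
    case 2
    have P5: "P = 1 / 5" unfolding P_def using 2 by simp
    \<comment> \<open>The upper intersection of the circles with squared radii \<open>1/5\<close>
      and \<open>1/20\<close>; the arcs meet at a right angle.\<close>
    define z where "z = Complex (- 2 / 5) (1 / 5)"
    have z2: "(- z) ^ 2 = Complex (3 / 25) (- 4 / 25)"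
      by (simp add: z_def power2_eq_square complex_eq_iff)
    interpret fricke_corner p h N z 2
    proof unfold_locales
      show "p \<in> {5, 7}" using 2 by simp
      show "Im z > 0" by (simp add: z_def)
      show "z * cnj z = of_real P" "(z + 1 / 2) * cnj (z + 1 / 2) = of_real (P / 4)"
        by (simp_all add: z_def P5 complex_eq_iff)
      show "z * cis (pi / real 2) = - 2 * (z + 1 / 2)"
        by (simp add: z_def complex_eq_iff)
      show "Im (v ^ 2) > 0" if "Im v > 0" "Im (v * cnj (cis (pi / real 2))) < 0" for v
        using that by (simp add: power2_eq_square)
      show "Im ((- z) ^ 2) < 0" unfolding z2 by simp
      show "Im ((- z) ^ 2 * (\<tau> - cnj z) ^ (2 + 1) * cnj (\<tau> - z) ^ (2 - 1)) > 0"
        if "Im \<tau> > 0" "Re \<tau> = - 1 / 2 \<or> Re \<tau> = 0" for \<tau>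
      proof -
        \<comment> \<open>Clears the denominators; on either side the quantity becomes a polynomial
          in \<open>y\<close> with positive coefficients.\<close>
        define y where "y = 5 * Im \<tau>"
        have y: "y > 0" "Im \<tau> = y / 5" using that by (auto simp: y_def)
        have "Im ((- z) ^ 2 * (\<tau> - cnj z) ^ (2 + 1) * cnj (\<tau> - z) ^ (2 - 1)) =
            (if Re \<tau> = 0 then 100 + 100 * y + 20 * y ^ 3 + 4 * y ^ 4 else 25 / 4 + 25 / 4 * y + 5 * y ^ 3 + 4 * y ^ 4) / 15625"
          using that(2)
        proof
          assume "Re \<tau> = - 1 / 2"
          hence \<tau>: "\<tau> = Complex (- 1 / 2) (y / 5)" using y by (simp add: complex_eq_iff)
          show ?thesis unfolding z2 \<tau> by (simp add: z_def eval_nat_numeral field_simps)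
        next
          assume "Re \<tau> = 0"
          hence \<tau>: "\<tau> = Complex 0 (y / 5)" using y by (simp add: complex_eq_iff)
          show ?thesis unfolding z2 \<tau> by (simp add: z_def eval_nat_numeral field_simps)
        qed
        also have "\<dots> > 0" using y(1) by (auto intro!: divide_pos_pos add_pos_pos mult_pos_pos)
        finally show ?thesis .
      qed
    qed auto
    show ?thesis by (rule h_nonzero_corner[OF assms])
  next
    case 3
    have P7: "P = 1 / 7" unfolding P_def using 3 by simp
    define s where "s = sqrt (3::real)"
    have s: "s > 0" "s * s = 3" by (auto simp: s_def)
    \<comment> \<open>The upper intersection of the circles with squared radii \<open>1/7\<close>
      and \<open>1/28\<close>; the arcs meet at the angle \<open>pi / 3\<close>.\<close>
    define z where "z = Complex (- 5 / 14) (s / 14)"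
    have ss: "s * (s * x) = 3 * x" for x using s by (simp flip: mult.assoc)
    have z3: "(- z) ^ 3 = Complex (80 / 2744) (- (72 * s) / 2744)"
      using s by (simp add: z_def power3_eq_cube complex_eq_iff algebra_simps ss)
    have cis3: "cis (pi / real 3) = Complex (1 / 2) (s / 2)"
      by (simp add: s_def complex_eq_iff cos_60 sin_60)
    interpret fricke_corner p h N z 3
    proof unfold_locales
      show "p \<in> {5, 7}" using 3 by simp
      show "Im z > 0" using s by (simp add: z_def)
      show "z * cnj z = of_real P" "(z + 1 / 2) * cnj (z + 1 / 2) = of_real (P / 4)"
        using s by (simp_all add: z_def P7 complex_eq_iff algebra_simps ss)
      show "z * cis (pi / real 3) = - 2 * (z + 1 / 2)"
        unfolding cis3 using s by (simp add: z_def complex_eq_iff algebra_simps ss)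
      show "Im (v ^ 3) > 0" if v: "Im v > 0" "Im (v * cnj (cis (pi / real 3))) < 0" for v
      proof -
        define a b where "a = Re v" and "b = Im v"
        have "b < s * a" "b > 0" using v unfolding cis3 by (simp_all add: a_def b_def mult.commute)
        hence "b * b < (s * a) * (s * a)" by (intro mult_strict_mono) auto
        also have "(s * a) * (s * a) = (s * s) * (a * a)" by (simp only: mult_ac)
        finally have "b * b < 3 * a * a" by (simp add: s)
        hence "b * (3 * a * a - b * b) > 0" using \<open>b > 0\<close> by (intro mult_pos_pos) auto
        moreover have "Im (v ^ 3) = b * (3 * a * a - b * b)"
          by (simp add: power3_eq_cube a_def b_def algebra_simps)
        ultimately show ?thesis by simp
      qed
      show "Im ((- z) ^ 3) < 0" unfolding z3 using s by simp
      show "Im ((- z) ^ 3 * (\<tau> - cnj z) ^ (3 + 1) * cnj (\<tau> - z) ^ (3 - 1)) > 0"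
        if "Im \<tau> > 0" "Re \<tau> = - 1 / 2 \<or> Re \<tau> = 0" for \<tau>
      proof -
        \<comment> \<open>A square root of \<open>-3\<close>: the computation takes place among
          numbers \<open>a + J * b\<close>, and in the variable \<open>t\<close> the
          \<open>J\<close>-part is again a polynomial with positive coefficients on each
          side.\<close>
        define J where "J = \<i> * of_real s"
        define t where "t = 14 * Im \<tau> / s"
        have t: "t > 0" "Im \<tau> = s * t / 14" using that s by (auto simp: t_def)
        have J: "(of_real a + J * of_real b) * (of_real c + J * of_real d) =
            of_real (a * c - 3 * b * d) + J * of_real (a * d + b * c)" for a b c d
          using s by (simp add: J_def complex_eq_iff algebra_simps ss)
        define a where "a = 14 * Re \<tau> + 5"
        have a: "Re \<tau> = (a - 5) / 14" "a = 5 \<or> a = - 2" using that(2) by (auto simp: a_def)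
        have 1: "(- z) ^ 3 = (of_real 80 + J * of_real (- 72)) / 2744"
          unfolding z3 by (simp add: J_def complex_eq_iff)
        have 2: "\<tau> - cnj z = (of_real a + J * of_real (t + 1)) / 14"
          by (simp add: J_def complex_eq_iff z_def t(2) a(1) field_simps)
        have 3: "cnj (\<tau> - z) = (of_real a + J * of_real (1 - t)) / 14"
          by (simp add: J_def complex_eq_iff z_def t(2) a(1) field_simps)
        define K where "K = (of_real 80 + J * of_real (- 72)) * (of_real a + J * of_real (t + 1)) ^ 4 * (of_real a + J * of_real (1 - t)) ^ 2"
        define R where "R = (if a = 5 then 8 * (197568 + 120736 * t + 8232 * t ^ 2 + 32928 * t ^ 3 + 882 * t ^ 4 + 1386 * t ^ 5 + 243 * t ^ 6)
            else 8 * (3087 + 686 * t + 1029 * t ^ 2 + 4116 * t ^ 3 + 441 * t ^ 4 + 126 * t ^ 5 + 243 * t ^ 6))"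
        have "\<exists>r i. K = of_real r + J * of_real i \<and> i = R"
          unfolding K_def power4_eq_xxxx power2_eq_square J
        proof (intro exI conjI, rule refl)
        qed (use a(2) in \<open>auto simp: R_def eval_nat_numeral algebra_simps\<close>)
        then obtain r where "K = of_real r + J * of_real R" by blast
        hence "Im K = s * R" by (simp add: J_def)
        moreover have "R > 0" using t(1) by (auto simp: R_def intro!: add_pos_pos mult_pos_pos)
        ultimately have "Im (K / of_real (2744 * 14 ^ 6)) > 0"
          using s(1) unfolding Im_divide_of_real by simp
        moreover have "(- z) ^ 3 * (\<tau> - cnj z) ^ (3 + 1) * cnj (\<tau> - z) ^ (3 - 1) = K / of_real (2744 * 14 ^ 6)"
          unfolding 1 2 3 K_def by (simp add: power_divide)
        ultimately show ?thesis by (simp only:)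
      qed
    qed auto
    show ?thesis by (rule h_nonzero_corner[OF assms])
  qed
qed

section \<open>Expansions at the cusp\<close>

lemma has_field_derivative_nome: "(nome has_field_derivative 2 * of_real pi * \<i> * nome \<tau>) (at \<tau>)"
  unfolding nome_def [abs_def] by (auto intro!: derivative_eq_intros)

text \<open>The principal logarithm yields the representative in the strip around the imaginary
  axis, where the hypothesis on zeros can be used.\<close>

lemma nome_surj:
  assumes "q \<noteq> 0" "norm q < 1"
  obtains \<tau> where "nome \<tau> = q" "Im \<tau> > 0" "\<bar>Re \<tau>\<bar> \<le> 1 / 2"
proof -
  define \<tau> where "\<tau> = Ln q / (2 * of_real pi * \<i>)"
  have "nome \<tau> = q" using assms by (simp add: nome_def \<tau>_def)
  moreover have "Im \<tau> > 0"
  proof -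
    have "exp (- 2 * pi * Im \<tau>) < 1" using assms norm_nome[of \<tau>] \<open>nome \<tau> = q\<close> by simp
    hence "- 2 * pi * Im \<tau> < 0" by (simp only: exp_less_one_iff)
    hence "pi * Im \<tau> > 0" by simp
    thus ?thesis by (rule zero_less_mult_pos) simp
  qed
  moreover have "\<bar>Re \<tau>\<bar> \<le> 1 / 2"
  proof -
    have eq: "\<tau> = (- \<i> * Ln q) / of_real (2 * pi)" by (simp add: \<tau>_def field_simps)
    have "Re \<tau> = Im (Ln q) / (2 * pi)" unfolding eq Re_divide_of_real by simp
    hence "\<bar>Re \<tau>\<bar> = \<bar>Im (Ln q)\<bar> / (2 * pi)" by (simp only: abs_divide) simp
    moreover have "\<bar>Im (Ln q)\<bar> \<le> pi"
      using Im_Ln_le_pi[OF assms(1)] mpi_less_Im_Ln[OF assms(1)] by (simp add: abs_le_iff)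
    hence "\<bar>Im (Ln q)\<bar> / (2 * pi) \<le> pi / (2 * pi)" by (rule divide_right_mono) simp
    ultimately show ?thesis by simp
  qed
  ultimately show ?thesis by (rule that)
qed

text \<open>\<open>E2\<close> in the variable \<open>q\<close>, where the cusp becomes the interior
  point 0.\<close>

definition E2_series :: "complex \<Rightarrow> complex" where
  "E2_series q = 1 - 24 * (\<Sum>n. of_nat (\<Sum>d | d dvd Suc n. d) * q ^ Suc n)"

lemma E2_eq: "E2 \<tau> = E2_series (nome \<tau>)"
  by (simp add: E2_def E2_series_def)

lemma E2_series_0: "E2_series 0 = 1"
  by (simp add: E2_series_def)

lemma E2_series_holomorphic: "E2_series holomorphic_on ball 0 1"
proof -
  define g :: "complex \<Rightarrow> complex" where "g = (\<lambda>q. \<Sum>n. of_nat (\<Sum>d | d dvd Suc n. d) * q ^ Suc n)"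
  have "g holomorphic_on ball 0 1"
  proof (rule power_series_holomorphic)
    fix q :: complex assume "q \<in> ball 0 1"
    hence "(\<lambda>n. of_nat (\<Sum>d | d dvd Suc n. d) * q ^ Suc n) sums g q"
      using lambert_has_sum(2)[of q] by (simp add: g_def sums_iff)
    \<comment> \<open>The added coefficient is a sum over the infinite set of divisors of 0, hence 0
      by convention.\<close>
    hence "(\<lambda>n. of_nat (\<Sum>d | d dvd n. d) * q ^ n) sums (g q + of_nat (\<Sum>d | d dvd (0::nat). d) * q ^ 0)"
      by (rule sums_Suc)
    thus "(\<lambda>n. of_nat (\<Sum>d | d dvd n. d) * (q - 0) ^ n) sums g q" by simp
  qed
  hence "(\<lambda>q. 1 - 24 * g q) holomorphic_on ball 0 1" by (intro holomorphic_intros)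
  thus ?thesis by (simp add: E2_series_def [abs_def] g_def)
qed

lemma E2_series_cnj:
  assumes "norm q < 1"
  shows "E2_series (cnj q) = cnj (E2_series q)"
proof -
  have "(\<lambda>n. cnj (of_nat (\<Sum>d | d dvd Suc n. d) * q ^ Suc n)) sums
      cnj (\<Sum>n. of_nat (\<Sum>d | d dvd Suc n. d) * q ^ Suc n)"
    unfolding sums_cnj using lambert_has_sum(2)[OF assms] by (simp add: sums_iff)
  hence "(\<lambda>n. of_nat (\<Sum>d | d dvd Suc n. d) * cnj q ^ Suc n) sums
      cnj (\<Sum>n. of_nat (\<Sum>d | d dvd Suc n. d) * q ^ Suc n)" by simp
  thus ?thesis by (simp add: E2_series_def sums_iff)
qed

definition E2p_series :: "nat \<Rightarrow> complex \<Rightarrow> complex" where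
  "E2p_series p q = 1 / of_nat (p + 1) * (of_nat p * E2_series (q ^ p) + E2_series q)"

lemma nome_of_nat_mult: "nome (of_nat p * \<tau>) = nome \<tau> ^ p"
  by (simp add: nome_def mult_ac flip: exp_of_nat_mult)

lemma E2p_eq: "E2p p \<tau> = E2p_series p (nome \<tau>)"
  by (simp add: E2p_def E2p_series_def E2_eq nome_of_nat_mult)

lemma power_in_ball:
  assumes "p > 0" "q \<in> ball (0::complex) 1"
  shows "q ^ p \<in> ball 0 1"
  using assms by (auto simp: norm_power power_less_one_iff)

lemma E2p_series_holomorphic:
  assumes "p > 0"
  shows "E2p_series p holomorphic_on ball 0 1"
proof -
  have "(\<lambda>q. E2_series (q ^ p)) holomorphic_on ball 0 1"
  proof -
    have "(\<lambda>q::complex. q ^ p) ` ball 0 1 \<subseteq> ball 0 1" using power_in_ball[OF assms] by blast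
    from holomorphic_on_compose_gen[OF _ E2_series_holomorphic this] show ?thesis
      by (simp add: o_def holomorphic_intros)
  qed
  thus ?thesis unfolding E2p_series_def [abs_def] using E2_series_holomorphic
    by (intro holomorphic_intros)
qed

lemma E2p_series_cnj:
  assumes "p > 0" "norm q < 1"
  shows "E2p_series p (cnj q) = cnj (E2p_series p q)"
proof -
  have "norm (q ^ p) < 1" using power_in_ball[of p q] assms by simp
  from E2_series_cnj[OF this] E2_series_cnj[OF assms(2)] show ?thesis
    by (simp add: E2p_series_def)
qed

lemma E2p_holomorphic:
  assumes "p > 0"
  shows "E2p p holomorphic_on {\<tau>. Im \<tau> > 0}"
proof -
  have "nome holomorphic_on {\<tau>. Im \<tau> > 0}"
    using has_field_derivative_nome by (auto simp: holomorphic_on_open open_halfspace_Im_gt)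
  moreover have "nome ` {\<tau>. Im \<tau> > 0} \<subseteq> ball 0 1" using norm_nome_less_1 by auto
  ultimately have "(E2p_series p \<circ> nome) holomorphic_on {\<tau>. Im \<tau> > 0}"
    using holomorphic_on_compose_gen E2p_series_holomorphic[OF assms] by blast
  thus ?thesis by (simp add: o_def E2p_eq [abs_def])
qed

lemma holomorphic_linear_bound:
  assumes "g holomorphic_on ball 0 R" "r < R"
  obtains C where "C \<ge> 0" "\<And>q. norm q \<le> r \<Longrightarrow> norm (g q - g 0) \<le> C * norm q"
proof -
  have sub: "cball 0 r \<subseteq> ball (0::complex) R" using assms(2) by auto
  have "continuous_on (cball 0 r) (deriv g)"
    using holomorphic_on_imp_continuous_on[OF holomorphic_deriv[OF assms(1) open_ball]] sub
    by (rule continuous_on_subset)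
  hence "compact (deriv g ` cball 0 r)" by (rule compact_continuous_image) simp
  then obtain B where B: "B > 0" "\<And>q. q \<in> cball 0 r \<Longrightarrow> norm (deriv g q) \<le> B"
    using compact_imp_bounded bounded_pos by (metis (no_types, lifting) image_eqI)
  show ?thesis
  proof (rule that[of B])
    fix q :: complex assume q: "norm q \<le> r"
    have "norm (g q - g 0) \<le> B * norm (q - 0)"
    proof (rule field_differentiable_bound)
      show "convex (cball (0::complex) r)" by simp
      fix z :: complex assume z: "z \<in> cball 0 r"
      show "(g has_field_derivative deriv g z) (at z within cball 0 r)"
        by (rule has_field_derivative_at_within, rule holomorphic_derivI[OF assms(1) open_ball])
           (use z sub in blast)
      show "norm (deriv g z) \<le> B" by (rule B(2)[OF z])
    qed (use q in \<open>auto intro: order_trans[OF norm_ge_zero]\<close>)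
    thus "norm (g q - g 0) \<le> B * norm q" by simp
  qed (use B(1) in simp)
qed

text \<open>Factoring out the first nonzero coefficient gives \<open>\<phi> 0 \<noteq> 0\<close>.
  The power series converges in the whole disc because every nonzero \<open>q\<close> there is a
  nome.\<close>

lemma fourier_power_series:
  assumes "has_fourier_expansion f a" "\<exists>\<tau>\<in>upper_half_plane. f \<tau> \<noteq> 0" "\<forall>n. a n \<in> \<real>"
  obtains n0 \<phi> where "\<phi> holomorphic_on ball 0 1" "\<phi> 0 \<noteq> 0"
    "\<And>\<tau>. Im \<tau> > 0 \<Longrightarrow> f \<tau> = nome \<tau> powi n0 * \<phi> (nome \<tau>)"
    "\<And>q. norm q < 1 \<Longrightarrow> \<phi> (cnj q) = cnj (\<phi> q)"
proof -
  obtain n1 where n1: "\<And>n. n < n1 \<Longrightarrow> a n = 0" using assms(1) unfolding has_fourier_expansion_def by blast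
  have sum: "((\<lambda>n. a n * nome \<tau> powi n) has_sum f \<tau>) UNIV" if "Im \<tau> > 0" for \<tau>
    using assms(1) that unfolding has_fourier_expansion_def upper_half_plane_def by blast
  have "\<exists>n. a n \<noteq> 0"
  proof (rule ccontr)
    assume "\<not> ?thesis"
    obtain \<tau> where \<tau>: "Im \<tau> > 0" "f \<tau> \<noteq> 0" using assms(2) by (auto simp: upper_half_plane_def)
    have "((\<lambda>n. a n * nome \<tau> powi n) has_sum 0) UNIV"
      by (rule has_sum_0) (use \<open>\<not> (\<exists>n. a n \<noteq> 0)\<close> in auto)
    thus False using sum[OF \<tau>(1)] \<tau>(2) has_sum_unique by blast
  qed
  then obtain n2 where n2: "a n2 \<noteq> 0" by blast
  have n2': "n2 = n1 + int (nat (n2 - n1))" using n1[of n2] n2 by force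
  define m where "m = (LEAST m. a (n1 + int m) \<noteq> 0)"
  have m: "a (n1 + int m) \<noteq> 0" unfolding m_def by (rule LeastI[of _ "nat (n2 - n1)"]) (use n2 n2' in simp)
  have m': "a (n1 + int j) = 0" if "j < m" for j using not_less_Least[of j] that unfolding m_def by blast
  define n0 where "n0 = n1 + int m"
  have n0: "a n0 \<noteq> 0" "\<And>n. n < n0 \<Longrightarrow> a n = 0"
  proof -
    show "a n0 \<noteq> 0" using m by (simp add: n0_def)
    show "a n = 0" if "n < n0" for n
    proof (cases "n < n1")
      case False
      thus ?thesis using m'[of "nat (n - n1)"] that by (simp add: n0_def)
    qed (rule n1)
  qed
  define c where "c = (\<lambda>j::nat. a (n0 + int j))"
  define \<phi> where "\<phi> = (\<lambda>q. \<Sum>j. c j * q ^ j)"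
  have c_sum: "(\<lambda>j. c j * nome \<tau> ^ j) sums (f \<tau> / nome \<tau> powi n0)" if "Im \<tau> > 0" for \<tau>
  proof -
    have "((\<lambda>n. a n * nome \<tau> powi n) has_sum f \<tau>) UNIV \<longleftrightarrow>
          ((\<lambda>n. a n * nome \<tau> powi n) has_sum f \<tau>) {n0..}"
      by (rule has_sum_cong_neutral) (use n0(2) in auto)
    also have "\<dots> \<longleftrightarrow> ((\<lambda>j::nat. c j * nome \<tau> powi (n0 + int j)) has_sum f \<tau>) UNIV"
      by (rule has_sum_reindex_bij_witness[of _ "\<lambda>j. n0 + int j" "\<lambda>n. nat (n - n0)"]) (auto simp: c_def)
    finally have "((\<lambda>j::nat. c j * nome \<tau> powi (n0 + int j)) has_sum f \<tau>) UNIV" using sum[OF that] by simp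
    hence "(\<lambda>j::nat. c j * nome \<tau> powi (n0 + int j)) sums f \<tau>" by (rule has_sum_imp_sums)
    hence "(\<lambda>j::nat. c j * nome \<tau> powi (n0 + int j) / nome \<tau> powi n0) sums (f \<tau> / nome \<tau> powi n0)"
      by (rule sums_divide)
    thus ?thesis by (simp add: power_int_add)
  qed
  have \<phi>_sums: "(\<lambda>j. c j * q ^ j) sums \<phi> q" if q: "norm q < 1" for q
  proof -
    have "summable (\<lambda>j. c j * q ^ j)"
    proof (cases "q = 0")
      case True
      show ?thesis unfolding True using powser_sums_zero[of c] by (rule sums_summable)
    next
      case False
      then obtain \<tau> where \<tau>: "nome \<tau> = q" "Im \<tau> > 0" using nome_surj[OF False q] by metis
      show ?thesis using c_sum[OF \<tau>(2)] unfolding \<tau>(1) by (rule sums_summable)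
    qed
    thus ?thesis unfolding \<phi>_def by (rule summable_sums)
  qed
  show ?thesis
  proof (rule that[of \<phi> n0])
    show "\<phi> holomorphic_on ball 0 1"
      by (rule power_series_holomorphic[of _ _ c]) (use \<phi>_sums in simp)
    show "\<phi> 0 \<noteq> 0" using n0(1) by (simp add: \<phi>_def c_def)
    show "f \<tau> = nome \<tau> powi n0 * \<phi> (nome \<tau>)" if "Im \<tau> > 0" for \<tau>
      using sums_unique2[OF c_sum[OF that] \<phi>_sums[OF norm_nome_less_1[OF that]]] by (simp add: field_simps)
    show "\<phi> (cnj q) = cnj (\<phi> q)" if "norm q < 1" for q
    proof -
      have "(\<lambda>j. cnj (c j * q ^ j)) sums cnj (\<phi> q)" unfolding sums_cnj by (rule \<phi>_sums[OF that])
      moreover have "cnj (c j) = c j" for j using assms(3) by (simp add: c_def Reals_cnj_iff)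
      ultimately have "(\<lambda>j. c j * cnj q ^ j) sums cnj (\<phi> q)" by simp
      thus ?thesis using \<phi>_sums[of "cnj q"] that sums_unique2 by fastforce
    qed
  qed
qed

section \<open>From the transformation law of \<open>f\<close> to that of \<open>h\<close>\<close>

text \<open>Differentiating the law of \<open>f\<close> leaves the extra term
  \<open>k * c / (c \<tau> + d)\<close> in the logarithmic derivative. The normalisation
  \<open>(p + 1) / 24\<close> in the Serre derivative makes the correction of \<open>E2p\<close>
  cancel it exactly.\<close>

lemma log_derivative_transform:
  fixes M :: "complex \<Rightarrow> complex"
  assumes f: "f holomorphic_on {\<tau>. Im \<tau> > 0}"
    and M: "\<And>\<tau>. Im \<tau> > 0 \<Longrightarrow> Im (M \<tau>) > 0"
    and trans: "\<And>\<tau>. Im \<tau> > 0 \<Longrightarrow> f (M \<tau>) = (c * \<tau> + d) powi k * f \<tau>"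
    and nz: "c * \<tau> + d \<noteq> 0"
    and deriv_M: "(M has_field_derivative 1 / (c * \<tau> + d) ^ 2) (at \<tau>)"
    and E: "E2p p (M \<tau>) = (c * \<tau> + d) ^ 2 * E2p p \<tau> +
       12 / (of_nat (p + 1) * of_real pi * \<i>) * (c * (c * \<tau> + d))"
    and "Im \<tau> > 0" "f \<tau> \<noteq> 0"
  shows "serre_derivative p k f (M \<tau>) / f (M \<tau>) = (c * \<tau> + d) ^ 2 * (serre_derivative p k f \<tau> / f \<tau>)"
proof -
  define J where "J = c * \<tau> + d"
  define A where "A = J powi k"
  have J: "J \<noteq> 0" "A \<noteq> 0" using nz by (auto simp: J_def A_def)
  have Df: "(f has_field_derivative deriv f z) (at z)" if "Im z > 0" for z
    by (rule holomorphic_derivI[OF f open_halfspace_Im_gt]) (use that in simp)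
  have "((\<lambda>\<tau>. f (M \<tau>)) has_field_derivative deriv f (M \<tau>) * (1 / J ^ 2)) (at \<tau>)"
    unfolding J_def by (rule DERIV_chain2[OF Df[OF M[OF assms(7)]] deriv_M])
  moreover have "((\<lambda>\<tau>. f (M \<tau>)) has_field_derivative (of_int k * J powi (k - 1) * c) * f \<tau> + deriv f \<tau> * A) (at \<tau>)"
  proof (rule has_field_derivative_transform_within_open)
    show "((\<lambda>\<tau>. (c * \<tau> + d) powi k * f \<tau>) has_field_derivative (of_int k * J powi (k - 1) * c) * f \<tau> + deriv f \<tau> * A) (at \<tau>)"
      unfolding J_def A_def
      by (rule DERIV_mult[OF DERIV_power_int Df]) (use nz assms(7) in \<open>auto intro!: derivative_eq_intros\<close>)
    show "open {\<tau>. Im \<tau> > 0}" by (rule open_halfspace_Im_gt)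
  qed (use assms(7) trans in auto)
  ultimately have "deriv f (M \<tau>) * (1 / J ^ 2) = (of_int k * J powi (k - 1) * c) * f \<tau> + deriv f \<tau> * A"
    by (rule DERIV_unique)
  moreover have "J powi (k - 1) = A / J" using J by (simp add: A_def power_int_diff)
  ultimately have D: "deriv f (M \<tau>) = J ^ 2 * (of_int k * A / J * c * f \<tau> + deriv f \<tau> * A)"
    using J by (simp add: field_simps)
  have fM: "f (M \<tau>) = A * f \<tau>" using trans[OF assms(7)] by (simp add: A_def J_def)
  define w where "w = of_real pi * \<i>"
  have w: "w \<noteq> 0" by (simp add: w_def)
  define n where "n = (of_nat (p + 1) :: complex)"
  have n: "n \<noteq> 0" by (simp add: n_def del: of_nat_Suc of_nat_add)
  have E': "E2p p (M \<tau>) = J ^ 2 * E2p p \<tau> + 12 / (n * w) * (c * J)"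
    using E by (simp add: n_def w_def J_def mult.assoc)
  have "serre_derivative p k f (M \<tau>) / f (M \<tau>) = deriv f (M \<tau>) / (A * f \<tau>) / (2 * w) - n / 24 * of_int k * E2p p (M \<tau>)"
    unfolding serre_derivative_def D_op_def fM n_def[symmetric] using J assms(8)
    by (simp add: w_def diff_divide_distrib mult.assoc)
  also have "deriv f (M \<tau>) / (A * f \<tau>) = J ^ 2 * (of_int k * c / J + deriv f \<tau> / f \<tau>)"
    unfolding D using J assms(8) by (simp add: field_simps)
  also have "J ^ 2 * (of_int k * c / J + deriv f \<tau> / f \<tau>) / (2 * w) - n / 24 * of_int k * E2p p (M \<tau>) =
      J ^ 2 * (deriv f \<tau> / f \<tau> / (2 * w) - n / 24 * of_int k * E2p p \<tau>)"
    unfolding E' using J w n by (simp add: field_simps power2_eq_square)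
  also have "deriv f \<tau> / f \<tau> / (2 * w) - n / 24 * of_int k * E2p p \<tau> = serre_derivative p k f \<tau> / f \<tau>"
    unfolding serre_derivative_def D_op_def n_def[symmetric] using assms(8)
    by (simp add: w_def diff_divide_distrib mult.assoc)
  finally show ?thesis by (simp add: J_def)
qed

lemma mat2_nth:
  "mat2 a b c d $ 1 $ 1 = a" "mat2 a b c d $ 1 $ 2 = b" "mat2 a b c d $ 2 $ 1 = c" "mat2 a b c d $ 2 $ 2 = d"
  by (simp_all add: mat2_def)

lemma mat2_mult_Fricke: "mat2 a b c d ** mat2 0 x y 0 = mat2 (b * y) (a * x) (d * y) (c * x)"
  by (simp add: vec_eq_iff forall_2 matrix_matrix_mult_def sum_2 mat2_nth)

lemma Fricke_group_I:
  assumes "(a::int) * d - b * c = 1" "int p dvd c"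
  shows "mat2 (b * sqrt p) (- a / sqrt p) (d * sqrt p) (- c / sqrt p) \<in> Fricke_group p"
proof -
  have "mat2 a b c d \<in> Gamma0 p" using assms unfolding Gamma0_def by blast
  hence "mat2 a b c d ** mat2 0 (- 1 / sqrt (real p)) (sqrt (real p)) 0 \<in> Fricke_group p"
    unfolding Fricke_group_def by blast
  thus ?thesis by (simp add: mat2_mult_Fricke)
qed

lemma nome_add_1: "nome (\<tau> + 1) = nome \<tau>"
  using nome_add_of_int[of \<tau> 1] by simp

lemma nome_reflect: "nome (- cnj \<tau>) = cnj (nome \<tau>)"
  by (simp add: nome_def exp_cnj)

section \<open>Weakly holomorphic forms\<close>

locale weakly_holomorphic_setting =
  fixes p :: nat and k :: int and f :: "complex \<Rightarrow> complex" and a :: "int \<Rightarrow> complex"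
  assumes p: "p \<in> {1, 2, 3, 5, 7}"
    and form: "f \<in> weakly_holomorphic_forms k p"
    and nonzero: "\<exists>\<tau>\<in>upper_half_plane. f \<tau> \<noteq> 0"
    and fourier: "has_fourier_expansion f a"
    and real: "\<forall>n. a n \<in> \<real>"
    and has_zero: "\<exists>\<tau>\<in>upper_half_plane. f \<tau> = 0"
    and zeros: "\<forall>\<tau>\<in>fundamental_domain p. f \<tau> = 0 \<longrightarrow> \<tau> \<in> lower_boundary p"
begin

text \<open>At zeros of \<open>f\<close> division by zero gives the value 0, which agrees with
  periodicity and reflection; so these hold everywhere in the half-plane.\<close>

definition h :: "complex \<Rightarrow> complex" where "h \<tau> = serre_derivative p k f \<tau> / f \<tau>"
definition N :: "complex set" where "N = {\<tau>. f \<tau> = 0}"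

lemma p_pos: "p > 0" using p by auto

lemma f_holomorphic: "f holomorphic_on {\<tau>. Im \<tau> > 0}"
  using form unfolding weakly_holomorphic_forms_def upper_half_plane_def by blast

lemma f_transform:
  "A \<in> Fricke_group p \<Longrightarrow> Im \<tau> > 0 \<Longrightarrow> f (moebius_action A \<tau>) = automorphy_factor A \<tau> powi k * f \<tau>"
  using form unfolding weakly_holomorphic_forms_def upper_half_plane_def by blast

lemma serre_holomorphic: "serre_derivative p k f holomorphic_on {\<tau>. Im \<tau> > 0}"
  unfolding serre_derivative_def [abs_def] D_op_def
  by (intro holomorphic_intros holomorphic_deriv f_holomorphic E2p_holomorphic p_pos open_halfspace_Im_gt)
     auto

lemma h_differentiable:
  assumes "Im \<tau> > 0" "\<tau> \<notin> N"
  shows "h field_differentiable at \<tau>"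
proof -
  have "serre_derivative p k f field_differentiable at \<tau>" "f field_differentiable at \<tau>"
    using serre_holomorphic f_holomorphic assms(1) holomorphic_on_imp_differentiable_at open_halfspace_Im_gt
    by (metis mem_Collect_eq)+
  thus ?thesis using assms(2) unfolding h_def [abs_def] N_def by (auto intro: field_differentiable_divide)
qed

text \<open>\<open>f = (\<tau> - \<tau>0)^n * g\<close> gives
  \<open>f' / f = n / (\<tau> - \<tau>0) + g' / g\<close>, so \<open>m\<close> is the order of the
  zero. Its positivity at zeros serves \<open>h_not_identically_0\<close>.\<close>

lemma h_local_form:
  assumes \<tau>0: "Im \<tau>0 > 0"
  shows "\<exists>m e b. 0 \<le> m \<and> (\<tau>0 \<in> N \<longrightarrow> m > 0) \<and> 0 < e \<and> b holomorphic_on ball \<tau>0 e \<and>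
        (\<forall>\<tau>\<in>ball \<tau>0 e. Im \<tau> > 0 \<and> (\<tau> \<noteq> \<tau>0 \<longrightarrow> \<tau> \<notin> N \<and> h \<tau> = of_real m / (2 * of_real pi * \<i> * (\<tau> - \<tau>0)) + b \<tau>))"
proof (cases "\<tau>0 \<in> N")
  case False
  have "open ({\<tau>. Im \<tau> > 0} \<inter> f -` (- {0}))"
    using holomorphic_on_imp_continuous_on[OF f_holomorphic] open_halfspace_Im_gt
    by (intro continuous_open_preimage) auto
  moreover have "\<tau>0 \<in> {\<tau>. Im \<tau> > 0} \<inter> f -` (- {0})" using False \<tau>0 by (simp add: N_def)
  ultimately obtain e where e: "e > 0" "ball \<tau>0 e \<subseteq> {\<tau>. Im \<tau> > 0} \<inter> f -` (- {0})"
    unfolding open_contains_ball by blast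
  have "h holomorphic_on ball \<tau>0 e"
    unfolding holomorphic_on_def
  proof
    fix \<tau> assume "\<tau> \<in> ball \<tau>0 e"
    hence "h field_differentiable at \<tau>" using e(2) by (intro h_differentiable) (auto simp: N_def)
    thus "h field_differentiable at \<tau> within ball \<tau>0 e" by (rule field_differentiable_at_within)
  qed
  thus ?thesis using e False by (intro exI[of _ "0::real"] exI[of _ e] exI[of _ h]) (auto simp: N_def)
next
  case True
  have conn: "connected {\<tau>. Im \<tau> > 0}" by (intro convex_connected convex_halfspace_Im_gt)
  have nconst: "\<not> f constant_on {\<tau>. Im \<tau> > 0}"
  proof
    assume "f constant_on {\<tau>. Im \<tau> > 0}"
    then obtain c where "\<And>\<tau>. Im \<tau> > 0 \<Longrightarrow> f \<tau> = c" unfolding constant_on_def by auto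
    thus False using nonzero True \<tau>0 by (auto simp: N_def upper_half_plane_def)
  qed
  obtain g r n where n: "0 < n" and r: "0 < r" "ball \<tau>0 r \<subseteq> {\<tau>. Im \<tau> > 0}"
    and g: "g holomorphic_on ball \<tau>0 r" "\<And>\<tau>. \<tau> \<in> ball \<tau>0 r \<Longrightarrow> f \<tau> = (\<tau> - \<tau>0) ^ n * g \<tau>"
      "\<And>\<tau>. \<tau> \<in> ball \<tau>0 r \<Longrightarrow> g \<tau> \<noteq> 0"
    by (rule holomorphic_factor_zero_nonconstant[OF f_holomorphic open_halfspace_Im_gt conn _ _ nconst, of \<tau>0])
       (use True \<tau>0 in \<open>auto simp: N_def\<close>)
  define b where "b = (\<lambda>\<tau>. deriv g \<tau> / g \<tau> / (2 * of_real pi * \<i>) - of_nat (p + 1) / 24 * of_int k * E2p p \<tau>)"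
  have "b holomorphic_on ball \<tau>0 r"
    unfolding b_def using g(3)
    by (intro holomorphic_intros holomorphic_deriv g(1) open_ball holomorphic_on_subset[OF E2p_holomorphic[OF p_pos] r(2)]) auto
  moreover have "h \<tau> = of_real (real n) / (2 * of_real pi * \<i> * (\<tau> - \<tau>0)) + b \<tau>" if \<tau>: "\<tau> \<in> ball \<tau>0 r" "\<tau> \<noteq> \<tau>0" for \<tau>
  proof -
    define G where "G = g \<tau>"
    have G: "G \<noteq> 0" using g(3)[OF \<tau>(1)] by (simp add: G_def)
    have "(g has_field_derivative deriv g \<tau>) (at \<tau>)" by (rule holomorphic_derivI[OF g(1) open_ball \<tau>(1)])
    hence "((\<lambda>\<tau>. (\<tau> - \<tau>0) ^ n * g \<tau>) has_field_derivative
        (of_nat n * (\<tau> - \<tau>0) ^ (n - 1) * G + deriv g \<tau> * (\<tau> - \<tau>0) ^ n)) (at \<tau>)"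
      by (auto intro!: derivative_eq_intros simp: G_def)
    hence "(f has_field_derivative (of_nat n * (\<tau> - \<tau>0) ^ (n - 1) * G + deriv g \<tau> * (\<tau> - \<tau>0) ^ n)) (at \<tau>)"
      by (rule has_field_derivative_transform_within_open[OF _ open_ball \<tau>(1)]) (simp add: g(2))
    hence D: "deriv f \<tau> = of_nat n * (\<tau> - \<tau>0) ^ (n - 1) * G + deriv g \<tau> * (\<tau> - \<tau>0) ^ n"
      by (rule DERIV_imp_deriv)
    have f: "f \<tau> = (\<tau> - \<tau>0) ^ n * G" using g(2)[OF \<tau>(1)] by (simp add: G_def)
    define s where "s = \<tau> - \<tau>0"
    have s: "s \<noteq> 0" using \<tau> by (simp add: s_def)
    obtain j where j: "n = Suc j" using n by (cases n) auto
    have L: "deriv f \<tau> / f \<tau> = of_nat n / s + deriv g \<tau> / G"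
      unfolding D f s_def[symmetric] using s G by (simp add: j field_simps)
    have "h \<tau> = deriv f \<tau> / f \<tau> / (2 * of_real pi * \<i>) - of_nat (p + 1) / 24 * of_int k * E2p p \<tau>"
      unfolding h_def serre_derivative_def D_op_def using s G
      by (simp add: f s_def[symmetric] diff_divide_distrib)
    also have "\<dots> = of_nat n / s / (2 * of_real pi * \<i>) + b \<tau>"
      unfolding L b_def G_def[symmetric] by (simp add: add_divide_distrib)
    finally show ?thesis by (simp add: s_def mult.commute)
  qed
  moreover have "\<tau> \<notin> N" if "\<tau> \<in> ball \<tau>0 r" "\<tau> \<noteq> \<tau>0" for \<tau>
    using g(2,3)[OF that(1)] that(2) by (simp add: N_def)
  ultimately show ?thesis using n r
    by (intro exI[of _ "real n"] exI[of _ r] exI[of _ b]) auto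
qed

lemma h_fricke:
  assumes "Im \<tau> > 0" "\<tau> \<notin> N"
  shows "h (- 1 / (of_nat p * \<tau>)) = of_nat p * \<tau> ^ 2 * h \<tau>"
proof -
  define s where "s = sqrt (real p)"
  have s: "s > 0" "of_real s * of_real s = (of_nat p :: complex)"
    using p_pos by (auto simp: s_def simp flip: of_real_mult)
  define A where "A = mat2 0 (- 1 / s) s 0"
  have A: "A \<in> Fricke_group p"
    using Fricke_group_I[of 1 1 0 0 p] by (simp add: A_def s_def)
  have M: "moebius_action A w = - 1 / (of_nat p * w)" for w
    using s(1) unfolding moebius_action_def automorphy_factor_def A_def mat2_nth
    by (simp add: s(2)[symmetric] divide_simps)
  have "h (- 1 / (of_nat p * \<tau>)) = (of_real s * \<tau> + 0) ^ 2 * h \<tau>"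
    unfolding h_def
  proof (rule log_derivative_transform[OF f_holomorphic])
    show "f (- 1 / (of_nat p * w)) = (of_real s * w + 0) powi k * f w" if "Im w > 0" for w
      using f_transform[OF A that] unfolding M by (simp add: automorphy_factor_def A_def mat2_nth)
    have \<tau>0: "\<tau> \<noteq> 0" using assms by auto
    show "of_real s * \<tau> + 0 \<noteq> 0" using s(1) \<tau>0 by simp
    have "((\<lambda>w. - 1 / (of_nat p * w)) has_field_derivative 1 / (of_nat p * \<tau> ^ 2)) (at \<tau>)"
      using \<tau>0 p_pos by (auto intro!: derivative_eq_intros simp: power2_eq_square field_simps)
    thus "((\<lambda>w. - 1 / (of_nat p * w)) has_field_derivative 1 / (of_real s * \<tau> + 0) ^ 2) (at \<tau>)"
      by (simp add: power_mult_distrib power2_eq_square[of "of_real s"] s(2))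
    show "E2p p (- 1 / (of_nat p * \<tau>)) = (of_real s * \<tau> + 0) ^ 2 * E2p p \<tau> +
        12 / (of_nat (p + 1) * of_real pi * \<i>) * (of_real s * (of_real s * \<tau> + 0))"
      unfolding E2p_Fricke[OF assms(1) p_pos]
      by (simp add: power_mult_distrib power2_eq_square[of "of_real s"] s(2) flip: mult.assoc)
    show "Im (- 1 / (of_nat p * w)) > 0" if "Im w > 0" for w
    proof -
      define z where "z = of_nat p * w"
      have "Im z > 0" using that p_pos by (simp add: z_def)
      hence "Im (- 1 / z) > 0" by (simp add: Im_divide sum_power2_gt_zero_iff)
      thus ?thesis by (simp add: z_def)
    qed
  qed (use assms in \<open>auto simp: N_def\<close>)
  thus ?thesis by (simp add: power_mult_distrib power2_eq_square[of "of_real s"] s(2))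
qed

lemma h_involution:
  assumes "Im \<tau> > 0" "\<tau> \<notin> N" "p \<in> {5, 7}"
  shows "h (- 1 / 2 - 1 / (4 * of_nat p * (\<tau> + 1 / 2))) = 4 * of_nat p * (\<tau> + 1 / 2) ^ 2 * h \<tau>"
proof -
  have odd: "odd p" using assms(3) by auto
  define s where "s = sqrt (real p)"
  have s: "s > 0" "s * s = real p" "of_real s * of_real s = (of_nat p :: complex)"
    using p_pos by (auto simp: s_def simp flip: of_real_mult)
  \<comment> \<open>\<open>2 j - p = 1\<close> is the determinant of the matrix with rows
    \<open>(j, -1)\<close> and \<open>(- p, 2)\<close> of \<open>Gamma0 p\<close>; its product with
    the Fricke matrix is \<open>A\<close>.\<close>
  define j where "j = int ((p + 1) div 2)"
  have j: "2 * j = int p + 1" using odd by (auto simp: j_def elim!: oddE)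
  hence "real_of_int (2 * j) = real_of_int (int p + 1)" by (simp only:)
  hence jr: "real_of_int j = (s * s + 1) / 2" unfolding s(2) by simp
  define A where "A = mat2 (- s) (- j / s) (2 * s) s"
  have "mat2 (of_int (- 1) * sqrt p) (- of_int j / sqrt p) (of_int 2 * sqrt p) (- of_int (- int p) / sqrt p) \<in> Fricke_group p"
    using Fricke_group_I[of j 2 "- 1" "- int p" p] j by simp
  moreover have "- of_int (- int p) / sqrt p = s" using s by (simp add: s_def real_div_sqrt)
  ultimately have A: "A \<in> Fricke_group p" by (simp add: A_def s_def)
  define J :: "complex \<Rightarrow> complex" where "J w = of_real (2 * s) * w + of_real s" for w
  have J_eq: "J w = 2 * of_real s * (w + 1 / 2)" for w by (simp add: J_def algebra_simps)
  have M: "moebius_action A w = - 1 / 2 - 1 / (4 * of_nat p * (w + 1 / 2))" if w: "Im w > 0" for w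
  proof -
    define u where "u = w + 1 / 2"
    have u: "u \<noteq> 0" "w = u - 1 / 2" using w by (auto simp: u_def complex_eq_iff)
    define S where "S = complex_of_real s"
    have S: "S \<noteq> 0" using s(1) by (simp add: S_def)
    have jS: "complex_of_real (real_of_int j) = (S * S + 1) / 2" unfolding jr by (simp add: S_def)
    have "moebius_action A w = (- S * w - complex_of_real (real_of_int j) / S) / (2 * S * u)"
      unfolding moebius_action_def automorphy_factor_def A_def mat2_nth
      by (simp add: S_def u_def algebra_simps)
    also have "\<dots> = - 1 / 2 - 1 / (4 * (S * S) * u)"
      unfolding jS u(2) using S u(1) by (simp add: field_simps)
    finally show ?thesis by (simp add: S_def s(3) u_def)
  qed
  have nz: "\<tau> + 1 / 2 \<noteq> 0" using assms by (auto simp: complex_eq_iff)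
  have Jsq: "J w ^ 2 = 4 * of_nat p * (w + 1 / 2) ^ 2" for w
    unfolding J_eq by (simp add: power_mult_distrib power2_eq_square[of "of_real s"] s(3))
  have "h (- 1 / 2 - 1 / (4 * of_nat p * (\<tau> + 1 / 2))) = (of_real (2 * s) * \<tau> + of_real s) ^ 2 * h \<tau>"
    unfolding h_def
  proof (rule log_derivative_transform[OF f_holomorphic])
    show "f (- 1 / 2 - 1 / (4 * of_nat p * (w + 1 / 2))) = (of_real (2 * s) * w + of_real s) powi k * f w" if "Im w > 0" for w
      using f_transform[OF A that] unfolding M[OF that] by (simp add: automorphy_factor_def A_def mat2_nth)
    show "of_real (2 * s) * \<tau> + of_real s \<noteq> 0"
      using s(1) nz unfolding J_def[symmetric] J_eq by simp
    have "((\<lambda>w. - 1 / 2 - 1 / (4 * of_nat p * (w + 1 / 2))) has_field_derivative 1 / (4 * of_nat p * (\<tau> + 1 / 2) ^ 2)) (at \<tau>)"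
    proof -
      have "((\<lambda>w. inverse (w + 1 / 2)) has_field_derivative - (inverse (\<tau> + 1 / 2) * inverse (\<tau> + 1 / 2))) (at \<tau>)"
        using nz by (auto intro!: derivative_eq_intros)
      from DERIV_diff[OF DERIV_const DERIV_cmult[OF this], of "- 1 / 2" "1 / (4 * of_nat p)"]
      show ?thesis by (simp add: inverse_eq_divide power2_eq_square)
    qed
    thus "((\<lambda>w. - 1 / 2 - 1 / (4 * of_nat p * (w + 1 / 2))) has_field_derivative 1 / (of_real (2 * s) * \<tau> + of_real s) ^ 2) (at \<tau>)"
      unfolding J_def[symmetric] Jsq .
    have "of_real (2 * s) * J \<tau> = 2 * of_nat p * (2 * \<tau> + 1)"
      unfolding J_eq s(3)[symmetric] by (simp add: algebra_simps)
    moreover have "J \<tau> ^ 2 = of_nat p * (2 * \<tau> + 1) ^ 2"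
      unfolding Jsq by (simp add: power2_eq_square algebra_simps)
    ultimately show "E2p p (- 1 / 2 - 1 / (4 * of_nat p * (\<tau> + 1 / 2))) = (of_real (2 * s) * \<tau> + of_real s) ^ 2 * E2p p \<tau> +
        12 / (of_nat (p + 1) * of_real pi * \<i>) * (of_real (2 * s) * (of_real (2 * s) * \<tau> + of_real s))"
      unfolding J_def[symmetric] E2p_involution[OF assms(1) odd] by (simp only:)
    show "Im (- 1 / 2 - 1 / (4 * of_nat p * (w + 1 / 2))) > 0" if "Im w > 0" for w
    proof -
      define z where "z = 4 * of_nat p * (w + 1 / 2)"
      have "Im z > 0" using that p_pos by (simp add: z_def)
      hence "Im (1 / z) < 0" by (simp add: Im_divide sum_power2_gt_zero_iff)
      thus ?thesis by (simp add: z_def)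
    qed
  qed (use assms in \<open>auto simp: N_def\<close>)
  thus ?thesis unfolding J_def[symmetric] Jsq .
qed

text \<open>As \<open>D\<close> is \<open>q d/dq\<close>, \<open>h\<close> becomes
  \<open>n0 + q \<phi>' / \<phi>\<close> minus a real multiple of \<open>E2p_series\<close>,
  holomorphic at \<open>q = 0\<close> and compatible with conjugation.\<close>

lemma h_power_series:
  obtains \<phi> g where "\<phi> holomorphic_on ball 0 1" "\<phi> 0 \<noteq> 0"
    "\<And>\<tau>. Im \<tau> > 0 \<Longrightarrow> f \<tau> = 0 \<longleftrightarrow> \<phi> (nome \<tau>) = 0"
    "\<And>q. norm q < 1 \<Longrightarrow> \<phi> (cnj q) = cnj (\<phi> q)"
    "g holomorphic_on {q \<in> ball 0 1. \<phi> q \<noteq> 0}" "g 0 \<in> \<real>"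
    "\<And>\<tau>. Im \<tau> > 0 \<Longrightarrow> h \<tau> = g (nome \<tau>)"
    "\<And>q. norm q < 1 \<Longrightarrow> g (cnj q) = cnj (g q)"
proof -
  obtain n0 \<phi> where \<phi>: "\<phi> holomorphic_on ball 0 1" "\<phi> 0 \<noteq> 0"
    and f_eq: "\<And>\<tau>. Im \<tau> > 0 \<Longrightarrow> f \<tau> = nome \<tau> powi n0 * \<phi> (nome \<tau>)"
    and cnj_\<phi>: "\<And>q. norm q < 1 \<Longrightarrow> \<phi> (cnj q) = cnj (\<phi> q)"
    by (rule fourier_power_series[OF fourier nonzero real]) (rule that; (assumption | simp))
  define c :: complex where "c = of_nat (p + 1) / 24 * of_int k"
  define G where "G q = of_int n0 * \<phi> q + q * deriv \<phi> q - c * E2p_series p q * \<phi> q" for q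
  have \<phi>': "(\<phi> has_field_derivative deriv \<phi> q) (at q)" if "norm q < 1" for q
    by (rule holomorphic_derivI[OF \<phi>(1) open_ball]) (use that in simp)
  have holo_G: "G holomorphic_on ball 0 1"
    unfolding G_def [abs_def]
    by (intro holomorphic_intros holomorphic_deriv \<phi>(1) E2p_series_holomorphic p_pos open_ball)
  have h_eq: "h \<tau> = G (nome \<tau>) / \<phi> (nome \<tau>)" if \<tau>: "Im \<tau> > 0" for \<tau>
  proof -
    define q where "q = nome \<tau>"
    have q: "q \<noteq> 0" "norm q < 1" using \<tau> by (simp_all add: q_def nome_nonzero norm_nome_less_1)
    define d where "d = 2 * of_real pi * \<i> * q"
    have nome': "(nome has_field_derivative d) (at \<tau>)"
      unfolding d_def q_def by (rule has_field_derivative_nome)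
    have "((\<lambda>\<tau>. nome \<tau> powi n0 * \<phi> (nome \<tau>)) has_field_derivative
        (of_int n0 * q powi (n0 - 1) * d) * \<phi> q + deriv \<phi> q * d * q powi n0) (at \<tau>)"
      using DERIV_mult[OF DERIV_power_int[OF nome', of n0] DERIV_chain2[OF \<phi>'[OF q(2)[unfolded q_def]] nome']] q(1)
      by (simp add: q_def)
    hence "(f has_field_derivative
        (of_int n0 * q powi (n0 - 1) * d) * \<phi> q + deriv \<phi> q * d * q powi n0) (at \<tau>)"
      by (rule has_field_derivative_transform_within_open[OF _ open_halfspace_Im_gt[of 0]]) (use \<tau> f_eq in auto)
    hence D: "deriv f \<tau> = (of_int n0 * q powi (n0 - 1) * d) * \<phi> q + deriv \<phi> q * d * q powi n0"
      by (rule DERIV_imp_deriv)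
    have pow: "q powi n0 = q powi (n0 - 1) * q" using q(1) by (simp add: power_int_minus_mult)
    have "D_op f \<tau> = q powi n0 * (of_int n0 * \<phi> q + q * deriv \<phi> q)"
      unfolding D_op_def D pow d_def by (simp add: algebra_simps)
    hence "serre_derivative p k f \<tau> = q powi n0 * G q"
      unfolding serre_derivative_def E2p_eq f_eq[OF \<tau>] G_def q_def[symmetric] c_def[symmetric]
      by (simp add: algebra_simps)
    thus ?thesis unfolding h_def f_eq[OF \<tau>] q_def[symmetric] using q(1) by simp
  qed
  have cnj_G: "G (cnj q) = cnj (G q)" if q: "norm q < 1" for q
  proof -
    have "(cnj \<circ> \<phi> \<circ> cnj has_field_derivative cnj (deriv \<phi> q)) (at (cnj q))"
      by (rule has_field_derivative_cnj_cnj) (simp add: \<phi>'[OF q])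
    hence "(\<phi> has_field_derivative cnj (deriv \<phi> q)) (at (cnj q))"
      by (rule has_field_derivative_transform_within_open[OF _ open_ball[of 0 1]]) (use q cnj_\<phi> in auto)
    hence "deriv \<phi> (cnj q) = cnj (deriv \<phi> q)" by (rule DERIV_imp_deriv)
    thus ?thesis using cnj_\<phi>[OF q] E2p_series_cnj[OF p_pos q] by (simp add: G_def c_def)
  qed
  have G0: "G 0 / \<phi> 0 = of_int n0 - c"
  proof -
    have nz: "1 + complex_of_nat p \<noteq> 0" using of_nat_neq_0[of p, where 'a = complex] by simp
    have "(0::complex) ^ p = 0" using p_pos by simp
    hence "E2p_series p 0 = (1 + of_nat p) / (1 + of_nat p)"
      by (simp only: E2p_series_def E2_series_0) (simp add: add.commute)
    hence "E2p_series p 0 = 1" using nz by simp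
    thus ?thesis using \<phi>(2) by (simp add: G_def diff_divide_distrib)
  qed
  show ?thesis
  proof (rule that[of \<phi> "\<lambda>q. G q / \<phi> q"])
    show "(\<lambda>q. G q / \<phi> q) holomorphic_on {q \<in> ball 0 1. \<phi> q \<noteq> 0}"
      by (intro holomorphic_intros holomorphic_on_subset[OF holo_G] holomorphic_on_subset[OF \<phi>(1)]) auto
    show "G 0 / \<phi> 0 \<in> \<real>" unfolding G0 c_def by (intro Reals_diff Reals_mult Reals_divide) auto
    show "f \<tau> = 0 \<longleftrightarrow> \<phi> (nome \<tau>) = 0" if "Im \<tau> > 0" for \<tau>
      unfolding f_eq[OF that] by (simp add: nome_nonzero)
  qed (simp_all add: \<phi> h_eq cnj_G cnj_\<phi>)
qed

lemma h_symmetries: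
  assumes "Im \<tau> > 0"
  shows "h (\<tau> + 1) = h \<tau>" "h (- cnj \<tau>) = cnj (h \<tau>)" "\<tau> + 1 \<in> N \<longleftrightarrow> \<tau> \<in> N" "- cnj \<tau> \<in> N \<longleftrightarrow> \<tau> \<in> N"
proof -
  obtain \<phi> g where \<phi>: "\<phi> holomorphic_on ball 0 1" "\<phi> 0 \<noteq> 0"
    "\<And>\<tau>. Im \<tau> > 0 \<Longrightarrow> f \<tau> = 0 \<longleftrightarrow> \<phi> (nome \<tau>) = 0"
    "\<And>q. norm q < 1 \<Longrightarrow> \<phi> (cnj q) = cnj (\<phi> q)"
    and g: "g holomorphic_on {q \<in> ball 0 1. \<phi> q \<noteq> 0}" "g 0 \<in> \<real>"
    "\<And>\<tau>. Im \<tau> > 0 \<Longrightarrow> h \<tau> = g (nome \<tau>)"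
    "\<And>q. norm q < 1 \<Longrightarrow> g (cnj q) = cnj (g q)"
    by (rule h_power_series) (rule that; (assumption | simp))
  have q: "norm (nome \<tau>) < 1" using assms by (rule norm_nome_less_1)
  show "h (\<tau> + 1) = h \<tau>" "h (- cnj \<tau>) = cnj (h \<tau>)" "\<tau> + 1 \<in> N \<longleftrightarrow> \<tau> \<in> N" "- cnj \<tau> \<in> N \<longleftrightarrow> \<tau> \<in> N"
    using assms q by (simp_all add: N_def \<phi>(3,4) g(3,4) nome_add_1 nome_reflect)
qed

lemma zeros_sqdist:
  assumes "Im \<tau> > 0" "- 1 / 2 \<le> Re \<tau>" "Re \<tau> \<le> 0" "1 / p < sqdist 0 \<tau>" "1 / (4 * p) < sqdist (- 1 / 2) \<tau>"
  shows "\<tau> \<notin> N"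
proof
  assume "\<tau> \<in> N"
  have 1: "norm \<tau> > 1 / sqrt p"
  proof (rule power2_less_imp_less)
    show "(1 / sqrt p) ^ 2 < norm \<tau> ^ 2" using assms(4) by (simp add: sqdist_altdef power_divide)
  qed simp
  have 2: "norm (\<tau> + 1 / 2) > 1 / (2 * sqrt p)"
  proof (rule power2_less_imp_less)
    show "(1 / (2 * sqrt p)) ^ 2 < norm (\<tau> + 1 / 2) ^ 2"
      using assms(5) by (simp add: sqdist_altdef power_divide power_mult_distrib)
  qed simp
  have "\<tau> \<in> fundamental_domain p"
    using 1 2 assms by (auto simp: fundamental_domain_def upper_half_plane_def)
  hence "\<tau> \<in> lower_boundary p" using zeros \<open>\<tau> \<in> N\<close> by (auto simp: N_def)
  thus False using 1 2 by (auto simp: lower_boundary_def split: if_splits)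
qed

text \<open>Above height 1 there are no zeros, so \<open>\<phi>\<close> is zero-free for
  \<open>norm q < exp (- 2 pi)\<close> and \<open>g\<close> is holomorphic there. A linear bound for
  \<open>g q - g 0\<close> on the smaller disc of radius \<open>exp (- 4 pi)\<close>, that is for
  \<open>Im \<tau> >= 2\<close>, gives the decay.\<close>

lemma h_cusp: "\<exists>M C. \<forall>\<tau>. Im \<tau> \<ge> 2 \<longrightarrow> norm (h \<tau> - of_real M) \<le> C * exp (- 2 * pi * Im \<tau>)"
proof -
  obtain \<phi> g where \<phi>: "\<phi> holomorphic_on ball 0 1" "\<phi> 0 \<noteq> 0"
    "\<And>\<tau>. Im \<tau> > 0 \<Longrightarrow> f \<tau> = 0 \<longleftrightarrow> \<phi> (nome \<tau>) = 0"
    "\<And>q. norm q < 1 \<Longrightarrow> \<phi> (cnj q) = cnj (\<phi> q)"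
    and g: "g holomorphic_on {q \<in> ball 0 1. \<phi> q \<noteq> 0}" "g 0 \<in> \<real>"
    "\<And>\<tau>. Im \<tau> > 0 \<Longrightarrow> h \<tau> = g (nome \<tau>)"
    "\<And>q. norm q < 1 \<Longrightarrow> g (cnj q) = cnj (g q)"
    by (rule h_power_series) (rule that; (assumption | simp))
  define R where "R = exp (- 2 * pi)"
  have R: "R < 1" by (simp add: R_def)
  have far: "\<tau> \<notin> N" if "Im \<tau> > 1" "- 1 / 2 \<le> Re \<tau>" "Re \<tau> \<le> 0" for \<tau>
  proof -
    have "(Im \<tau>) ^ 2 > 1 ^ 2" using that by (intro power_strict_mono) auto
    hence gt1: "sqdist c \<tau> > 1" for c
      using zero_le_power2[of "Re \<tau> - c"] unfolding sqdist_def one_power2 by linarith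
    have "1 / real p \<le> 1" "1 / (4 * real p) \<le> 1" using p by auto
    with gt1[of 0] gt1[of "- 1 / 2"] show ?thesis using that by (intro zeros_sqdist) auto
  qed
  have \<phi>_nz: "\<phi> q \<noteq> 0" if q: "norm q < R" for q
  proof (cases "q = 0")
    case False
    have "norm q < 1" using q R by simp
    from nome_surj[OF False this] obtain \<tau> where \<tau>: "nome \<tau> = q" "Im \<tau> > 0" "\<bar>Re \<tau>\<bar> \<le> 1 / 2" by blast
    have "exp (- 2 * pi * Im \<tau>) < exp (- 2 * pi)" using q unfolding \<tau>(1)[symmetric] norm_nome R_def by simp
    hence Im: "Im \<tau> > 1" by simp
    have "\<tau> \<notin> N"
    proof (cases "Re \<tau> \<le> 0")
      case True thus ?thesis using far[OF Im] \<tau>(3) by simp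
    next
      case False
      hence "- cnj \<tau> \<notin> N" using far[of "- cnj \<tau>"] Im \<tau>(3) by simp
      thus ?thesis using h_symmetries(4)[OF \<tau>(2)] by simp
    qed
    thus ?thesis using \<phi>(3)[OF \<tau>(2)] \<tau>(1) by (simp add: N_def)
  qed (simp add: \<phi>(2))
  have "g holomorphic_on ball 0 R"
    by (rule holomorphic_on_subset[OF g(1)]) (use \<phi>_nz R in auto)
  moreover have "exp (- 4 * pi) < R" by (simp add: R_def)
  ultimately obtain C where C: "C \<ge> 0" "\<And>q. norm q \<le> exp (- 4 * pi) \<Longrightarrow> norm (g q - g 0) \<le> C * norm q"
    by (rule holomorphic_linear_bound) (rule that; (assumption | simp))
  obtain M where M: "g 0 = of_real M" using g(2) by (auto elim: Reals_cases)
  have "norm (h \<tau> - of_real M) \<le> C * exp (- 2 * pi * Im \<tau>)" if \<tau>: "Im \<tau> \<ge> 2" for \<tau>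
    using C(2)[of "nome \<tau>"] g(3)[of \<tau>] \<tau> unfolding M norm_nome by simp
  thus ?thesis by blast
qed

sublocale fricke_form p h N
proof
  show "\<exists>m e b. 0 \<le> m \<and> 0 < e \<and> b holomorphic_on ball \<tau>0 e \<and>
        (\<forall>\<tau>\<in>ball \<tau>0 e. Im \<tau> > 0 \<and> (\<tau> \<noteq> \<tau>0 \<longrightarrow> \<tau> \<notin> N \<and> h \<tau> = of_real m / (2 * of_real pi * \<i> * (\<tau> - \<tau>0)) + b \<tau>))"
    if \<tau>0: "Im \<tau>0 > 0" for \<tau>0
  proof -
    obtain m e b where "0 \<le> m" "0 < e" "b holomorphic_on ball \<tau>0 e"
      "\<forall>\<tau>\<in>ball \<tau>0 e. Im \<tau> > 0 \<and> (\<tau> \<noteq> \<tau>0 \<longrightarrow> \<tau> \<notin> N \<and> h \<tau> = of_real m / (2 * of_real pi * \<i> * (\<tau> - \<tau>0)) + b \<tau>)"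
      using h_local_form[OF \<tau>0] by (elim exE conjE) (rule that)
    thus ?thesis by (intro exI conjI)
  qed
qed (fact p h_differentiable zeros_sqdist h_symmetries h_fricke h_involution h_cusp)+

text \<open>By analytic continuation \<open>h = 0\<close> on \<open>\<Omega>\<close> would make the
  Serre derivative vanish throughout the half-plane, whereas \<open>h\<close> has a genuine pole at
  a zero of \<open>f\<close>.\<close>

lemma h_not_identically_0: "\<exists>\<tau>\<in>\<Omega>. h \<tau> \<noteq> 0"
proof (rule ccontr)
  assume "\<not> ?thesis"
  hence 0: "serre_derivative p k f \<tau> = 0" if "\<tau> \<in> \<Omega>" for \<tau>
    using that region_not_N[of \<tau>] \<Omega>_subset_region by (auto simp: h_def N_def)
  have "serre_derivative p k f \<tau> = 0" if "Im \<tau> > 0" for \<tau>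
  proof (rule analytic_continuation[OF serre_holomorphic])
    show "connected {\<tau>. Im \<tau> > 0}" by (intro convex_connected convex_halfspace_Im_gt)
    show "\<Omega> \<subseteq> {\<tau>. Im \<tau> > 0}" by (auto simp: \<Omega>_def)
    show "base islimpt \<Omega>" using open_\<Omega> base_region(2) by (simp add: interior_limit_point interior_open)
  qed (use 0 that in \<open>auto simp: base_def open_halfspace_Im_gt\<close>)
  hence h0: "h \<tau> = 0" if "Im \<tau> > 0" for \<tau> using that by (simp add: h_def)
  obtain \<tau>0 where \<tau>0: "Im \<tau>0 > 0" "\<tau>0 \<in> N" using has_zero by (auto simp: N_def upper_half_plane_def)
  from h_local_form[OF \<tau>0(1)] \<tau>0(2) obtain m e b where m: "m > 0" and e: "e > 0"
    and b: "b holomorphic_on ball \<tau>0 e" and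
      form: "\<And>\<tau>. \<tau> \<in> ball \<tau>0 e \<Longrightarrow> Im \<tau> > 0 \<and> (\<tau> \<noteq> \<tau>0 \<longrightarrow> \<tau> \<notin> N \<and> h \<tau> = of_real m / (2 * of_real pi * \<i> * (\<tau> - \<tau>0)) + b \<tau>)"
    by (elim exE conjE) (simp only: simp_thms Ball_def, blast)
  have "isCont b \<tau>0"
    by (rule continuous_on_interior[OF holomorphic_on_imp_continuous_on[OF b]]) (use e in simp)
  hence "((\<lambda>\<tau>. - (2 * of_real pi * \<i> * (\<tau> - \<tau>0)) * b \<tau>) \<longlongrightarrow> - (2 * of_real pi * \<i> * (\<tau>0 - \<tau>0)) * b \<tau>0) (at \<tau>0)"
    unfolding isCont_def by (intro tendsto_intros)
  hence "((\<lambda>\<tau>. - (2 * of_real pi * \<i> * (\<tau> - \<tau>0)) * b \<tau>) \<longlongrightarrow> 0) (at \<tau>0)" by simp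
  moreover have "eventually (\<lambda>\<tau>. - (2 * of_real pi * \<i> * (\<tau> - \<tau>0)) * b \<tau> = of_real m) (at \<tau>0)"
  proof -
    have "- (2 * of_real pi * \<i> * (\<tau> - \<tau>0)) * b \<tau> = of_real m" if "\<tau> \<in> ball \<tau>0 e" "\<tau> \<noteq> \<tau>0" for \<tau>
    proof -
      define d where "d = 2 * of_real pi * \<i> * (\<tau> - \<tau>0)"
      have "d \<noteq> 0" using that(2) by (simp add: d_def)
      have "0 = of_real m / d + b \<tau>" using form[OF that(1)] that(2) h0[of \<tau>] unfolding d_def by metis
      hence "b \<tau> = - of_real m / d" by (simp add: eq_neg_iff_add_eq_0 add.commute)
      hence "- d * b \<tau> = of_real m" using \<open>d \<noteq> 0\<close> by simp
      thus ?thesis by (simp only: d_def)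
    qed
    thus ?thesis using e eventually_at_in_open[of "ball \<tau>0 e" \<tau>0] 
      by (auto elim!: eventually_mono)
  qed
  ultimately have "((\<lambda>_. complex_of_real m) \<longlongrightarrow> 0) (at \<tau>0)" by (simp cong: tendsto_cong)
  hence "complex_of_real m = 0" by (simp add: tendsto_const_iff)
  thus False using m by simp
qed

text \<open>The right half of the fundamental domain is cut out by strict inequalities, so its
  mirror image avoids the arcs and lies in the region.\<close>

lemma lower_boundary_or_region:
  assumes "\<tau> \<in> fundamental_domain p"
  shows "\<tau> \<in> lower_boundary p \<or> \<tau> \<in> region \<or> - cnj \<tau> \<in> region"
proof -
  have p0: "real p > 0" using p_pos by simp
  have arc0: "sqdist 0 z > P" if "norm z > 1 / sqrt p" for z
  proof -
    have "(1 / sqrt p) ^ 2 < norm z ^ 2" using that by (intro power_strict_mono) auto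
    thus ?thesis using p0 by (simp add: sqdist_altdef power_divide P_def)
  qed
  have arc1: "sqdist (- 1 / 2) z > P / 4" if "norm (z + 1 / 2) > 1 / (2 * sqrt p)" for z
  proof -
    have "(1 / (2 * sqrt p)) ^ 2 < norm (z + 1 / 2) ^ 2" using that by (intro power_strict_mono) auto
    thus ?thesis using p0 by (simp add: sqdist_altdef power_divide power_mult_distrib P_def)
  qed
  have small: "sqdist (- 1 / 2) z > P / 4" if "sqdist 0 z > P" "Re z \<ge> - 1 / 2" "p \<in> {1, 2, 3}" for z
    using that P123 sqdist_half(1)[of z] by auto
  have refl: "norm (- cnj \<tau>) = norm \<tau>" "norm (- cnj \<tau> + 1 / 2) = norm (\<tau> - 1 / 2)"
    by (simp_all add: cmod_def power2_commute)
  show ?thesis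
  proof (cases "Re \<tau> \<le> 0")
    case True
    show ?thesis
    proof (cases "\<tau> \<in> lower_boundary p")
      case False
      have "norm \<tau> > 1 / sqrt p" "- 1 / 2 \<le> Re \<tau>" "Im \<tau> > 0"
        using assms True False
        by (auto simp: fundamental_domain_def lower_boundary_def upper_half_plane_def split: if_splits)
      moreover have "norm (\<tau> + 1 / 2) > 1 / (2 * sqrt p)" if "p \<notin> {1, 2, 3}"
        using assms True False that
        by (auto simp: fundamental_domain_def lower_boundary_def upper_half_plane_def split: if_splits)
      ultimately show ?thesis using True arc0 arc1 small by (auto simp: region_def)
    qed simp
  next
    case False
    have "norm \<tau> > 1 / sqrt p" "Re \<tau> < 1 / 2" "Im \<tau> > 0"
      using assms False by (auto simp: fundamental_domain_def upper_half_plane_def split: if_splits)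
    moreover have "norm (\<tau> - 1 / 2) > 1 / (2 * sqrt p)" if "p \<notin> {1, 2, 3}"
      using assms False that by (auto simp: fundamental_domain_def upper_half_plane_def split: if_splits)
    ultimately show ?thesis
      using False arc0[of "- cnj \<tau>"] arc1[of "- cnj \<tau>"] small[of "- cnj \<tau>"] unfolding refl
      by (auto simp: region_def)
  qed
qed

lemma serre_zeros:
  assumes "\<tau> \<in> fundamental_domain p" "serre_derivative p k f \<tau> = 0"
  shows "\<tau> \<in> lower_boundary p"
proof -
  have Im: "Im \<tau> > 0"
    using assms(1) by (auto simp: fundamental_domain_def upper_half_plane_def split: if_splits)
  have h: "h \<tau> = 0" using assms(2) by (simp add: h_def)
  have "\<tau> \<notin> region" using h_nonzero[OF h_not_identically_0] h by blast
  moreover have "- cnj \<tau> \<notin> region"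
    using h_nonzero[OF h_not_identically_0] h h_symmetries(2)[OF Im] by force
  ultimately show ?thesis using lower_boundary_or_region[OF assms(1)] by blast
qed

end

theorem theorem1p3:
  fixes p :: nat and k :: int and f :: "complex \<Rightarrow> complex" and a :: "int \<Rightarrow> complex"
  assumes "p \<in> {1, 2, 3, 5, 7}"
    and "even k"
    and "f \<in> weakly_holomorphic_forms k p"
    and "\<exists>\<tau>\<in>upper_half_plane. f \<tau> \<noteq> 0"
    and "has_fourier_expansion f a"
    and "\<forall>n. a n \<in> \<real>"
    and "\<exists>\<tau>\<in>upper_half_plane. f \<tau> = 0"
    and "\<forall>\<tau>\<in>fundamental_domain p. f \<tau> = 0 \<longrightarrow> \<tau> \<in> lower_boundary p"
  shows "\<forall>\<tau>\<in>fundamental_domain p. serre_derivative p k f \<tau> = 0 \<longrightarrow> \<tau> \<in> lower_boundary p"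
proof -
  interpret weakly_holomorphic_setting p k f a
    by standard (use assms in auto)
  show ?thesis using serre_zeros by blast
qed

end
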